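(* Let $\alpha\beta=2$ and $\beta\ge1$. Assume that $K:\mathbb{R}\to\mathbb{R}$ is integrable and square integrable on $\mathbb{R}$, and that there exist constants $c,\delta>0$ such that $\phi_\varepsilon(u)=\mathbb{E}[e^{\iota u\varepsilon_1}]$ satisfies $|\phi_\varepsilon(u)|\le\frac{c}{1+|u|^\delta}$ for all $u\in\mathbb{R}$. If the linear process has short memory, i.e. $\sum_{j=1}^\infty a_j^{\alpha/2}H^{1/2}(a_j^{-1})<\infty$, then the limit $\theta^2=\lim_{N\to\infty}N^{-1}\mathrm{Var}(S_N)$ exists and is finite, and, as $N\to\infty$, the processes $\{N^{-1/2}S_{[Nt]}:t\ge0\}$ converge weakly in finite-dimensional distributions to $\{|\theta|W_t:t\ge0\}$, where $(W_t)_{t\ge0}$ is a standard Brownian motion.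
   Context: $\iota=\sqrt{-1}$ and $[\cdot]$ is the integer part. $\alpha\in(0,2]$. The innovations $\{\varepsilon_n\}_{n\in\mathbb{Z}}$ are i.i.d. real random variables in the domain of attraction of an $\alpha$-stable law, symmetric if $\alpha=1$ and with mean zero if $\alpha>1$. There are constants $\sigma_1,\sigma_2\ge0$ with $\sigma_1+\sigma_2>0$ and a positive function $h$, slowly varying at $\infty$, such that as $x\to\infty$, $\mathbb{P}(\varepsilon_1\le-x)=(\sigma_1+o(1))x^{-\alpha}h(x)$ and $\mathbb{P}(\varepsilon_1>x)=(\sigma_2+o(1))x^{-\alpha}h(x)$. Set $H(t):=h(t)$ if $\alpha\in(0,2)$ and $H(t):=-\int_0^ts^2\,d\big(\frac{h(s)}{s^2}\big)$ if $\alpha=2$ (Stieltjes integral, $h$ being such that it is well defined); $H$ is slowly varying at $\infty$. Coefficients: $a_j=j^{-\beta}\ell(j)$, $j\geq 1$, where $\ell:(0,\infty)\to(0,\infty)$ is slowly varying at $\infty$. The linear process is $X_n=\sum_{j=1}^\infty a_j\varepsilon_{n-j}$, $n\in\mathbb{N}$, and $S_m=\sum_{n=1}^m[K(X_n)-\mathbb{E}K(X_n)]$. (Under the decay condition on $\phi_\varepsilon$, $X_1$ has a bounded density.) *)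

theory Defs
  imports "HOL-Probability.Probability"
begin

definition slowly_varying :: "(real \<Rightarrow> real) \<Rightarrow> bool" where
  "slowly_varying f \<longleftrightarrow>
     f \<in> borel_measurable (lebesgue_on {0<..}) \<and>
     (\<forall>x>0. f x > 0) \<and>
     (\<forall>c>0. ((\<lambda>x. f (c * x) / f x) \<longlongrightarrow> 1) at_top)"

text \<open>
  The condition \<open>c\<^sup>\<alpha> = a\<^sup>\<alpha> + b\<^sup>\<alpha>\<close> on the scale of \<open>a X + b Y\<close> singles out the index;
  point masses are excluded because they would satisfy it for every \<open>\<alpha>\<close>.
\<close>
definition stable_law :: "real \<Rightarrow> real measure \<Rightarrow> bool" where
  "stable_law \<alpha> \<nu> \<longleftrightarrow>
     real_distribution \<nu> \<and>
     (\<forall>x. \<nu> \<noteq> return borel x) \<and>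
     (\<forall>a>0. \<forall>b>0. \<exists>d.
        distr (\<nu> \<Otimes>\<^sub>M \<nu>) borel (\<lambda>(x, y). a * x + b * y) =
        distr \<nu> borel (\<lambda>x. (a powr \<alpha> + b powr \<alpha>) powr (1 / \<alpha>) * x + d))"

definition in_domain_of_attraction :: "real measure \<Rightarrow> real measure \<Rightarrow> bool" where
  "in_domain_of_attraction \<mu> \<nu> \<longleftrightarrow>
     (\<exists>A B :: nat \<Rightarrow> real. (\<forall>n. B n > 0) \<and>
        weak_conv_m
          (\<lambda>n. distr (\<Pi>\<^sub>M i\<in>{..<n}. \<mu>) borel (\<lambda>x. ((\<Sum>i<n. x i) - A n) / B n)) \<nu>)"

text \<open>
  The Riemann--Stieltjes integral of \<open>f\<close> with respect to \<open>g\<close> over \<open>[a, b]\<close>, as a limit over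
  tagged divisions whose mesh tends to 0 (that is, over constant gauges).
\<close>
definition has_stieltjes_integral ::
    "(real \<Rightarrow> real) \<Rightarrow> (real \<Rightarrow> real) \<Rightarrow> real \<Rightarrow> real \<Rightarrow> real \<Rightarrow> bool" where
  "has_stieltjes_integral f g a b I \<longleftrightarrow>
     (\<forall>e>0. \<exists>d>0. \<forall>D. D tagged_division_of {a..b} \<and> (\<lambda>x. ball x d) fine D \<longrightarrow>
        \<bar>(\<Sum>(x, k)\<in>D. f x * (g (Sup k) - g (Inf k))) - I\<bar> < e)"

text \<open>The integral from 0 is improper at 0, where the integrator need not be defined.\<close>
definition has_stieltjes_integral_from_0 ::
    "(real \<Rightarrow> real) \<Rightarrow> (real \<Rightarrow> real) \<Rightarrow> real \<Rightarrow> real \<Rightarrow> bool" where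
  "has_stieltjes_integral_from_0 f g t I \<longleftrightarrow>
     (\<exists>F. (\<forall>s. 0 < s \<and> s < t \<longrightarrow> has_stieltjes_integral f g s t (F s)) \<and>
          (F \<longlongrightarrow> I) (at_right 0))"

text \<open>
  \<open>H = h\<close> if \<open>\<alpha> < 2\<close>; if \<open>\<alpha> = 2\<close>, the integral of \<open>s\<^sup>2\<close> against \<open>h(s)/s\<^sup>2\<close> over \<open>(0, t]\<close>
  exists for every \<open>t > 0\<close>, and \<open>H t\<close> is minus its value.
\<close>
definition tail_normalizer :: "real \<Rightarrow> (real \<Rightarrow> real) \<Rightarrow> (real \<Rightarrow> real) \<Rightarrow> bool" where
  "tail_normalizer \<alpha> h H \<longleftrightarrow>
     (\<forall>t>0. if \<alpha> < 2 then H t = h t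
            else has_stieltjes_integral_from_0 (\<lambda>s. s\<^sup>2) (\<lambda>s. h s / s\<^sup>2) t (- H t))"

text \<open>The coefficient \<open>a 0\<close> is not used: the series starts with \<open>a 1 * \<epsilon> (n - 1)\<close>.\<close>
definition linear_process ::
    "(nat \<Rightarrow> real) \<Rightarrow> (int \<Rightarrow> 'a \<Rightarrow> real) \<Rightarrow> nat \<Rightarrow> 'a \<Rightarrow> real" where
  "linear_process a \<epsilon> n \<omega> = (\<Sum>j. a (Suc j) * \<epsilon> (int n - int (Suc j)) \<omega>)"

definition centered_sum ::
    "'a measure \<Rightarrow> (real \<Rightarrow> real) \<Rightarrow> (nat \<Rightarrow> 'a \<Rightarrow> real) \<Rightarrow> nat \<Rightarrow> 'a \<Rightarrow> real" where
  "centered_sum M K X m \<omega> = (\<Sum>n = 1..m. (K (X n \<omega>) - (\<integral>\<omega>'. K (X n \<omega>') \<partial>M)))"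

definition standard_brownian_motion :: "'b measure \<Rightarrow> (real \<Rightarrow> 'b \<Rightarrow> real) \<Rightarrow> bool" where
  "standard_brownian_motion M W \<longleftrightarrow>
     prob_space M \<and>
     (\<forall>t\<ge>0. W t \<in> borel_measurable M) \<and>
     (AE \<omega> in M. W 0 \<omega> = 0) \<and>
     (\<forall>s t. 0 \<le> s \<and> s < t \<longrightarrow>
        distributed M lborel (\<lambda>\<omega>. W t \<omega> - W s \<omega>) (normal_density 0 (sqrt (t - s)))) \<and>
     (\<forall>(n :: nat) (t :: nat \<Rightarrow> real). 0 \<le> t 0 \<and> (\<forall>i<n. t i < t (Suc i)) \<longrightarrow>
        prob_space.indep_vars M (\<lambda>_. borel) (\<lambda>i \<omega>. W (t (Suc i)) \<omega> - W (t i) \<omega>) {..<n}) \<and>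
     (AE \<omega> in M. continuous_on {0..} (\<lambda>t. W t \<omega>))"

text \<open>
  Weak convergence of the laws of \<open>(Y N t)\<^bsub>t \<in> T\<^esub>\<close> to that of \<open>(Z t)\<^bsub>t \<in> T\<^esub>\<close>, for every finite
  set \<open>T\<close> of times. The Euclidean space with coordinates indexed by \<open>T\<close> is the product topology
  on the extensional functions on \<open>T\<close>.
\<close>
definition fdd_converges ::
    "'a measure \<Rightarrow> (nat \<Rightarrow> real \<Rightarrow> 'a \<Rightarrow> real) \<Rightarrow> 'b measure \<Rightarrow> (real \<Rightarrow> 'b \<Rightarrow> real) \<Rightarrow> bool" where
  "fdd_converges M Y M' Z \<longleftrightarrow>
     (\<forall>T (f :: (real \<Rightarrow> real) \<Rightarrow> real).
        finite T \<and> T \<subseteq> {0..} \<and>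
        continuous_map (product_topology (\<lambda>_. euclideanreal) T) euclideanreal f \<and>
        bounded (f ` (T \<rightarrow>\<^sub>E UNIV)) \<longrightarrow>
        (\<lambda>N. \<integral>\<omega>. f (\<lambda>t\<in>T. Y N t \<omega>) \<partial>M) \<longlonglongrightarrow> (\<integral>\<omega>. f (\<lambda>t\<in>T. Z t \<omega>) \<partial>M'))"

end

theory Submission
  imports Defs
begin

text \<open>
  The functional \<open>K\<close> may be discontinuous, and the innovations may have infinite variance. Two devices deal with this.

  The first is a norm adapted to bounded Lipschitz functions. Such a function feels an innovation with coefficient
  \<open>a j\<close> through \<open>min 1 \<bar>a j * \<epsilon>\<bar>\<close> only, and the mean square of this variable is a truncated second moment. By Karamata's
  theorem it is at most a multiple of \<open>(a j) powr \<alpha> * H (1 / a j)\<close>; for \<open>\<alpha> = 2\<close> this is where the definition of \<open>H\<close>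
  as an integral against \<open>h(s) / s\<^sup>2\<close> matters (\<open>truncated_moment_le_tail_normalizer\<close>). So short memory says that the
  \<open>L\<^sup>2\<close> norms \<open>clipped_norm \<mu> (a j)\<close> are summable, which is the form in which the tails enter the
  rest of the proof.

  The second device is smoothing. For \<open>k * \<delta> \<ge> 3\<close> the sum of the \<open>k\<close> most recent terms of \<open>X\<^sub>n\<close> has a characteristic
  function that decays like \<open>\<bar>u\<bar> powr (-3)\<close>, hence a bounded Lipschitz density \<open>p\<close>. The conditional expectation of
  \<open>K(X\<^sub>n)\<close> given the older innovations is a bounded Lipschitz function of the rest of the series, namely \<open>K\<close> integrated
  against translates of \<open>p\<close>, and the residuals, \<open>K(X\<^sub>n)\<close> minus this expectation, are orthogonal at lags from \<open>k\<close> on.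

  Truncate the series at lag \<open>m\<close>. The change of \<open>S\<^sub>N\<close> is at most \<open>\<eta> * sqrt N\<close> in \<open>L\<^sup>2\<close>, uniformly in \<open>N\<close>, for large \<open>m\<close>
  (\<open>truncation_error\<close>). For the residuals this follows from their orthogonality and from the convergence of each
  of them. For the smoothed part, the Efron--Stein inequality bounds the variance by the effects of resampling single
  innovations; the effect of innovation \<open>i\<close> on the term at time \<open>n\<close> is at most a multiple of the minimum of
  \<open>clipped_norm \<mu> (a (n - i))\<close> and the tail of the series of these norms, and the sum of such minima tends to 0 with
  growing \<open>m\<close>.

  The truncated terms are \<open>m\<close>-dependent. Leaving a gap of length \<open>m\<close> at the end of every block of length \<open>L\<close> gives
  independent and identically distributed block sums, so \<open>S\<^sub>N\<close> is within \<open>\<eta> * sqrt N + c\<close> of a random walk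
  (\<open>block_approximation\<close>). The variance of \<open>S\<^sub>N / sqrt N\<close> is therefore a Cauchy sequence, and the limit theorem for the
  finite-dimensional distributions of random walks passes to \<open>S\<^sub>N\<close> as \<open>\<eta>\<close> tends to 0
  (\<open>normalized_norm2_convergent\<close>, \<open>block_approximable_fdd\<close>).
\<close>

section \<open>Square-integrable functions\<close>

text \<open>Integrability of \<open>f\<^sup>2\<close> does not make \<open>f\<close> itself measurable, hence the first conjunct.\<close>
definition square_integrable :: "'a measure \<Rightarrow> ('a \<Rightarrow> real) \<Rightarrow> bool" where
  "square_integrable M f \<longleftrightarrow> f \<in> borel_measurable M \<and> integrable M (\<lambda>x. (f x)\<^sup>2)"

definition norm2 :: "'a measure \<Rightarrow> ('a \<Rightarrow> real) \<Rightarrow> real" where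
  "norm2 M f = sqrt (\<integral>x. (f x)\<^sup>2 \<partial>M)"

lemma norm2_nonneg [simp]: "norm2 M f \<ge> 0"
  unfolding norm2_def by simp

lemma norm2_squared: "(norm2 M f)\<^sup>2 = (\<integral>x. (f x)\<^sup>2 \<partial>M)"
  unfolding norm2_def by simp

lemma square_integrable_measurable: "square_integrable M f \<Longrightarrow> f \<in> borel_measurable M"
  unfolding square_integrable_def by simp

lemma square_integrable_mult:
  assumes "square_integrable M f" "square_integrable M g"
  shows "integrable M (\<lambda>x. f x * g x)"
proof (rule Bochner_Integration.integrable_bound[where f="\<lambda>x. (f x)\<^sup>2 + (g x)\<^sup>2"])
  show "integrable M (\<lambda>x. (f x)\<^sup>2 + (g x)\<^sup>2)"
    using assms unfolding square_integrable_def by simp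
  show "(\<lambda>x. f x * g x) \<in> borel_measurable M"
    using assms unfolding square_integrable_def by (intro borel_measurable_times) auto
  have "\<bar>u * v\<bar> \<le> u\<^sup>2 + v\<^sup>2" for u v :: real
  proof -
    have "0 \<le> (\<bar>u\<bar> - \<bar>v\<bar>)\<^sup>2" by simp
    then have "2 * (\<bar>u\<bar> * \<bar>v\<bar>) \<le> u\<^sup>2 + v\<^sup>2" by (simp add: power2_diff)
    moreover have "0 \<le> \<bar>u\<bar> * \<bar>v\<bar>" by simp
    ultimately show ?thesis unfolding abs_mult by linarith
  qed
  then show "AE x in M. norm (f x * g x) \<le> norm ((f x)\<^sup>2 + (g x)\<^sup>2)" by simp
qed

lemma square_integrable_add:
  assumes "square_integrable M f" "square_integrable M g"
  shows "square_integrable M (\<lambda>x. f x + g x)"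
  using assms square_integrable_mult[OF assms]
  unfolding square_integrable_def by (auto simp: power2_sum mult.assoc)

lemma square_integrable_cmult:
  "square_integrable M f \<Longrightarrow> square_integrable M (\<lambda>x. c * f x)"
  unfolding square_integrable_def by (auto simp: power_mult_distrib)

lemma square_integrable_diff:
  assumes "square_integrable M f" "square_integrable M g"
  shows "square_integrable M (\<lambda>x. f x - g x)"
  using square_integrable_add[OF assms(1) square_integrable_cmult[OF assms(2), of "-1"]] by simp

lemma square_integrable_zero [simp]: "square_integrable M (\<lambda>x. 0)"
  unfolding square_integrable_def by simp

lemma square_integrable_sum:
  "(\<And>i. i \<in> I \<Longrightarrow> square_integrable M (f i)) \<Longrightarrow> square_integrable M (\<lambda>x. \<Sum>i\<in>I. f i x)"
  by (induction I rule: infinite_finite_induct) (auto intro: square_integrable_add)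

lemma square_integrable_bound:
  assumes "square_integrable M g" "f \<in> borel_measurable M" "AE x in M. \<bar>f x\<bar> \<le> \<bar>g x\<bar>"
  shows "square_integrable M f"
  unfolding square_integrable_def
proof
  show "integrable M (\<lambda>x. (f x)\<^sup>2)"
    by (rule Bochner_Integration.integrable_bound[where f="\<lambda>x. (g x)\<^sup>2"])
      (use assms in \<open>auto simp: square_integrable_def abs_le_square_iff\<close>)
qed fact

lemma (in finite_measure) square_integrable_bounded:
  assumes "f \<in> borel_measurable M" "\<And>x. x \<in> space M \<Longrightarrow> \<bar>f x\<bar> \<le> B"
  shows "square_integrable M f"
proof (rule square_integrable_bound[where g="\<lambda>_. B"])
  show "square_integrable M (\<lambda>_. B)" unfolding square_integrable_def by simp
  show "AE x in M. \<bar>f x\<bar> \<le> \<bar>B\<bar>" using assms(2) by (fastforce intro: AE_I2)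
qed fact

lemma (in finite_measure) square_integrable_integrable:
  "square_integrable M f \<Longrightarrow> integrable M f"
  unfolding square_integrable_def by (auto intro: square_integrable_imp_integrable)

lemma norm2_mono:
  assumes "square_integrable M g" "f \<in> borel_measurable M" "AE x in M. \<bar>f x\<bar> \<le> \<bar>g x\<bar>"
  shows "norm2 M f \<le> norm2 M g"
  unfolding norm2_def
  using assms square_integrable_bound[OF assms]
  by (auto intro!: integral_mono_AE simp: square_integrable_def abs_le_square_iff)

lemma norm2_cmult: "norm2 M (\<lambda>x. c * f x) = \<bar>c\<bar> * norm2 M f"
  unfolding norm2_def by (simp add: power_mult_distrib real_sqrt_mult)

lemma norm2_minus_commute: "norm2 M (\<lambda>x. f x - g x) = norm2 M (\<lambda>x. g x - f x)"
  unfolding norm2_def by (simp add: power2_commute)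

lemma norm2_Cauchy_Schwarz:
  assumes f: "square_integrable M f" and g: "square_integrable M g"
  shows "\<bar>\<integral>x. f x * g x \<partial>M\<bar> \<le> norm2 M f * norm2 M g"
proof -
  define A where "A = (\<integral>x. (f x)\<^sup>2 \<partial>M)"
  define B where "B = (\<integral>x. (g x)\<^sup>2 \<partial>M)"
  define P where "P = (\<integral>x. f x * g x \<partial>M)"
  have fi: "integrable M (\<lambda>x. (f x)\<^sup>2)" and gi: "integrable M (\<lambda>x. (g x)\<^sup>2)"
    using f g by (auto simp: square_integrable_def)
  note fg = square_integrable_mult[OF f g]
  have nn: "A \<ge> 0" "B \<ge> 0" unfolding A_def B_def by simp_all
  have "P\<^sup>2 \<le> A * B"
  proof (cases "B = 0")
    case True
    then have "AE x in M. (g x)\<^sup>2 = 0"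
      using integral_nonneg_eq_0_iff_AE[OF gi] by (simp add: B_def)
    then have "AE x in M. f x * g x = 0" by auto
    then have "P = 0" unfolding P_def by (simp add: integral_eq_zero_AE)
    then show ?thesis using True by simp
  next
    case False
    have "0 \<le> (\<integral>x. (B * f x - P * g x)\<^sup>2 \<partial>M)" by simp
    also have "\<dots> = (\<integral>x. B\<^sup>2 * (f x)\<^sup>2 + P\<^sup>2 * (g x)\<^sup>2 - 2 * B * P * (f x * g x) \<partial>M)"
      by (rule Bochner_Integration.integral_cong) (auto simp: power2_diff power_mult_distrib algebra_simps)
    also have "\<dots> = B\<^sup>2 * A + P\<^sup>2 * B - 2 * B * P * P"
      using fi gi fg by (simp add: A_def B_def P_def)
    also have "\<dots> = B * (A * B - P\<^sup>2)" by (simp add: power2_eq_square algebra_simps)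
    finally have "0 \<le> A * B - P\<^sup>2"
      using False nn by (simp add: zero_le_mult_iff)
    then show ?thesis by simp
  qed
  then have "\<bar>P\<bar> \<le> sqrt (A * B)" using real_le_rsqrt[of "\<bar>P\<bar>" "A * B"] by simp
  then show ?thesis unfolding norm2_def P_def A_def B_def by (simp add: real_sqrt_mult)
qed

lemma norm2_add:
  assumes f: "square_integrable M f" and g: "square_integrable M g"
  shows "norm2 M (\<lambda>x. f x + g x) \<le> norm2 M f + norm2 M g"
proof (rule power2_le_imp_le)
  have "(norm2 M (\<lambda>x. f x + g x))\<^sup>2 = (\<integral>x. (f x)\<^sup>2 + (g x)\<^sup>2 + 2 * (f x * g x) \<partial>M)"
    unfolding norm2_squared by (simp add: power2_sum mult.assoc)
  also have "\<dots> = (norm2 M f)\<^sup>2 + (norm2 M g)\<^sup>2 + 2 * (\<integral>x. f x * g x \<partial>M)"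
    unfolding norm2_squared using f g square_integrable_mult[OF f g]
    by (simp add: square_integrable_def)
  also have "\<dots> \<le> (norm2 M f + norm2 M g)\<^sup>2"
    using norm2_Cauchy_Schwarz[OF f g] by (simp add: power2_sum mult.assoc)
  finally show "(norm2 M (\<lambda>x. f x + g x))\<^sup>2 \<le> (norm2 M f + norm2 M g)\<^sup>2" .
qed simp

lemma norm2_zero [simp]: "norm2 M (\<lambda>x. 0) = 0"
  unfolding norm2_def by simp

lemma norm2_diff:
  assumes f: "square_integrable M f" and g: "square_integrable M g"
  shows "norm2 M (\<lambda>x. f x - g x) \<le> norm2 M f + norm2 M g"
  using norm2_add[OF f square_integrable_cmult[OF g, of "-1"]] norm2_cmult[of M "-1" g] by simp

lemma norm2_triangle_diff:
  assumes "square_integrable M f" "square_integrable M g" "square_integrable M h"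
  shows "norm2 M (\<lambda>x. f x - h x) \<le> norm2 M (\<lambda>x. f x - g x) + norm2 M (\<lambda>x. g x - h x)"
  using norm2_add[OF square_integrable_diff[OF assms(1,2)] square_integrable_diff[OF assms(2,3)]]
  by simp

lemma norm2_abs_diff:
  assumes f: "square_integrable M f" and g: "square_integrable M g"
  shows "\<bar>norm2 M f - norm2 M g\<bar> \<le> norm2 M (\<lambda>x. f x - g x)"
  using norm2_triangle_diff[OF f g square_integrable_zero]
    norm2_triangle_diff[OF g f square_integrable_zero] norm2_minus_commute[of M f g] by simp

lemma norm2_sum:
  assumes "\<And>i. i \<in> I \<Longrightarrow> square_integrable M (f i)"
  shows "norm2 M (\<lambda>x. \<Sum>i\<in>I. f i x) \<le> (\<Sum>i\<in>I. norm2 M (f i))"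
  using assms
proof (induction I rule: infinite_finite_induct)
  case (insert i I)
  have "norm2 M (\<lambda>x. f i x + (\<Sum>i\<in>I. f i x)) \<le> norm2 M (f i) + norm2 M (\<lambda>x. \<Sum>i\<in>I. f i x)"
    using insert by (intro norm2_add square_integrable_sum) auto
  then show ?case using insert by fastforce
qed auto

lemma (in prob_space) square_integrable_const [simp]: "square_integrable M (\<lambda>_. c)"
  unfolding square_integrable_def by simp

lemma (in prob_space) abs_expectation_le_norm2:
  assumes "square_integrable M f"
  shows "\<bar>expectation f\<bar> \<le> norm2 M f"
  using norm2_Cauchy_Schwarz[OF assms square_integrable_const[of 1]]
  by (simp add: norm2_def prob_space)

lemma (in prob_space) norm2_centered:
  assumes "square_integrable M f"
  shows "norm2 M (\<lambda>x. f x - expectation f) \<le> norm2 M f"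
proof -
  have "(\<integral>x. (f x - expectation f)\<^sup>2 \<partial>M) \<le> (\<integral>x. (f x)\<^sup>2 \<partial>M)"
    using assms square_integrable_integrable[OF assms]
    by (subst variance_eq) (auto simp: square_integrable_def)
  then show ?thesis unfolding norm2_def by simp
qed

text \<open>
  A summand is orthogonal to all but fewer than \<open>2 * m\<close> of the summands, so about \<open>2 * m * card I\<close> products
  survive in the expanded square, and each is at most \<open>s\<^sup>2\<close> by Cauchy--Schwarz. This is the variance bound
  for everything with a finite range of dependence.
\<close>
lemma norm2_sum_lag_orthogonal:
  fixes Z :: "nat \<Rightarrow> 'a \<Rightarrow> real"
  assumes Z: "\<And>n. n \<in> I \<Longrightarrow> square_integrable M (Z n)"
    and s: "\<And>n. n \<in> I \<Longrightarrow> norm2 M (Z n) \<le> s"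
    and orth: "\<And>n l. n \<in> I \<Longrightarrow> l \<in> I \<Longrightarrow> l + m \<le> n \<Longrightarrow> (\<integral>x. Z n x * Z l x \<partial>M) = 0"
    and fin: "finite I"
  shows "(norm2 M (\<lambda>x. \<Sum>n\<in>I. Z n x))\<^sup>2 \<le> 2 * real m * real (card I) * s\<^sup>2"
proof (cases "I = {}")
  case False
  then obtain n0 where "n0 \<in> I" by auto
  with s[OF this] have s0: "s \<ge> 0" using norm2_nonneg[of M "Z n0"] by linarith
  have int: "integrable M (\<lambda>x. Z n x * Z l x)" if "n \<in> I" "l \<in> I" for n l
    using that Z by (intro square_integrable_mult) auto
  have "(norm2 M (\<lambda>x. \<Sum>n\<in>I. Z n x))\<^sup>2 = (\<integral>x. (\<Sum>n\<in>I. \<Sum>l\<in>I. Z n x * Z l x) \<partial>M)"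
    unfolding norm2_squared by (simp add: power2_eq_square sum_product)
  also have "\<dots> = (\<Sum>n\<in>I. \<integral>x. (\<Sum>l\<in>I. Z n x * Z l x) \<partial>M)"
    by (intro Bochner_Integration.integral_sum Bochner_Integration.integrable_sum int)
  also have "\<dots> = (\<Sum>n\<in>I. \<Sum>l\<in>I. \<integral>x. Z n x * Z l x \<partial>M)"
    by (intro sum.cong refl Bochner_Integration.integral_sum int)
  also have "\<dots> \<le> (\<Sum>n\<in>I. 2 * real m * s\<^sup>2)"
  proof (rule sum_mono)
    fix n assume n: "n \<in> I"
    have "(\<Sum>l\<in>I. \<integral>x. Z n x * Z l x \<partial>M) = (\<Sum>l\<in>I \<inter> {n+1-m..<n+m}. \<integral>x. Z n x * Z l x \<partial>M)"
    proof (rule sum.mono_neutral_right)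
      show "\<forall>l\<in>I - I \<inter> {n+1-m..<n+m}. (\<integral>x. Z n x * Z l x \<partial>M) = 0"
      proof
        fix l assume l: "l \<in> I - I \<inter> {n+1-m..<n+m}"
        then consider "l + m \<le> n" | "n + m \<le> l" by fastforce
        then show "(\<integral>x. Z n x * Z l x \<partial>M) = 0"
          using orth[of n l] orth[of l n] n l by cases (auto simp: mult.commute)
      qed
    qed (use fin in auto)
    also have "\<dots> \<le> (\<Sum>l\<in>I \<inter> {n+1-m..<n+m}. s\<^sup>2)"
    proof (rule sum_mono)
      fix l assume l: "l \<in> I \<inter> {n+1-m..<n+m}"
      have "(\<integral>x. Z n x * Z l x \<partial>M) \<le> norm2 M (Z n) * norm2 M (Z l)"
        using norm2_Cauchy_Schwarz[OF Z[OF n] Z[of l]] l by simp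
      also have "\<dots> \<le> s * s"
        using s n l s0 by (intro mult_mono) auto
      finally show "(\<integral>x. Z n x * Z l x \<partial>M) \<le> s\<^sup>2" by (simp add: power2_eq_square)
    qed
    also have "\<dots> = real (card (I \<inter> {n+1-m..<n+m})) * s\<^sup>2" by simp
    also have "\<dots> \<le> real (2 * m) * s\<^sup>2"
    proof -
      have "card (I \<inter> {n+1-m..<n+m}) \<le> card {n+1-m..<n+m}" by (intro card_mono) auto
      also have "\<dots> \<le> 2 * m" by simp
      finally show ?thesis by (intro mult_right_mono) auto
    qed
    finally show "(\<Sum>l\<in>I. \<integral>x. Z n x * Z l x \<partial>M) \<le> 2 * real m * s\<^sup>2" by simp
  qed
  also have "\<dots> = 2 * real m * real (card I) * s\<^sup>2" by simp
  finally show ?thesis .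
qed (simp add: norm2_def)

section \<open>Densities from characteristic functions\<close>

lemma norm_iexp_diff_le:
  fixes x y :: real
  shows "cmod (iexp x - iexp y) \<le> \<bar>x - y\<bar>"
proof -
  have "iexp x - iexp y = iexp y * (iexp (x - y) - 1)"
    by (simp add: algebra_simps exp_diff)
  then have "cmod (iexp x - iexp y) = cmod (iexp (x - y) - 1)"
    by (simp add: norm_mult)
  also have "\<dots> \<le> \<bar>x - y\<bar>" using iexp_approx1[of "x - y" 0] by simp
  finally show ?thesis .
qed

lemma (in finite_borel_measure) no_atoms_dense:
  fixes a b :: real
  assumes "a < b"
  obtains x where "a < x" "x < b" "measure M {x} = 0"
proof -
  have "\<not> {a<..<b} \<subseteq> {x. measure M {x} > 0}"
    using countable_atoms countable_subset assms uncountable_open_interval[of a b] by blast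
  then show ?thesis using that using measure_nonneg[of M] by (force simp: not_less order.order_iff_strict)
qed

text \<open>
  Fourier inversion: the density is \<open>p x = (1 / 2\<pi>) \<integral> e\<^bsup>-iux\<^esup> \<phi>(u) du\<close>. Integrability of the majorant \<open>w\<close> of
  \<open>\<phi>\<close> bounds \<open>p\<close>, and integrability of \<open>\<bar>u\<bar> * w u\<close> makes it Lipschitz. The inversion formula of Levy and
  Fubini's theorem identify the mass of an interval with the integral of \<open>p\<close> over it, at first only when the
  end points carry no mass.
\<close>
lemma (in real_distribution) lipschitz_density_of_integrable_char:
  fixes w :: "real \<Rightarrow> real"
  assumes w: "integrable lborel w" and uw: "integrable lborel (\<lambda>u. \<bar>u\<bar> * w u)"
    and bound: "\<And>u. cmod (char M u) \<le> w u"
    and C: "C \<ge> (\<integral>u. w u \<partial>lborel) / (2 * pi)" "C \<ge> (\<integral>u. \<bar>u\<bar> * w u \<partial>lborel) / (2 * pi)"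
  obtains p where "p \<in> borel_measurable borel" "M = density lborel (\<lambda>x. ennreal (p x))"
    "\<And>x. 0 \<le> p x" "\<And>x. p x \<le> C" "\<And>x y. \<bar>p x - p y\<bar> \<le> C * \<bar>x - y\<bar>"
proof -
  define \<phi> where "\<phi> = char M"
  have [measurable]: "\<phi> \<in> borel_measurable borel" unfolding \<phi>_def by simp
  have [measurable]: "w \<in> borel_measurable borel" using w by auto
  have w0: "0 \<le> w u" for u using bound[of u] norm_ge_zero order_trans by blast
  have \<phi>w: "cmod (\<phi> u) \<le> w u" for u using bound by (simp add: \<phi>_def)
  define P where "P x = (CLBINT u. iexp (-(u * x)) * \<phi> u) / (2 * pi)" for x
  define p where "p x = Re (P x)" for x
  have int1: "complex_integrable lborel (\<lambda>u. iexp (-(u * x)) * \<phi> u)" for x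
    by (rule Bochner_Integration.integrable_bound[OF w]) (auto simp: norm_mult \<phi>w w0)
  have P_le: "cmod (P x) \<le> C" for x
  proof -
    have "cmod (CLBINT u. iexp (-(u * x)) * \<phi> u) \<le> (\<integral>u. w u \<partial>lborel)"
      by (rule Bochner_Integration.integral_norm_bound_integral[OF int1 w]) (simp add: norm_mult \<phi>w)
    then have "cmod (P x) \<le> (\<integral>u. w u \<partial>lborel) / (2 * pi)"
      unfolding P_def by (simp add: norm_divide divide_right_mono)
    then show ?thesis using C by linarith
  qed
  have P_lip: "cmod (P x - P y) \<le> C * \<bar>x - y\<bar>" for x y
  proof -
    have "cmod (CLBINT u. iexp (-(u * x)) * \<phi> u - iexp (-(u * y)) * \<phi> u)
        \<le> (\<integral>u. \<bar>x - y\<bar> * (\<bar>u\<bar> * w u) \<partial>lborel)"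
    proof (rule Bochner_Integration.integral_norm_bound_integral)
      fix u
      have "cmod (iexp (-(u * x)) * \<phi> u - iexp (-(u * y)) * \<phi> u)
          = cmod (iexp (-(u * x)) - iexp (-(u * y))) * cmod (\<phi> u)"
        by (simp only: norm_mult[symmetric] left_diff_distrib)
      also have "\<dots> \<le> \<bar>-(u * x) - -(u * y)\<bar> * w u"
        by (intro mult_mono norm_iexp_diff_le \<phi>w) auto
      also have "-(u * x) - -(u * y) = u * (y - x)" by (simp add: algebra_simps)
      finally show "cmod (iexp (-(u * x)) * \<phi> u - iexp (-(u * y)) * \<phi> u) \<le> \<bar>x - y\<bar> * (\<bar>u\<bar> * w u)"
        by (simp add: abs_mult abs_minus_commute mult_ac)
    qed (use int1 uw in auto)
    then have "cmod (CLBINT u. iexp (-(u * x)) * \<phi> u - iexp (-(u * y)) * \<phi> u)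
        \<le> \<bar>x - y\<bar> * (\<integral>u. \<bar>u\<bar> * w u \<partial>lborel)" by simp
    also have "(CLBINT u. iexp (-(u * x)) * \<phi> u - iexp (-(u * y)) * \<phi> u) = (P x - P y) * (2 * pi)"
      using int1 by (simp add: P_def diff_divide_distrib[symmetric])
    finally have "cmod (P x - P y) * (2 * pi) \<le> \<bar>x - y\<bar> * (\<integral>u. \<bar>u\<bar> * w u \<partial>lborel)"
      by (simp add: norm_mult)
    then have "cmod (P x - P y) \<le> \<bar>x - y\<bar> * ((\<integral>u. \<bar>u\<bar> * w u \<partial>lborel) / (2 * pi))"
      by (simp add: field_simps)
    also have "\<dots> \<le> \<bar>x - y\<bar> * C" by (intro mult_left_mono C) auto
    finally show ?thesis by (simp add: mult.commute)
  qed
  have p_le: "\<bar>p x\<bar> \<le> C" for x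
    using P_le[of x] abs_Re_le_cmod[of "P x"] by (simp add: p_def)
  have p_lip: "\<bar>p x - p y\<bar> \<le> C * \<bar>x - y\<bar>" for x y
    using P_lip[of x y] abs_Re_le_cmod[of "P x - P y"] by (simp add: p_def)
  have C0: "0 \<le> C" using p_le[of 0] by linarith
  have cont_P: "continuous_on UNIV P"
    unfolding continuous_on_iff
  proof safe
    fix x e :: real assume "0 < e"
    have "dist (P y) (P x) < e" if "dist y x < e / (C + 1)" for y
    proof -
      have "dist (P y) (P x) \<le> C * \<bar>y - x\<bar>" using P_lip by (simp add: dist_norm)
      also have "\<dots> \<le> C * (e / (C + 1))"
        using that C0 by (intro mult_left_mono) (auto simp: dist_real_def)
      also have "\<dots> < e" using \<open>0 < e\<close> C0 by (simp add: field_simps)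
      finally show ?thesis .
    qed
    then show "\<exists>d>0. \<forall>x'\<in>UNIV. dist x' x < d \<longrightarrow> dist (P x') (P x) < e"
      using \<open>0 < e\<close> C0 by (intro exI[of _ "e / (C + 1)"]) auto
  qed
  then have [measurable]: "P \<in> borel_measurable borel" by (rule borel_measurable_continuous_onI)
  have [measurable]: "p \<in> borel_measurable borel" unfolding p_def by measurable
  have int_p: "integrable lborel (\<lambda>x. indicator {a..b} x * p x)" for a b
    by (rule integrableI_bounded_set[where A="{a..b}" and B=C])
      (use p_le in \<open>auto simp: indicator_def emeasure_lborel_Icc_eq\<close>)
  \<comment> \<open>inversion formula for intervals whose end points have mass 0\<close>
  have inv: "measure M {a<..b} = (\<integral>x. indicator {a..b} x * p x \<partial>lborel)"
    if ab: "a \<le> b" and at: "measure M {a} = 0" "measure M {b} = 0" for a b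
  proof -
    define F where "F t = (iexp (-(t * a)) - iexp (-(t * b))) / (\<i> * t)" for t :: real
    have [measurable]: "F \<in> borel_measurable borel" unfolding F_def by measurable
    have F_le: "cmod (F t) \<le> b - a" for t
    proof (cases "t = 0")
      case False
      then show ?thesis using Levy_Inversion_aux2[of "-b" "-a" t] ab by (simp add: F_def)
    qed (use ab in \<open>simp add: F_def\<close>)
    have "(\<lambda>T::nat. 1 / (2 * pi) * (CLBINT t=-(real T)..real T. F t * \<phi> t)) \<longlonglongrightarrow> measure M {a<..b}"
      using Levy_Inversion[OF ab at] unfolding F_def \<phi>_def by simp
    moreover have "(\<lambda>T::nat. 1 / (2 * pi) * (CLBINT t=-(real T)..real T. F t * \<phi> t))
        \<longlonglongrightarrow> 1 / (2 * pi) * (CLBINT t. F t * \<phi> t)"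
    proof (rule tendsto_mult_left)
      have eq: "(CLBINT t=-(real T)..real T. F t * \<phi> t)
          = (CLBINT t. indicator {-(real T)<..<real T} t *\<^sub>R (F t * \<phi> t))" for T :: nat
        by (simp add: interval_lebesgue_integral_def set_lebesgue_integral_def)
      show "(\<lambda>T::nat. (CLBINT t=-(real T)..real T. F t * \<phi> t)) \<longlonglongrightarrow> (CLBINT t. F t * \<phi> t)"
        unfolding eq
      proof (rule integral_dominated_convergence[where w="\<lambda>t. (b - a) * w t"])
        show "AE x in lborel. (\<lambda>T::nat. indicator {-(real T)<..<real T} x *\<^sub>R (F x * \<phi> x)) \<longlonglongrightarrow> F x * \<phi> x"
        proof (rule AE_I2)
          fix x :: real
          have "\<forall>\<^sub>F T in sequentially. indicator {-(real T)<..<real T} x *\<^sub>R (F x * \<phi> x) = F x * \<phi> x"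
            using eventually_gt_at_top[of "nat \<lceil>\<bar>x\<bar>\<rceil>"]
            by eventually_elim (auto simp: indicator_def, linarith+)
          then show "(\<lambda>T::nat. indicator {-(real T)<..<real T} x *\<^sub>R (F x * \<phi> x)) \<longlonglongrightarrow> F x * \<phi> x"
            by (rule tendsto_eventually)
        qed
        have "cmod (F x * \<phi> x) \<le> (b - a) * w x" for x
          unfolding norm_mult using ab by (intro mult_mono F_le \<phi>w) auto
        then show "AE x in lborel. cmod (indicator {-(real T)<..<real T} x *\<^sub>R (F x * \<phi> x)) \<le> (b - a) * w x" for T :: nat
          using ab w0 by (auto simp: indicator_def)
      qed (use w in auto)
    qed
    ultimately have "complex_of_real (measure M {a<..b}) = 1 / (2 * pi) * (CLBINT t. F t * \<phi> t)"
      by (rule LIMSEQ_unique)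
    also have "(CLBINT t. F t * \<phi> t) = (CLBINT t. (CLBINT x. indicator {a..b} x *\<^sub>R (iexp (-(t * x)) * \<phi> t)))"
    proof (rule integral_cong_AE)
      have "F t * \<phi> t = (CLBINT x. indicator {a..b} x *\<^sub>R (iexp (-(t * x)) * \<phi> t))" if t: "t \<noteq> 0" for t
      proof -
        have "(CLBINT x. indicator {a..b} x *\<^sub>R (iexp (-(t * x)) * \<phi> t))
            = (iexp (-(t * b)) / (- \<i> * t) * \<phi> t) - (iexp (-(t * a)) / (- \<i> * t) * \<phi> t)"
        proof (rule integral_FTC_Icc[OF ab])
          fix x
          show "((\<lambda>x. iexp (-(t * x)) / (- \<i> * t) * \<phi> t) has_vector_derivative iexp (-(t * x)) * \<phi> t) (at x within {a..b})"
          proof -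
            have "((\<lambda>x. exp (- \<i> * t * of_real x) / (- \<i> * t) * \<phi> t) has_vector_derivative
               (exp (- \<i> * t * of_real x) * (- \<i> * t)) / (- \<i> * t) * \<phi> t) (at x within {a..b})"
              by (rule has_vector_derivative_real_field) (auto intro!: derivative_eq_intros simp: t)
            then show ?thesis using t by (simp add: mult.assoc)
          qed
        next
          show "continuous_on {a..b} (\<lambda>x. iexp (-(t * x)) * \<phi> t)" by (intro continuous_intros)
        qed
        also have "\<dots> = F t * \<phi> t"
          using t by (simp add: F_def field_simps)
        finally show ?thesis by simp
      qed
      then show "AE t in lborel. F t * \<phi> t = (CLBINT x. indicator {a..b} x *\<^sub>R (iexp (-(t * x)) * \<phi> t))"
        using AE_lborel_singleton[of 0] by auto
    qed measurable
    also have "\<dots> = (CLBINT x. (CLBINT t. indicator {a..b} x *\<^sub>R (iexp (-(t * x)) * \<phi> t)))"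
    proof (rule lborel_pair.Fubini_integral)
      have "integrable (lborel \<Otimes>\<^sub>M lborel) (\<lambda>(t, x). indicator {a..b} x *\<^sub>R (iexp (-(t * x)) * \<phi> t))"
      proof (rule lborel_pair.Fubini_integrable)
        have "(CLBINT y. complex_of_real (indicator {a..b} y * w t)) = (b - a) * w t" for t
          using ab by simp
        have "(LBINT y. norm (indicator {a..b} y *\<^sub>R (iexp (-(t * y)) * \<phi> t))) = (b - a) * cmod (\<phi> t)" for t
          using ab by (simp add: norm_mult)
        moreover have "integrable lborel (\<lambda>t. (b - a) * cmod (\<phi> t))"
          by (rule Bochner_Integration.integrable_bound[where f="\<lambda>t. (b - a) * w t"])
            (use w \<phi>w w0 ab in \<open>auto intro!: AE_I2 mult_left_mono simp: abs_mult\<close>)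
        ultimately show "integrable lborel (\<lambda>t. LBINT y. norm (case (t, y) of (t, x) \<Rightarrow> indicator {a..b} x *\<^sub>R (iexp (-(t * x)) * \<phi> t)))"
          by simp
        show "AE t in lborel. complex_integrable lborel (\<lambda>y. case (t, y) of (t, x) \<Rightarrow> indicator {a..b} x *\<^sub>R (iexp (-(t * x)) * \<phi> t))"
        proof (rule AE_I2)
          fix t
          show "complex_integrable lborel (\<lambda>y. case (t, y) of (t, x) \<Rightarrow> indicator {a..b} x *\<^sub>R (iexp (-(t * x)) * \<phi> t))"
            by (rule integrableI_bounded_set[where A="{a..b}" and B="cmod (\<phi> t)"])
              (auto simp: indicator_def emeasure_lborel_Icc_eq norm_mult)
        qed
      qed measurable
      then show "integrable (lborel \<Otimes>\<^sub>M lborel) (\<lambda>(x, t). indicator {a..b} x *\<^sub>R (iexp (-(t * x)) * \<phi> t))"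
        using lborel_pair.integrable_product_swap_iff by fastforce
    qed
    also have "(CLBINT x. (CLBINT t. indicator {a..b} x *\<^sub>R (iexp (-(t * x)) * \<phi> t)))
        = (2 * pi) * (CLBINT x. indicator {a..b} x *\<^sub>R P x)"
      unfolding integral_mult_right_zero[symmetric]
      by (rule Bochner_Integration.integral_cong) (auto simp: P_def)
    also have "1 / (2 * pi) * \<dots> = (CLBINT x. indicator {a..b} x *\<^sub>R P x)"
      by simp
    finally have "measure M {a<..b} = Re (CLBINT x. indicator {a..b} x *\<^sub>R P x)"
      by (metis Re_complex_of_real)
    also have "\<dots> = (LBINT x. Re (indicator {a..b} x *\<^sub>R P x))"
    proof (rule integral_Re[symmetric])
      show "complex_integrable lborel (\<lambda>x. indicator {a..b} x *\<^sub>R P x)"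
        by (rule integrableI_bounded_set[where A="{a..b}" and B=C])
          (use P_le in \<open>auto simp: indicator_def emeasure_lborel_Icc_eq\<close>)
    qed
    finally show ?thesis by (simp add: p_def)
  qed
  have int_c: "integrable lborel (\<lambda>x. indicator {a..b} x * c)" for a b c :: real
    by (rule integrable_mult_left) (simp add: emeasure_lborel_Icc_eq)
  have int_p_le: "(LBINT x. indicator {a..b} x * p x) \<le> C * (b - a)" if "a \<le> b" for a b
  proof -
    have "(LBINT x. indicator {a..b} x * p x) \<le> (LBINT x. indicator {a..b} x * C)"
      using p_le by (intro integral_mono int_p int_c mult_left_mono) (auto simp: abs_le_iff)
    then show ?thesis using that by (simp add: mult.commute)
  qed
  \<comment> \<open>points of mass 0 are dense, so \<open>x\<close> lies in arbitrarily short intervals to which \<open>inv\<close> applies\<close>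
  have atom: "measure M {x} = 0" for x
  proof (rule ccontr)
    assume "measure M {x} \<noteq> 0"
    then have pos: "measure M {x} > 0" by (simp add: zero_less_measure_iff)
    define e where "e = measure M {x} / (2 * C + 1)"
    have e: "e > 0" using pos C0 by (simp add: e_def)
    obtain a where a: "x - e < a" "a < x" "measure M {a} = 0"
      using no_atoms_dense[of "x - e" x] e by auto
    obtain b where b: "x < b" "b < x + e" "measure M {b} = 0"
      using no_atoms_dense[of x "x + e"] e by auto
    have "measure M {x} \<le> measure M {a<..b}"
      using a b by (intro finite_measure_mono) auto
    also have "\<dots> \<le> C * (b - a)" using inv[of a b] int_p_le[of a b] a b by simp
    also have "\<dots> \<le> C * (2 * e)" using a b C0 by (intro mult_left_mono) auto
    also have "\<dots> < measure M {x}" using pos C0 by (simp add: e_def field_simps)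
    finally show False by simp
  qed
  \<comment> \<open>if \<open>p x < 0\<close>, a short interval to the right of \<open>x\<close> would have negative mass\<close>
  have p0: "p x \<ge> 0" for x
  proof (rule ccontr)
    assume "\<not> p x \<ge> 0"
    then have neg: "p x < 0" by simp
    define d where "d = - p x / (2 * (C + 1))"
    have d: "d > 0" unfolding d_def using neg C0 by (intro divide_pos_pos) auto
    have le: "p y \<le> p x / 2" if "y \<in> {x..x+d}" for y
    proof -
      have "p y - p x \<le> C * \<bar>y - x\<bar>" using p_lip[of y x] by linarith
      also have "\<dots> \<le> (C + 1) * d" using that C0 by (intro mult_mono) auto
      also have "\<dots> = - p x / 2" using C0 by (simp add: d_def field_simps)
      finally show ?thesis by simp
    qed
    have "0 \<le> measure M {x<..x+d}" by simp
    also have "\<dots> = (LBINT y. indicator {x..x+d} y * p y)" using d atom by (intro inv) auto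
    also have "\<dots> \<le> (LBINT y. indicator {x..x+d} y * (p x / 2))"
      using le by (intro integral_mono int_p int_c) (auto simp: indicator_def)
    also have "\<dots> = d * (p x / 2)" using d by simp
    also have "\<dots> < 0" using d neg by (simp add: mult_pos_neg)
    finally show False by simp
  qed
  have "M = density lborel (\<lambda>x. ennreal (p x))"
  proof (rule measure_eqI_generator_eq[where \<Omega>=UNIV])
    fix X assume "X \<in> range (\<lambda>(a, b). {a<..b::real})"
    then obtain a b where X: "X = {a<..b}" by auto
    show "emeasure M X = emeasure (density lborel (\<lambda>x. ennreal (p x))) X"
    proof (cases "a \<le> b")
      case True
      have "emeasure (density lborel (\<lambda>x. ennreal (p x))) X
          = (\<integral>\<^sup>+x. ennreal (p x) * indicator {a<..b} x \<partial>lborel)"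
        unfolding X by (subst emeasure_density) auto
      also have "\<dots> = (\<integral>\<^sup>+x. ennreal (indicator {a..b} x * p x) \<partial>lborel)"
        using AE_lborel_singleton[of a]
        by (intro nn_integral_cong_AE) (auto simp: indicator_def)
      also have "\<dots> = ennreal (LBINT x. indicator {a..b} x * p x)"
        by (intro nn_integral_eq_integral int_p) (auto simp: p0)
      also have "\<dots> = emeasure M X"
        unfolding X using inv[OF True atom atom] by (simp add: emeasure_eq_measure)
      finally show ?thesis ..
    qed (simp add: X)
  next
    show "(\<Union>i. {- real (i::nat)<..real i}) = UNIV"
      by (rule UN_Ioc_eq_UNIV)
  qed (auto simp: borel_sigma_sets_Ioc Int_stable_def)
  then show ?thesis
    using that[of p] p0 p_le p_lip by (simp add: abs_le_iff)
qed

section \<open>The Efron--Stein inequality\<close>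

lemma (in prob_space) variance_eq_double_integral:
  assumes [measurable]: "g \<in> borel_measurable M" and B: "\<And>x. x \<in> space M \<Longrightarrow> \<bar>g x\<bar> \<le> (B::real)"
  shows "(\<integral>x. (g x)\<^sup>2 \<partial>M) - (\<integral>x. g x \<partial>M)\<^sup>2 = (\<integral>x. (\<integral>y. (g x - g y)\<^sup>2 \<partial>M) \<partial>M) / 2"
proof -
  have g2: "integrable M (\<lambda>x. (g x)\<^sup>2)"
    using square_integrable_bounded[OF assms] by (simp add: square_integrable_def)
  have g1: "integrable M g"
    using square_integrable_bounded[OF assms] by (rule square_integrable_integrable)
  have "(\<integral>y. (g x - g y)\<^sup>2 \<partial>M) = (g x)\<^sup>2 - 2 * g x * expectation g + (\<integral>y. (g y)\<^sup>2 \<partial>M)" for x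
    using g1 g2 by (simp add: power2_diff prob_space)
  then have "(\<integral>x. (\<integral>y. (g x - g y)\<^sup>2 \<partial>M) \<partial>M)
      = (\<integral>x. (g x)\<^sup>2 - 2 * expectation g * g x + (\<integral>y. (g y)\<^sup>2 \<partial>M) \<partial>M)"
    by (simp add: mult_ac)
  also have "\<dots> = 2 * ((\<integral>x. (g x)\<^sup>2 \<partial>M) - (expectation g)\<^sup>2)"
    using g1 g2 by (simp add: prob_space power2_eq_square)
  finally show ?thesis by simp
qed

lemma (in prob_space) abs_expectation_le_bound:
  fixes g :: "'a \<Rightarrow> real"
  assumes [measurable]: "g \<in> borel_measurable M" and B: "\<And>x. x \<in> space M \<Longrightarrow> \<bar>g x\<bar> \<le> B"
  shows "\<bar>expectation g\<bar> \<le> B"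
proof -
  have "\<bar>expectation g\<bar> \<le> (\<integral>x. \<bar>g x\<bar> \<partial>M)" using integral_norm_bound[of M g] by simp
  also have "\<dots> \<le> (\<integral>x. B \<partial>M)"
  proof (rule integral_mono)
    show "integrable M (\<lambda>x. \<bar>g x\<bar>)"
      using B by (intro integrable_const_bound[where B=B]) (auto intro!: AE_I2)
  qed (use B in auto)
  finally show ?thesis by (simp add: prob_space)
qed

lemma (in prob_space) square_expectation_le_bounded:
  fixes g :: "'a \<Rightarrow> real"
  assumes [measurable]: "g \<in> borel_measurable M" and B: "\<And>x. x \<in> space M \<Longrightarrow> \<bar>g x\<bar> \<le> B"
  shows "(expectation g)\<^sup>2 \<le> (\<integral>x. (g x)\<^sup>2 \<partial>M)"
proof -
  have "\<bar>expectation g\<bar> \<le> norm2 M g"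
    by (rule abs_expectation_le_norm2[OF square_integrable_bounded[OF assms]])
  then have "\<bar>expectation g\<bar>\<^sup>2 \<le> (norm2 M g)\<^sup>2" by (intro power_mono) auto
  then show ?thesis by (simp add: norm2_squared)
qed

text \<open>
  The Efron--Stein inequality, by induction on the set of coordinates. The variance is the mean of the
  conditional variance given all coordinates but \<open>i\<close>, plus the variance of the conditional mean \<open>h\<close>. The former is
  the summand for \<open>i\<close>, since a variance is half the mean squared difference of two independent copies. The latter
  is covered by the induction hypothesis, since by Jensen's inequality \<open>h\<close> reacts to a change of another
  coordinate no more than \<open>f\<close> does. Boundedness makes all iterated integrals exist.
\<close>
lemma efron_stein_iterated:
  fixes \<mu> :: "'b measure" and f :: "('i \<Rightarrow> 'b) \<Rightarrow> real"
  assumes "prob_space \<mu>" and "finite I"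
    and "f \<in> borel_measurable (\<Pi>\<^sub>M i\<in>I. \<mu>)"
    and "\<And>x. x \<in> space (\<Pi>\<^sub>M i\<in>I. \<mu>) \<Longrightarrow> \<bar>f x\<bar> \<le> B"
  shows "(\<integral>x. (f x)\<^sup>2 \<partial>(\<Pi>\<^sub>M i\<in>I. \<mu>)) - (\<integral>x. f x \<partial>(\<Pi>\<^sub>M i\<in>I. \<mu>))\<^sup>2
    \<le> (\<Sum>i\<in>I. \<integral>x. (\<integral>y. (f x - f (x(i := y)))\<^sup>2 \<partial>\<mu>) \<partial>(\<Pi>\<^sub>M i\<in>I. \<mu>)) / 2"
  using assms(2-)
proof (induction I arbitrary: f rule: finite_induct)
  case empty
  interpret P: prob_space "\<Pi>\<^sub>M i\<in>{}. \<mu>" using assms(1) by (intro prob_space_PiM)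
  show ?case by (simp add: PiM_empty lebesgue_integral_count_space_finite)
next
  case (insert i I)
  interpret mu: prob_space \<mu> by fact
  interpret P: product_sigma_finite "\<lambda>_::'i. \<mu>" ..
  interpret Q: prob_space "\<Pi>\<^sub>M i\<in>I. \<mu>" using assms(1) by (intro prob_space_PiM)
  interpret Q': prob_space "\<Pi>\<^sub>M i\<in>insert i I. \<mu>" using assms(1) by (intro prob_space_PiM)
  interpret mm: pair_sigma_finite \<mu> \<mu> ..
  let ?P = "\<Pi>\<^sub>M i\<in>I. \<mu>" and ?P' = "\<Pi>\<^sub>M i\<in>insert i I. \<mu>"
  note [measurable] = insert.prems(1)
  have upd[measurable (raw)]: "(\<lambda>x. (g x)(i := h x)) \<in> N \<rightarrow>\<^sub>M ?P'"
    if "g \<in> N \<rightarrow>\<^sub>M ?P" "h \<in> N \<rightarrow>\<^sub>M \<mu>" for g h and N :: "'c measure"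
    using that by (intro measurable_fun_upd[where J=I]) auto
  have updi[measurable (raw)]: "(\<lambda>x. (g x)(j := h x)) \<in> N \<rightarrow>\<^sub>M ?P'"
    if "g \<in> N \<rightarrow>\<^sub>M ?P'" "h \<in> N \<rightarrow>\<^sub>M \<mu>" "j \<in> insert i I" for g h j and N :: "'c measure"
    using that by (intro measurable_fun_upd[where J="insert i I"]) auto
  have updj[measurable (raw)]: "(\<lambda>x. (g x)(j := h x)) \<in> N \<rightarrow>\<^sub>M ?P"
    if "g \<in> N \<rightarrow>\<^sub>M ?P" "h \<in> N \<rightarrow>\<^sub>M \<mu>" "j \<in> I" for g h j and N :: "'c measure"
    using that by (intro measurable_fun_upd[where J="I"]) auto
  have sp: "x(i := y) \<in> space ?P'" if "x \<in> space ?P" "y \<in> space \<mu>" for x y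
    using that by (auto simp: space_PiM PiE_iff extensional_def)
  have spj: "x(j := y) \<in> space ?P" if "x \<in> space ?P" "y \<in> space \<mu>" "j \<in> I" for x y j
    using that by (auto simp: space_PiM PiE_iff extensional_def)
  have spj': "x(j := y) \<in> space ?P'" if "x \<in> space ?P'" "y \<in> space \<mu>" "j \<in> insert i I" for x y j
    using that by (auto simp: space_PiM PiE_iff extensional_def)
  have B0: "0 \<le> B"
  proof -
    obtain x where "x \<in> space ?P'" using Q'.not_empty by blast
    from insert.prems(2)[OF this] show ?thesis by linarith
  qed
  \<comment> \<open>the conditional mean given the coordinates other than \<open>i\<close>\<close>
  define h where "h x = (\<integral>y. f (x(i := y)) \<partial>\<mu>)" for x
  have fB: "\<bar>f (x(i := y))\<bar> \<le> B" if "x \<in> space ?P" "y \<in> space \<mu>" for x y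
    using insert.prems(2) sp that by auto
  have h[measurable]: "h \<in> borel_measurable ?P" unfolding h_def by measurable
  have hB: "\<bar>h x\<bar> \<le> B" if "x \<in> space ?P" for x
    unfolding h_def using fB that by (intro mu.abs_expectation_le_bound) auto
  have int': "integrable ?P' F" if "F \<in> borel_measurable ?P'" "\<And>x. x \<in> space ?P' \<Longrightarrow> \<bar>F x\<bar> \<le> C"
    for F :: "('i \<Rightarrow> 'b) \<Rightarrow> real" and C
    using that by (intro Q'.integrable_const_bound[where B=C]) auto
  have int: "integrable ?P F" if "F \<in> borel_measurable ?P" "\<And>x. x \<in> space ?P \<Longrightarrow> \<bar>F x\<bar> \<le> C"
    for F :: "('i \<Rightarrow> 'b) \<Rightarrow> real" and C
    using that by (intro Q.integrable_const_bound[where B=C]) auto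
  have sq: "\<bar>u\<^sup>2\<bar> \<le> B\<^sup>2" if "\<bar>u\<bar> \<le> B" for u :: real
    using that by (simp add: abs_le_square_iff[symmetric])
  have sqd: "\<bar>(u - v)\<^sup>2\<bar> \<le> (2 * B)\<^sup>2" if "\<bar>u\<bar> \<le> B" "\<bar>v\<bar> \<le> B" for u v :: real
  proof -
    have "\<bar>u - v\<bar> \<le> \<bar>2 * B\<bar>" using that by linarith
    then show ?thesis by (simp add: abs_le_square_iff)
  qed
  have split: "(\<integral>x. F x \<partial>?P') = (\<integral>x. (\<integral>y. F (x(i := y)) \<partial>\<mu>) \<partial>?P)"
    if "F \<in> borel_measurable ?P'" "\<And>x. x \<in> space ?P' \<Longrightarrow> \<bar>F x\<bar> \<le> C" for F :: "('i \<Rightarrow> 'b) \<Rightarrow> real" and C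
    using insert.hyps int'[OF that] by (rule P.product_integral_insert)
  have splitD: "(\<integral>x. (\<integral>y. (f x - f (x(j := y)))\<^sup>2 \<partial>\<mu>) \<partial>?P')
      = (\<integral>x. (\<integral>y. (\<integral>z. (f (x(i := y)) - f ((x(i := y))(j := z)))\<^sup>2 \<partial>\<mu>) \<partial>\<mu>) \<partial>?P)"
    if j: "j \<in> insert i I" for j
  proof (rule split)
    fix x assume x: "x \<in> space ?P'"
    show "\<bar>\<integral>y. (f x - f (x(j := y)))\<^sup>2 \<partial>\<mu>\<bar> \<le> (2 * B)\<^sup>2"
    proof (rule mu.abs_expectation_le_bound)
      show "(\<lambda>y. (f x - f (x(j := y)))\<^sup>2) \<in> borel_measurable \<mu>" using x j by measurable
      show "\<bar>(f x - f (x(j := y)))\<^sup>2\<bar> \<le> (2 * B)\<^sup>2" if "y \<in> space \<mu>" for y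
        by (intro sqd insert.prems(2) spj' x j that)
    qed
  qed (use j in measurable)
  have "(\<integral>x. (f x)\<^sup>2 \<partial>?P') - (\<integral>x. f x \<partial>?P')\<^sup>2
      = (\<integral>x. (\<integral>y. (f (x(i := y)))\<^sup>2 \<partial>\<mu>) \<partial>?P) - (\<integral>x. h x \<partial>?P)\<^sup>2"
  proof -
    have "(\<integral>x. (f x)\<^sup>2 \<partial>?P') = (\<integral>x. (\<integral>y. (f (x(i := y)))\<^sup>2 \<partial>\<mu>) \<partial>?P)"
      using insert.prems(2) sq by (intro split[of _ "B\<^sup>2"]) auto
    moreover have "(\<integral>x. f x \<partial>?P') = (\<integral>x. h x \<partial>?P)"
      unfolding h_def using insert.prems(2) by (intro split[of _ B]) auto
    ultimately show ?thesis by simp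
  qed
  also have "\<dots> = (\<integral>x. (\<integral>y. (f (x(i := y)))\<^sup>2 \<partial>\<mu>) - (h x)\<^sup>2 \<partial>?P)
      + ((\<integral>x. (h x)\<^sup>2 \<partial>?P) - (\<integral>x. h x \<partial>?P)\<^sup>2)"
  proof -
    have "integrable ?P (\<lambda>x. (\<integral>y. (f (x(i := y)))\<^sup>2 \<partial>\<mu>))"
      using fB sq by (intro int[of _ "B\<^sup>2"] mu.abs_expectation_le_bound) auto
    moreover have "integrable ?P (\<lambda>x. (h x)\<^sup>2)"
      using hB sq by (intro int[of _ "B\<^sup>2"]) auto
    ultimately show ?thesis by simp
  qed
  also have "(\<integral>x. (\<integral>y. (f (x(i := y)))\<^sup>2 \<partial>\<mu>) - (h x)\<^sup>2 \<partial>?P)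
      = (\<integral>x. (\<integral>y. (f x - f (x(i := y)))\<^sup>2 \<partial>\<mu>) \<partial>?P') / 2"
  proof -
    have "(\<integral>x. (\<integral>y. (f (x(i := y)))\<^sup>2 \<partial>\<mu>) - (h x)\<^sup>2 \<partial>?P)
        = (\<integral>x. (\<integral>y. (\<integral>z. (f (x(i := y)) - f (x(i := z)))\<^sup>2 \<partial>\<mu>) \<partial>\<mu>) / 2 \<partial>?P)"
      unfolding h_def using fB
      by (intro Bochner_Integration.integral_cong mu.variance_eq_double_integral) auto
    also have "\<dots> = (\<integral>x. (\<integral>y. (\<integral>z. (f (x(i := y)) - f ((x(i := y))(i := z)))\<^sup>2 \<partial>\<mu>) \<partial>\<mu>) \<partial>?P) / 2"
      by simp
    also have "\<dots> = (\<integral>x. (\<integral>y. (f x - f (x(i := y)))\<^sup>2 \<partial>\<mu>) \<partial>?P') / 2"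
      using splitD[of i] by simp
    finally show ?thesis .
  qed
  also have "(\<integral>x. (h x)\<^sup>2 \<partial>?P) - (\<integral>x. h x \<partial>?P)\<^sup>2
      \<le> (\<Sum>j\<in>I. \<integral>x. (\<integral>y. (h x - h (x(j := y)))\<^sup>2 \<partial>\<mu>) \<partial>?P) / 2"
    using h hB by (rule insert.IH)
  also have "(\<Sum>j\<in>I. \<integral>x. (\<integral>y. (h x - h (x(j := y)))\<^sup>2 \<partial>\<mu>) \<partial>?P)
      \<le> (\<Sum>j\<in>I. \<integral>x. (\<integral>y. (f x - f (x(j := y)))\<^sup>2 \<partial>\<mu>) \<partial>?P')"
  proof (rule sum_mono)
    fix j assume j: "j \<in> I"
    with insert.hyps have ji: "j \<noteq> i" by auto
    have tw: "(x(i := y))(j := z) = (x(j := z))(i := y)" for x :: "'i \<Rightarrow> 'b" and y z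
      using ji by (simp add: fun_upd_twist)
    let ?D = "\<lambda>x z y. (f (x(i := y)) - f ((x(j := z))(i := y)))\<^sup>2"
    have D: "\<bar>?D x z y\<bar> \<le> (2 * B)\<^sup>2" if "x \<in> space ?P" "y \<in> space \<mu>" "z \<in> space \<mu>" for x y z
      using that j spj by (intro sqd fB) auto
    have "(\<integral>x. (\<integral>z. (h x - h (x(j := z)))\<^sup>2 \<partial>\<mu>) \<partial>?P) \<le> (\<integral>x. (\<integral>z. (\<integral>y. ?D x z y \<partial>\<mu>) \<partial>\<mu>) \<partial>?P)"
    proof (rule integral_mono)
      show "integrable ?P (\<lambda>x. \<integral>z. (h x - h (x(j := z)))\<^sup>2 \<partial>\<mu>)"
        using hB sqd spj j by (intro int[of _ "(2 * B)\<^sup>2"] mu.abs_expectation_le_bound) auto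
      show "integrable ?P (\<lambda>x. \<integral>z. (\<integral>y. ?D x z y \<partial>\<mu>) \<partial>\<mu>)"
        using D j by (intro int[of _ "(2 * B)\<^sup>2"] mu.abs_expectation_le_bound) auto
      fix x assume x: "x \<in> space ?P"
      show "(\<integral>z. (h x - h (x(j := z)))\<^sup>2 \<partial>\<mu>) \<le> (\<integral>z. (\<integral>y. ?D x z y \<partial>\<mu>) \<partial>\<mu>)"
      proof (rule integral_mono)
        show "integrable \<mu> (\<lambda>z. (h x - h (x(j := z)))\<^sup>2)"
          using hB sqd spj x j by (intro mu.integrable_const_bound[where B="(2 * B)\<^sup>2"]) (auto intro!: AE_I2)
        show "integrable \<mu> (\<lambda>z. \<integral>y. ?D x z y \<partial>\<mu>)"
        proof (rule mu.integrable_const_bound[where B="(2 * B)\<^sup>2"])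
          have "\<bar>\<integral>y. ?D x z y \<partial>\<mu>\<bar> \<le> (2 * B)\<^sup>2" if z: "z \<in> space \<mu>" for z
          proof (rule mu.abs_expectation_le_bound[OF _ D[OF x _ z]])
            show "?D x z \<in> borel_measurable \<mu>" using x z j spj by measurable
          qed
          then show "AE z in \<mu>. norm (\<integral>y. ?D x z y \<partial>\<mu>) \<le> (2 * B)\<^sup>2"
            unfolding real_norm_def by (intro AE_I2)
        qed (use x j in measurable)
        fix z assume z: "z \<in> space \<mu>"
        have xz: "x(j := z) \<in> space ?P" using spj x z j by auto
        have i1: "integrable \<mu> (\<lambda>y. f (x(i := y)))" "integrable \<mu> (\<lambda>y. f ((x(j := z))(i := y)))"
          using fB x xz z j by (auto intro!: mu.integrable_const_bound[where B=B] AE_I2)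
        have "h x - h (x(j := z)) = (\<integral>y. f (x(i := y)) - f ((x(j := z))(i := y)) \<partial>\<mu>)"
          unfolding h_def using i1 by simp
        also have "\<dots>\<^sup>2 \<le> (\<integral>y. ?D x z y \<partial>\<mu>)"
        proof (rule mu.square_expectation_le_bounded[where B="2 * B"])
          show "\<bar>f (x(i := y)) - f ((x(j := z))(i := y))\<bar> \<le> 2 * B" if "y \<in> space \<mu>" for y
            using fB[OF x that] fB[OF xz that] by linarith
        qed (use x xz in measurable)
        finally show "(h x - h (x(j := z)))\<^sup>2 \<le> (\<integral>y. ?D x z y \<partial>\<mu>)" .
      qed
    qed
    also have "\<dots> = (\<integral>x. (\<integral>y. (\<integral>z. ?D x z y \<partial>\<mu>) \<partial>\<mu>) \<partial>?P)"
    proof (rule Bochner_Integration.integral_cong[OF refl])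
      fix x assume x: "x \<in> space ?P"
      interpret mp: pair_prob_space \<mu> \<mu> ..
      show "(\<integral>z. (\<integral>y. ?D x z y \<partial>\<mu>) \<partial>\<mu>) = (\<integral>y. (\<integral>z. ?D x z y \<partial>\<mu>) \<partial>\<mu>)"
      proof (rule mm.Fubini_integral)
        show "integrable (\<mu> \<Otimes>\<^sub>M \<mu>) (\<lambda>(y, z). ?D x z y)"
          using D x j by (intro mp.integrable_const_bound[where B="(2 * B)\<^sup>2"])
            (auto intro!: AE_I2 simp: space_pair_measure)
      qed
    qed
    also have "\<dots> = (\<integral>x. (\<integral>y. (f x - f (x(j := y)))\<^sup>2 \<partial>\<mu>) \<partial>?P')"
      using splitD[of j] j by (simp add: tw)
    finally show "(\<integral>x. (\<integral>y. (h x - h (x(j := y)))\<^sup>2 \<partial>\<mu>) \<partial>?P)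
        \<le> (\<integral>x. (\<integral>y. (f x - f (x(j := y)))\<^sup>2 \<partial>\<mu>) \<partial>?P')" .
  qed
  \<comment> \<open>the calculation leaves the monotonicity of \<open>\<lambda>x. x / 2\<close> as a premise\<close>
  finally have "(\<integral>x. (f x)\<^sup>2 \<partial>?P') - (\<integral>x. f x \<partial>?P')\<^sup>2
      \<le> (\<integral>x. (\<integral>y. (f x - f (x(i := y)))\<^sup>2 \<partial>\<mu>) \<partial>?P') / 2
        + (\<Sum>j\<in>I. \<integral>x. (\<integral>y. (f x - f (x(j := y)))\<^sup>2 \<partial>\<mu>) \<partial>?P') / 2"
    by - (assumption | simp only: divide_right_mono)
  then show ?case unfolding sum.insert[OF insert.hyps] add_divide_distrib .
qed

text \<open>
  The form of the inequality for sums: \<open>b i n\<close> bounds the influence of coordinate \<open>i\<close> on the summand \<open>n\<close>, and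
  by Minkowski's inequality influences on different summands add up.
\<close>
lemma efron_stein_sum:
  fixes \<mu> :: "'b measure" and f :: "'n \<Rightarrow> ('i \<Rightarrow> 'b) \<Rightarrow> real"
  assumes "prob_space \<mu>" and I: "finite I" and A: "finite A"
    and f: "\<And>n. n \<in> A \<Longrightarrow> f n \<in> borel_measurable (\<Pi>\<^sub>M i\<in>I. \<mu>)"
    and B: "\<And>n x. n \<in> A \<Longrightarrow> x \<in> space (\<Pi>\<^sub>M i\<in>I. \<mu>) \<Longrightarrow> \<bar>f n x\<bar> \<le> B"
    and b: "\<And>i n. i \<in> I \<Longrightarrow> n \<in> A \<Longrightarrow>
      norm2 ((\<Pi>\<^sub>M i\<in>I. \<mu>) \<Otimes>\<^sub>M \<mu>) (\<lambda>z. f n (fst z) - f n ((fst z)(i := snd z))) \<le> b i n"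
  shows "(\<integral>x. (\<Sum>n\<in>A. f n x)\<^sup>2 \<partial>(\<Pi>\<^sub>M i\<in>I. \<mu>)) - (\<integral>x. (\<Sum>n\<in>A. f n x) \<partial>(\<Pi>\<^sub>M i\<in>I. \<mu>))\<^sup>2
    \<le> (\<Sum>i\<in>I. (\<Sum>n\<in>A. b i n)\<^sup>2) / 2"
proof -
  interpret mu: prob_space \<mu> by fact
  let ?P = "\<Pi>\<^sub>M i\<in>I. \<mu>"
  interpret P: prob_space ?P using assms(1) by (intro prob_space_PiM)
  interpret PM: pair_prob_space ?P \<mu> ..
  note [measurable] = f
  define F where "F x = (\<Sum>n\<in>A. f n x)" for x
  have F[measurable]: "F \<in> borel_measurable ?P" unfolding F_def by measurable
  have FB: "\<bar>F x\<bar> \<le> real (card A) * B" if "x \<in> space ?P" for x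
    unfolding F_def using B that by (intro order_trans[OF sum_abs] order_trans[OF sum_bounded_above]) auto
  have upd[measurable]: "(\<lambda>z. (fst z)(i := snd z)) \<in> ?P \<Otimes>\<^sub>M \<mu> \<rightarrow>\<^sub>M ?P" if "i \<in> I" for i
    using that by (intro measurable_fun_upd[where J=I]) auto
  have spj: "x(j := y) \<in> space ?P" if "x \<in> space ?P" "y \<in> space \<mu>" "j \<in> I" for x y j
    using that by (auto simp: space_PiM PiE_iff extensional_def)
  have L2: "square_integrable (?P \<Otimes>\<^sub>M \<mu>) (\<lambda>z. g (fst z) - g ((fst z)(i := snd z)))"
    if g[measurable]: "g \<in> borel_measurable ?P" and gB: "\<And>x. x \<in> space ?P \<Longrightarrow> \<bar>g x\<bar> \<le> C" and i: "i \<in> I" for g C i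
  proof (rule PM.P.square_integrable_bounded[where B="2 * C"])
    fix z assume "z \<in> space (?P \<Otimes>\<^sub>M \<mu>)"
    then have "fst z \<in> space ?P" "(fst z)(i := snd z) \<in> space ?P"
      using spj i by (auto simp: space_pair_measure)
    from this[THEN gB] show "\<bar>g (fst z) - g ((fst z)(i := snd z))\<bar> \<le> 2 * C" by linarith
  qed (use i in measurable)
  have "(\<integral>x. (F x)\<^sup>2 \<partial>?P) - (\<integral>x. F x \<partial>?P)\<^sup>2
      \<le> (\<Sum>i\<in>I. \<integral>x. (\<integral>y. (F x - F (x(i := y)))\<^sup>2 \<partial>\<mu>) \<partial>?P) / 2"
    using FB by (intro efron_stein_iterated assms(1) I F)
  also have "\<dots> \<le> (\<Sum>i\<in>I. (\<Sum>n\<in>A. b i n)\<^sup>2) / 2"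
  proof (intro divide_right_mono sum_mono)
    fix i assume i: "i \<in> I"
    let ?D = "\<lambda>g z. g (fst z) - g ((fst z)(i := snd z))"
    have "(\<integral>x. (\<integral>y. (F x - F (x(i := y)))\<^sup>2 \<partial>\<mu>) \<partial>?P)
        = (\<integral>x. (\<integral>y. (\<lambda>z. (?D F z)\<^sup>2) (x, y) \<partial>\<mu>) \<partial>?P)" by simp
    also have "\<dots> = (norm2 (?P \<Otimes>\<^sub>M \<mu>) (?D F))\<^sup>2"
      unfolding norm2_squared
      by (rule PM.integral_fst') (use L2[OF F FB i] in \<open>auto simp: square_integrable_def\<close>)
    also have "?D F = (\<lambda>z. \<Sum>n\<in>A. ?D (f n) z)" by (simp add: F_def sum_subtractf fun_eq_iff)
    also have "(norm2 (?P \<Otimes>\<^sub>M \<mu>) (\<lambda>z. \<Sum>n\<in>A. ?D (f n) z))\<^sup>2 \<le> (\<Sum>n\<in>A. b i n)\<^sup>2"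
    proof (rule power_mono)
      have "norm2 (?P \<Otimes>\<^sub>M \<mu>) (\<lambda>z. \<Sum>n\<in>A. ?D (f n) z) \<le> (\<Sum>n\<in>A. norm2 (?P \<Otimes>\<^sub>M \<mu>) (?D (f n)))"
        using f B i by (intro norm2_sum L2) auto
      also have "\<dots> \<le> (\<Sum>n\<in>A. b i n)" using b i by (intro sum_mono) auto
      finally show "norm2 (?P \<Otimes>\<^sub>M \<mu>) (\<lambda>z. \<Sum>n\<in>A. ?D (f n) z) \<le> (\<Sum>n\<in>A. b i n)" .
    qed simp
    finally show "(\<integral>x. (\<integral>y. (F x - F (x(i := y)))\<^sup>2 \<partial>\<mu>) \<partial>?P) \<le> (\<Sum>n\<in>A. b i n)\<^sup>2" .
  qed simp
  finally show ?thesis unfolding F_def .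
qed

section \<open>Slowly varying functions\<close>

text \<open>
  Slow variation is pointwise convergence of \<open>f (t * y) / f y\<close>; on a bounded interval dominated convergence
  turns it into convergence in measure. The interval contains every quotient \<open>s / u\<close> with \<open>2 \<le> s \<le> 4\<close> and
  \<open>1 \<le> u \<le> 2\<close>.
\<close>
lemma slowly_varying_bad_set_measure:
  assumes sv: "slowly_varying f" and y: "filterlim y at_top sequentially" and y0: "\<And>n. y n > 0"
  defines "A n \<equiv> {t \<in> {1..4::real}. \<not> (f (y n * t) / f (y n) < 2 \<and> f (y n * t) / f (y n) > 1/2)}"
  shows "\<And>n. A n \<in> sets lebesgue" and "(\<lambda>n. measure lebesgue (A n)) \<longlonglongrightarrow> 0"
proof -
  have f[measurable]: "f \<in> borel_measurable (lebesgue_on {0<..})"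
    using sv by (simp add: slowly_varying_def)
  show A: "A n \<in> sets lebesgue" for n
  proof -
    have "(\<lambda>t. y n * t) \<in> lebesgue_on {1..4} \<rightarrow>\<^sub>M lebesgue_on {0<..}"
    proof (rule measurable_restrict_space2)
      show "(\<lambda>t. y n * t) \<in> space (lebesgue_on {1..4}) \<rightarrow> {0<..}"
        using y0 by (auto simp: space_restrict_space)
      show "(\<lambda>t. y n * t) \<in> lebesgue_on {1..4} \<rightarrow>\<^sub>M lebesgue"
        using lebesgue_measurable_scaling[of "y n", where 'a=real] by (intro measurable_restrict_space1) (simp add: real_scaleR_def[abs_def])
    qed
    then have [measurable]: "(\<lambda>t. f (y n * t)) \<in> borel_measurable (lebesgue_on {1..4})"
      using f by (rule measurable_compose)
    have "{t \<in> space (lebesgue_on {1..4::real}). \<not> (f (y n * t) / f (y n) < 2 \<and> f (y n * t) / f (y n) > 1/2)} \<in> sets (lebesgue_on {1..4})"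
      by measurable
    then show ?thesis
      by (auto simp: A_def space_restrict_space sets_restrict_space_iff)
  qed
  have "(\<lambda>n. \<integral>t. indicator (A n) t \<partial>lebesgue) \<longlonglongrightarrow> (\<integral>t. (0::real) \<partial>(lebesgue :: real measure))"
  proof (rule integral_dominated_convergence[where w="indicator {1..4}"])
    show "integrable lebesgue (indicator {1..4::real} :: real \<Rightarrow> real)"
      by (simp add: emeasure_lborel_Icc_eq)
    show "AE t in lebesgue. (\<lambda>n. indicator (A n) t :: real) \<longlonglongrightarrow> 0"
    proof (rule AE_I2)
      fix t :: real
      have "\<forall>\<^sub>F n in sequentially. indicator (A n) t = (0::real)"
      proof (cases "t > 0")
        case True
        then have "((\<lambda>x. f (t * x) / f x) \<longlongrightarrow> 1) at_top" using sv by (auto simp: slowly_varying_def)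
        then have lim: "(\<lambda>n. f (t * y n) / f (y n)) \<longlonglongrightarrow> 1" using y by (rule filterlim_compose)
        have "\<forall>\<^sub>F n in sequentially. f (t * y n) / f (y n) < 2" by (rule order_tendstoD[OF lim]) simp
        moreover have "\<forall>\<^sub>F n in sequentially. f (t * y n) / f (y n) > 1/2" by (rule order_tendstoD[OF lim]) simp
        ultimately show ?thesis by eventually_elim (simp add: A_def mult.commute)
      qed (simp add: A_def)
      then show "(\<lambda>n. indicator (A n) t :: real) \<longlonglongrightarrow> 0" by (rule tendsto_eventually)
    qed
    show "AE t in lebesgue. norm (indicator (A n) t :: real) \<le> indicator {1..4} t" for n
      by (rule AE_I2) (auto simp: A_def indicator_def)
  qed (use A in auto)
  then show "(\<lambda>n. measure lebesgue (A n)) \<longlonglongrightarrow> 0" by simp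
qed

text \<open>
  A weak form of the uniform convergence theorem. If \<open>f (u * x) > 4 * f x\<close>, then every \<open>s\<close> in \<open>[2, 4]\<close> satisfies
  \<open>f (s * x) \<ge> 2 * f x\<close> or \<open>f (s * x) \<le> f (u * x) / 2\<close>. For arbitrarily large \<open>x\<close> this would cover an interval of
  length 2 by two sets whose measures tend to 0.
\<close>
lemma slowly_varying_locally_bounded:
  assumes sv: "slowly_varying f"
  obtains x0 where "x0 > 0" "\<And>x u. x \<ge> x0 \<Longrightarrow> 1 \<le> u \<Longrightarrow> u \<le> 2 \<Longrightarrow> f (u * x) \<le> 4 * f x"
proof (rule ccontr)
  assume no: "\<not> thesis"
  have pos: "f x > 0" if "x > 0" for x using sv that by (simp add: slowly_varying_def)
  have "\<exists>x u. x \<ge> real n + 1 \<and> 1 \<le> u \<and> u \<le> 2 \<and> f (u * x) > 4 * f x" for n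
    using no that[of "real n + 1"] by (force simp: not_le)
  then obtain x u where xu: "\<And>n. x n \<ge> real n + 1" "\<And>n. 1 \<le> u n" "\<And>n. u n \<le> 2"
    and bad: "\<And>n. f (u n * x n) > 4 * f (x n)" by metis
  have x0: "x n > 0" for n using xu(1)[of n] by linarith
  have xlim: "filterlim x at_top sequentially"
    by (rule filterlim_at_top_mono[OF filterlim_real_sequentially]) (use xu(1) in \<open>auto intro!: always_eventually intro: order_trans[OF _ xu(1)]\<close>)
  have uxlim: "filterlim (\<lambda>n. u n * x n) at_top sequentially"
  proof (rule filterlim_at_top_mono[OF xlim], rule always_eventually, rule allI)
    show "x n \<le> u n * x n" for n using xu(2)[of n] x0[of n] by simp
  qed
  have ux0: "u n * x n > 0" for n using x0 xu(2)[of n] by (intro mult_pos_pos) auto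
  define A where "A n = {t \<in> {1..4::real}. \<not> (f (x n * t) / f (x n) < 2 \<and> f (x n * t) / f (x n) > 1/2)}" for n
  define B where "B n = {t \<in> {1..4::real}. \<not> (f (u n * x n * t) / f (u n * x n) < 2 \<and> f (u n * x n * t) / f (u n * x n) > 1/2)}" for n
  have A1: "A n \<in> sets lebesgue" for n
    unfolding A_def by (rule slowly_varying_bad_set_measure(1)[OF sv xlim x0])
  have A2: "(\<lambda>n. measure lebesgue (A n)) \<longlonglongrightarrow> 0"
    unfolding A_def by (rule slowly_varying_bad_set_measure(2)[OF sv xlim x0])
  have B1: "B n \<in> sets lebesgue" for n
    unfolding B_def by (rule slowly_varying_bad_set_measure(1)[OF sv uxlim ux0])
  have B2: "(\<lambda>n. measure lebesgue (B n)) \<longlonglongrightarrow> 0"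
    unfolding B_def by (rule slowly_varying_bad_set_measure(2)[OF sv uxlim ux0])
  have cover: "{2..4} \<subseteq> A n \<union> (\<lambda>t. u n *\<^sub>R t + 0) ` B n" for n
  proof
    fix s :: real assume s: "s \<in> {2..4}"
    have u: "u n > 0" "1 \<le> u n" "u n \<le> 2" using xu[of n] by auto
    show "s \<in> A n \<union> (\<lambda>t. u n *\<^sub>R t + 0) ` B n"
    proof (rule ccontr)
      assume neg: "s \<notin> A n \<union> (\<lambda>t. u n *\<^sub>R t + 0) ` B n"
      have "s \<notin> A n" using neg by simp
      then have 1: "f (x n * s) < 2 * f (x n)"
        using s pos[OF x0, of n] by (simp add: A_def field_simps)
      have "u n \<le> s" "s \<le> u n * 4" using s u by auto
      then have "s / u n \<in> {1..4}" using u by (simp add: field_simps)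
      moreover have "s / u n \<notin> B n"
        using neg u by (force simp: image_iff)
      ultimately have "f (u n * x n * (s / u n)) > f (u n * x n) / 2"
        using pos[OF ux0, of n] by (simp add: B_def field_simps)
      also have "u n * x n * (s / u n) = x n * s" using u by simp
      finally show False using 1 bad[of n] by simp
    qed
  qed
  have fin: "emeasure lebesgue S < \<infinity>" if "S \<subseteq> {1..4}" for S :: "real set"
    using emeasure_mono[OF that, of lebesgue] by (simp add: order_le_less_trans)
  have le: "2 \<le> measure lebesgue (A n) + 2 * measure lebesgue (B n)" for n
  proof -
    have "A n \<subseteq> {1..4}" "B n \<subseteq> {1..4}" unfolding A_def B_def by blast+
    then have "emeasure lebesgue (A n) \<noteq> top" and nB: "emeasure lebesgue (B n) \<noteq> top"
      using fin[of "A n"] fin[of "B n"] by simp_all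
    then have finA: "emeasure lebesgue (A n) = ennreal (measure lebesgue (A n))"
      by (intro emeasure_eq_ennreal_measure)
    have finB: "emeasure lebesgue (B n) = ennreal (measure lebesgue (B n))"
      using nB by (rule emeasure_eq_ennreal_measure)
    have uB: "(\<lambda>t. u n *\<^sub>R t + 0) ` B n \<in> sets lebesgue"
    proof -
      have "(\<lambda>t. u n *\<^sub>R t + 0) ` B n = (*\<^sub>R) (1 / u n) -` B n \<inter> space lebesgue"
        using xu(2)[of n] by (force simp: image_iff)
      also have "\<dots> \<in> sets lebesgue"
        using lebesgue_measurable_scaling B1 by (rule measurable_sets)
      finally show ?thesis .
    qed
    have "ennreal 2 = emeasure lebesgue {2..4::real}" by simp
    also have "\<dots> \<le> emeasure lebesgue (A n \<union> (\<lambda>t. u n *\<^sub>R t + 0) ` B n)"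
    proof (rule emeasure_mono[OF cover])
      show "A n \<union> (\<lambda>t. u n *\<^sub>R t + 0) ` B n \<in> sets lebesgue"
        using A1 uB by (rule sets.Un)
    qed
    also have "\<dots> \<le> emeasure lebesgue (A n) + emeasure lebesgue ((\<lambda>t. u n *\<^sub>R t + 0) ` B n)"
    proof (rule emeasure_subadditive)
      show "(\<lambda>t. u n *\<^sub>R t + 0) ` B n \<in> sets lebesgue"
        by (rule uB)
    qed (use A1 in auto)
    also have "emeasure lebesgue ((\<lambda>t. u n *\<^sub>R t + 0) ` B n) = ennreal (u n) * emeasure lebesgue (B n)"
      using xu(2)[of n] by (subst emeasure_lebesgue_affine) simp
    also have "emeasure lebesgue (A n) + \<dots> = ennreal (measure lebesgue (A n) + u n * measure lebesgue (B n))"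
      using finA finB xu(2)[of n] by (simp add: ennreal_mult)
    finally have "2 \<le> measure lebesgue (A n) + u n * measure lebesgue (B n)"
      using xu(2)[of n] by (subst (asm) ennreal_le_iff) auto
    also have "\<dots> \<le> measure lebesgue (A n) + 2 * measure lebesgue (B n)"
      using xu(3)[of n] by (intro add_left_mono mult_right_mono) auto
    finally show ?thesis .
  qed
  have "(\<lambda>n. measure lebesgue (A n) + 2 * measure lebesgue (B n)) \<longlonglongrightarrow> 0 + 2 * 0"
    by (intro tendsto_intros A2 B2)
  then have "2 \<le> (0::real)"
    using le by (intro LIMSEQ_le_const) auto
  then show False by simp
qed

lemma dyadic_induct:
  fixes x r :: real
  assumes "r > 0" and "x \<ge> r" and base: "\<And>x. r \<le> x \<Longrightarrow> x \<le> 2 * r \<Longrightarrow> P x"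
    and step: "\<And>x. r \<le> x \<Longrightarrow> P x \<Longrightarrow> P (2 * x)"
  shows "P x"
proof -
  have "\<forall>x. r \<le> x \<and> x \<le> 2 ^ Suc n * r \<longrightarrow> P x" for n
  proof (induction n)
    case (Suc n)
    show ?case
    proof safe
      fix x assume x: "r \<le> x" "x \<le> 2 ^ Suc (Suc n) * r"
      show "P x"
      proof (cases "x \<le> 2 * r")
        case False
        then show ?thesis using Suc[rule_format, of "x / 2"] step[of "x / 2"] x by simp
      qed (use base x in auto)
    qed
  qed (use base in auto)
  moreover obtain n where "x / r < 2 ^ n"
    using real_arch_pow[of 2 "x / r"] by auto
  then have "x \<le> 2 ^ Suc n * r" using assms(1,2) by (simp add: field_simps)
  ultimately show ?thesis using assms(2) by blast
qed

text \<open>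
  For large \<open>x\<close>, doubling the argument multiplies \<open>f\<close> by less than \<open>sqrt 2\<close>; hence \<open>f\<close> grows no faster than the
  square root.
\<close>
lemma slowly_varying_powr_tendsto_0:
  assumes sv: "slowly_varying f" and "\<beta> \<ge> 1"
  shows "((\<lambda>x. x powr (-\<beta>) * f x) \<longlongrightarrow> 0) at_top"
proof -
  have pos: "f x > 0" if "x > 0" for x using sv that by (simp add: slowly_varying_def)
  obtain x1 where x1: "x1 > 0" "\<And>x u. x \<ge> x1 \<Longrightarrow> 1 \<le> u \<Longrightarrow> u \<le> 2 \<Longrightarrow> f (u * x) \<le> 4 * f x"
    using slowly_varying_locally_bounded[OF sv] by blast
  have "((\<lambda>x. f (2 * x) / f x) \<longlongrightarrow> 1) at_top" using sv by (simp add: slowly_varying_def)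
  then have "\<forall>\<^sub>F x in at_top. f (2 * x) / f x < sqrt 2"
    by (rule order_tendstoD) simp
  then obtain x2 where x2: "\<And>x. x \<ge> x2 \<Longrightarrow> f (2 * x) / f x < sqrt 2"
    by (auto simp: eventually_at_top_linorder)
  define x0 where "x0 = max 1 (max x1 x2)"
  have x0: "x0 \<ge> 1" "x0 \<ge> x1" "x0 \<ge> x2" by (auto simp: x0_def)
  define C where "C = 4 * f x0"
  have C: "C > 0" using pos[of x0] x0 by (simp add: C_def)
  have bound: "f x \<le> C * sqrt x" if "x \<ge> x0" for x
  proof (rule dyadic_induct[where r=x0 and P="\<lambda>x. f x \<le> C * sqrt x"])
    fix x assume x: "x0 \<le> x" "x \<le> 2 * x0"
    have "f x = f ((x / x0) * x0)" using x0 by simp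
    also have "\<dots> \<le> C" unfolding C_def using x x0 by (intro x1) (auto simp: field_simps)
    also have "C * 1 \<le> C * sqrt x" using C x x0 by (intro mult_left_mono) auto
    finally show "f x \<le> C * sqrt x" by simp
  next
    fix x assume x: "x0 \<le> x" "f x \<le> C * sqrt x"
    have "f (2 * x) \<le> sqrt 2 * f x"
      using x2[of x] x x0 pos[of x] by (simp add: field_simps)
    also have "\<dots> \<le> sqrt 2 * (C * sqrt x)" using x by (intro mult_left_mono) auto
    finally show "f (2 * x) \<le> C * sqrt (2 * x)" by (simp add: real_sqrt_mult mult_ac)
  qed (use x0 that in auto)
  show ?thesis
  proof (rule tendsto_sandwich)
    show "\<forall>\<^sub>F x in at_top. 0 \<le> x powr (-\<beta>) * f x"
      using eventually_gt_at_top[of 0] by eventually_elim (simp add: pos less_imp_le)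
    show "\<forall>\<^sub>F x in at_top. x powr (-\<beta>) * f x \<le> C * x powr (-1/2)"
      using eventually_ge_at_top[of x0]
    proof eventually_elim
      case (elim x)
      then have x: "x \<ge> 1" using x0 by simp
      have "x powr (-\<beta>) * f x \<le> x powr (-1) * (C * sqrt x)"
        using bound[OF elim] assms(2) x pos[of x] by (intro mult_mono powr_mono) auto
      also have "\<dots> = C * (x powr (-1) * x powr (1/2))" using x by (simp add: powr_half_sqrt)
      also have "x powr (-1) * x powr (1/2) = x powr (-1/2)" by (subst powr_add[symmetric]) simp
      finally show ?case .
    qed
    have "((\<lambda>x::real. x powr (-1/2)) \<longlongrightarrow> 0) at_top"
      by (rule tendsto_neg_powr) (auto simp: filterlim_ident)
    then show "((\<lambda>x. C * x powr (-1/2)) \<longlongrightarrow> 0) at_top"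
      by (rule tendsto_mult_right_zero)
  qed simp
qed

section \<open>Truncated second moments\<close>

text \<open>
  The tags of a fine division may be moved to the right end points. With these tags, summation by parts turns
  an integral against \<open>g\<close> into increments of \<open>f\<close> weighted by the values of \<open>g\<close> at the left end points.
\<close>
lemma stieltjes_sum_right_tags:
  fixes f g :: "real \<Rightarrow> real"
  assumes I: "has_stieltjes_integral f g a b I" and e: "e > 0" and \<delta>: "\<delta> > 0"
  obtains D where "D tagged_division_of {a..b}" "\<And>x k. (x, k) \<in> D \<Longrightarrow> Sup k - Inf k < \<delta>"
    "\<bar>(\<Sum>(x, k)\<in>D. f (Sup k) * (g (Sup k) - g (Inf k))) - I\<bar> < e"
proof -
  from I[unfolded has_stieltjes_integral_def, rule_format, OF e]
  obtain d where d: "d > 0" and fine: "\<forall>D. D tagged_division_of {a..b} \<and> (\<lambda>x. ball x d) fine D \<longrightarrow>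
        \<bar>(\<Sum>(x, k)\<in>D. f x * (g (Sup k) - g (Inf k))) - I\<bar> < e"
    by blast
  define d' where "d' = min d \<delta>"
  have d': "d' > 0" "d' \<le> d" "d' \<le> \<delta>" using d \<delta> by (auto simp: d'_def)
  \<comment> \<open>half the mesh, since moving a tag within its interval may double the distance to the other points\<close>
  have "gauge (\<lambda>x::real. ball x (d' / 2))" using d' by (auto simp: gauge_def)
  then obtain D where D: "D tagged_division_of {a..b}" "(\<lambda>x. ball x (d' / 2)) fine D"
    by (rule fine_division_exists_real)
  note Dd = tagged_division_ofD[OF D(1)]
  define D' where "D' = (\<lambda>(x, k). (Sup k, k)) ` D"
  have Sup_in: "Sup k \<in> k" if xk: "(x, k) \<in> D" for x k
  proof -
    obtain u v where "k = {u..v}" using Dd(4)[OF xk] by auto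
    then show ?thesis using Dd(2)[OF xk] by auto
  qed
  have D': "D' tagged_division_of {a..b}"
  proof (rule tagged_division_ofI)
    show "finite D'" using Dd(1) by (simp add: D'_def)
    show "x \<in> K" "K \<subseteq> {a..b}" "\<exists>u v. K = cbox u v" if "(x, K) \<in> D'" for x K
      using that Dd(3,4) Sup_in unfolding D'_def by fastforce+
    show "interior K1 \<inter> interior K2 = {}" if xk: "(x1, K1) \<in> D'" "(x2, K2) \<in> D'" "(x1, K1) \<noteq> (x2, K2)" for x1 K1 x2 K2
    proof -
      obtain y1 y2 where "(y1, K1) \<in> D" "(y2, K2) \<in> D" "x1 = Sup K1" "x2 = Sup K2"
        using xk unfolding D'_def by auto
      then show ?thesis using xk(3) by (intro Dd(5)[of y1 K1 y2 K2]) auto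
    qed
    have "{K. \<exists>x. (x, K) \<in> D'} = {K. \<exists>x. (x, K) \<in> D}" unfolding D'_def by force
    then show "\<Union> {K. \<exists>x. (x, K) \<in> D'} = {a..b}" using Dd(6) by simp
  qed
  have "(\<lambda>x. ball x d) fine D'"
    unfolding fine_def
  proof safe
    fix x K y assume "(x, K) \<in> D'" "y \<in> K"
    then obtain z where z: "(z, K) \<in> D" "x = Sup K" unfolding D'_def by auto
    then have "K \<subseteq> ball z (d' / 2)" using D(2) by (auto simp: fine_def)
    then have "dist z x < d' / 2" "dist z y < d' / 2"
      using Sup_in[OF z(1)] z(2) \<open>y \<in> K\<close> by auto
    then have "dist x y < d'" by (rule dist_triangle_half_r)
    then show "y \<in> ball x d" using d' by simp
  qed
  with fine D' have "\<bar>(\<Sum>(x, k)\<in>D'. f x * (g (Sup k) - g (Inf k))) - I\<bar> < e" by blast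
  also have "(\<Sum>(x, k)\<in>D'. f x * (g (Sup k) - g (Inf k))) = (\<Sum>(x, k)\<in>D'. f (Sup k) * (g (Sup k) - g (Inf k)))"
    by (rule sum.cong) (auto simp: D'_def)
  finally have *: "\<bar>(\<Sum>(x, k)\<in>D'. f (Sup k) * (g (Sup k) - g (Inf k))) - I\<bar> < e" .
  have "Sup k - Inf k < \<delta>" if xk: "(x, k) \<in> D'" for x k
  proof -
    obtain z where z: "(z, k) \<in> D" using xk unfolding D'_def by auto
    obtain u v where k: "k = {u..v}" using Dd(4)[OF z] by auto
    then have "u \<in> k" "v \<in> k" "Sup k = v" "Inf k = u" using Dd(2)[OF z] by auto
    moreover have "k \<subseteq> ball z (d' / 2)" using z D(2) by (auto simp: fine_def)
    ultimately have "dist z v < d' / 2" "dist z u < d' / 2" by auto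
    then have "dist v u < d'" by (rule dist_triangle_half_r)
    then show ?thesis using d' \<open>Sup k = v\<close> \<open>Inf k = u\<close> by (simp add: dist_real_def)
  qed
  with that[OF D'] * show ?thesis by blast
qed

text \<open>The left half line is closed and the right one open, as in the two tail conditions on the innovations.\<close>
definition two_sided_tail :: "real measure \<Rightarrow> real \<Rightarrow> real" where
  "two_sided_tail \<mu> x = measure \<mu> {y. y \<le> - x \<or> x < y}"

text \<open>
  Capping \<open>y\<^sup>2\<close> at \<open>x\<^sup>2\<close> instead of restricting to \<open>\<bar>y\<bar> \<le> x\<close> makes this function the integral of the tail
  against \<open>d(s\<^sup>2)\<close> over \<open>[0, x]\<close>; the two lemmas on increments below are the discrete form of that identity.
\<close>
definition truncated_moment :: "real measure \<Rightarrow> real \<Rightarrow> real" where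
  "truncated_moment \<mu> x = (\<integral>y. min (y\<^sup>2) (x\<^sup>2) \<partial>\<mu>)"

context real_distribution
begin

lemma two_sided_tail_antimono:
  assumes "x \<le> z" shows "two_sided_tail M z \<le> two_sided_tail M x"
  unfolding two_sided_tail_def using assms by (intro finite_measure_mono) auto

lemma integrable_truncated: "integrable M (\<lambda>y. min (y\<^sup>2) (x\<^sup>2))"
  by (rule integrable_const_bound[where B="x\<^sup>2"]) auto

lemma truncated_moment_nonneg: "truncated_moment M x \<ge> 0"
  unfolding truncated_moment_def by simp

lemma truncated_moment_le: "truncated_moment M x \<le> x\<^sup>2"
proof -
  have "truncated_moment M x \<le> (\<integral>y. x\<^sup>2 \<partial>M)"
    unfolding truncated_moment_def by (intro integral_mono integrable_truncated) auto
  then show ?thesis using prob_space by simp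
qed

lemma truncated_moment_mono:
  assumes "0 \<le> s" "s \<le> x"
  shows "truncated_moment M s \<le> truncated_moment M x"
  unfolding truncated_moment_def
proof (intro integral_mono integrable_truncated)
  show "min (y\<^sup>2) (s\<^sup>2) \<le> min (y\<^sup>2) (x\<^sup>2)" for y
    using power_mono[OF assms(2,1), of 2] by auto
qed

lemma truncated_moment_increment_upper:
  assumes "0 \<le> s" "s \<le> x"
  shows "truncated_moment M x - truncated_moment M s \<le> (x\<^sup>2 - s\<^sup>2) * two_sided_tail M s"
proof -
  have sx: "s\<^sup>2 \<le> x\<^sup>2" using assms by (intro power_mono) auto
  have "truncated_moment M x - truncated_moment M s = (\<integral>y. min (y\<^sup>2) (x\<^sup>2) - min (y\<^sup>2) (s\<^sup>2) \<partial>M)"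
    unfolding truncated_moment_def
    by (rule Bochner_Integration.integral_diff[symmetric]) (rule integrable_truncated)+
  also have "\<dots> \<le> (\<integral>y. (x\<^sup>2 - s\<^sup>2) * indicator {y. y \<le> - s \<or> s < y} y \<partial>M)"
  proof (rule integral_mono)
    show "integrable M (\<lambda>y. min (y\<^sup>2) (x\<^sup>2) - min (y\<^sup>2) (s\<^sup>2))"
      by (intro Bochner_Integration.integrable_diff integrable_truncated)
    show "integrable M (\<lambda>y. (x\<^sup>2 - s\<^sup>2) * indicator {y. y \<le> - s \<or> s < y} y)"
      by (intro integrable_mult_right integrable_real_indicator) (auto simp: less_top[symmetric])
    fix y
    show "min (y\<^sup>2) (x\<^sup>2) - min (y\<^sup>2) (s\<^sup>2) \<le> (x\<^sup>2 - s\<^sup>2) * indicator {y. y \<le> - s \<or> s < y} y"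
    proof (cases "y \<le> - s \<or> s < y")
      case True
      then have "\<bar>s\<bar> \<le> \<bar>y\<bar>" using assms by auto
      then have "s\<^sup>2 \<le> y\<^sup>2" by (simp add: abs_le_square_iff)
      then show ?thesis using True by simp
    next
      case False
      then have "\<bar>y\<bar> \<le> \<bar>s\<bar>" by auto
      then have "y\<^sup>2 \<le> s\<^sup>2" by (simp add: abs_le_square_iff)
      then show ?thesis using False sx by simp
    qed
  qed
  also have "\<dots> = (x\<^sup>2 - s\<^sup>2) * two_sided_tail M s"
    by (simp add: two_sided_tail_def)
  finally show ?thesis .
qed

lemma truncated_moment_increment_lower:
  assumes "0 \<le> s" "s \<le> x"
  shows "(x\<^sup>2 - s\<^sup>2) * two_sided_tail M x \<le> truncated_moment M x - truncated_moment M s"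
proof -
  have sx: "s\<^sup>2 \<le> x\<^sup>2" using assms by (intro power_mono) auto
  have "(x\<^sup>2 - s\<^sup>2) * two_sided_tail M x = (\<integral>y. (x\<^sup>2 - s\<^sup>2) * indicator {y. y \<le> - x \<or> x < y} y \<partial>M)"
    by (simp add: two_sided_tail_def)
  also have "\<dots> \<le> (\<integral>y. min (y\<^sup>2) (x\<^sup>2) - min (y\<^sup>2) (s\<^sup>2) \<partial>M)"
  proof (rule integral_mono)
    show "integrable M (\<lambda>y. min (y\<^sup>2) (x\<^sup>2) - min (y\<^sup>2) (s\<^sup>2))"
      by (intro Bochner_Integration.integrable_diff integrable_truncated)
    show "integrable M (\<lambda>y. (x\<^sup>2 - s\<^sup>2) * indicator {y. y \<le> - x \<or> x < y} y)"
      by (intro integrable_mult_right integrable_real_indicator) (auto simp: less_top[symmetric])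
    fix y
    show "(x\<^sup>2 - s\<^sup>2) * indicator {y. y \<le> - x \<or> x < y} y \<le> min (y\<^sup>2) (x\<^sup>2) - min (y\<^sup>2) (s\<^sup>2)"
    proof (cases "y \<le> - x \<or> x < y")
      case True
      then have "\<bar>x\<bar> \<le> \<bar>y\<bar>" using assms by auto
      then have "x\<^sup>2 \<le> y\<^sup>2" by (simp add: abs_le_square_iff)
      then show ?thesis using True sx by simp
    qed (use sx in auto)
  qed
  also have "\<dots> = truncated_moment M x - truncated_moment M s"
    unfolding truncated_moment_def
    by (rule Bochner_Integration.integral_diff) (rule integrable_truncated)+
  finally show ?thesis .
qed

text \<open>
  Half of Karamata's theorem. Let \<open>G\<close> be the tail. Doubling \<open>x\<close> adds at most \<open>3 * x\<^sup>2 * G x\<close> to the truncated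
  moment, while \<open>x\<^sup>2 * G x\<close> itself is eventually multiplied by almost \<open>2 powr (2 - \<alpha>) > 1\<close>; so the increments form
  a series dominated by a geometric one, and the last of them dominates the sum.
\<close>
lemma truncated_moment_index_lt_2:
  fixes h :: "real \<Rightarrow> real"
  assumes \<alpha>: "0 < \<alpha>" "\<alpha> < 2" and h: "slowly_varying h"
    and tail: "((\<lambda>x. two_sided_tail M x / (x powr (-\<alpha>) * h x)) \<longlongrightarrow> \<sigma>) at_top" and \<sigma>: "\<sigma> > 0"
  shows "\<exists>C x0. 0 < x0 \<and> 0 < C \<and> (\<forall>x\<ge>x0. truncated_moment M x \<le> C * (x powr (2 - \<alpha>) * h x))"
proof -
  define G where "G = two_sided_tail M"
  define q where "q x = x powr (-\<alpha>) * h x" for x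
  have hpos: "h x > 0" if "x > 0" for x using h that by (simp add: slowly_varying_def)
  have qpos: "q x > 0" if "x > 0" for x using hpos[OF that] that by (simp add: q_def)
  have lim: "((\<lambda>x. G x / q x) \<longlongrightarrow> \<sigma>) at_top" using tail by (simp add: G_def q_def)
  have two: "filterlim (\<lambda>x::real. 2 * x) at_top at_top"
    by (rule filterlim_tendsto_pos_mult_at_top[OF tendsto_const _ filterlim_ident]) simp
  have ratio: "((\<lambda>x. G x / G (2 * x)) \<longlongrightarrow> 2 powr \<alpha>) at_top"
  proof -
    have hr: "((\<lambda>x. h (2 * x) / h x) \<longlongrightarrow> 1) at_top" using h by (simp add: slowly_varying_def)
    have "((\<lambda>x. (G x / q x) / (G (2 * x) / q (2 * x)) * (2 powr \<alpha> / (h (2 * x) / h x))) \<longlongrightarrow> \<sigma> / \<sigma> * (2 powr \<alpha> / 1)) at_top"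
      using \<sigma> by (intro tendsto_intros lim hr filterlim_compose[OF lim two]) auto
    moreover have "\<forall>\<^sub>F x in at_top. (G x / q x) / (G (2 * x) / q (2 * x)) * (2 powr \<alpha> / (h (2 * x) / h x)) = G x / G (2 * x)"
      using eventually_gt_at_top[of 0]
    proof eventually_elim
      case (elim x)
      have "q (2 * x) = q x * (h (2 * x) / h x) / 2 powr \<alpha>"
        using elim hpos[OF elim] by (simp add: q_def powr_mult powr_minus field_simps)
      then show ?case using qpos[OF elim] hpos[OF elim] hpos[of "2 * x"] elim by (simp add: field_simps)
    qed
    ultimately have "((\<lambda>x. G x / G (2 * x)) \<longlongrightarrow> \<sigma> / \<sigma> * (2 powr \<alpha> / 1)) at_top"
      by (rule Lim_transform_eventually)
    then show ?thesis using \<sigma> by simp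
  qed
  \<comment> \<open>any number strictly between \<open>2 powr \<alpha>\<close> and 4\<close>
  define \<kappa> where "\<kappa> = (2 powr \<alpha> + 4) / 2"
  have "2 powr \<alpha> < 2 powr (2::real)" using \<alpha> by (intro powr_less_mono) auto
  then have \<kappa>: "2 powr \<alpha> < \<kappa>" "\<kappa> < 4" "\<kappa> > 0" by (auto simp: \<kappa>_def add_nonneg_pos)
  have "\<forall>\<^sub>F x in at_top. G x / G (2 * x) < \<kappa> \<and> \<sigma> / 2 < G x / q x \<and> G x / q x < 2 * \<sigma>"
    using \<sigma> \<kappa> by (intro eventually_conj order_tendstoD[OF ratio] order_tendstoD[OF lim]) auto
  then obtain b where b: "\<And>x. x \<ge> b \<Longrightarrow> G x / G (2 * x) < \<kappa> \<and> \<sigma> / 2 < G x / q x \<and> G x / q x < 2 * \<sigma>"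
    unfolding eventually_at_top_linorder by blast
  define x0 where "x0 = max 1 b"
  have x0: "x0 > 0" "x0 \<ge> b" by (auto simp: x0_def)
  have ev: "G x / G (2 * x) < \<kappa>" "\<sigma> / 2 < G x / q x" "G x / q x < 2 * \<sigma>" if "x \<ge> x0" for x
    using b[of x] that x0 by auto
  have Gpos: "G x > 0" if "x \<ge> x0" for x
  proof -
    have "0 < G x / q x" using ev(2)[OF that] \<sigma> by linarith
    then show ?thesis using qpos[of x] x0 that by (simp add: zero_less_divide_iff)
  qed
  \<comment> \<open>the first entry gives \<open>(C + 3) * \<kappa> \<le> 4 * C\<close>, the second one starts the induction\<close>
  define C where "C = max (3 * \<kappa> / (4 - \<kappa>)) (1 / G (2 * x0))"
  have C: "C \<ge> 3 * \<kappa> / (4 - \<kappa>)" "C \<ge> 1 / G (2 * x0)" by (auto simp: C_def)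
  have C0: "C > 0" using C(2) Gpos[of "2 * x0"] x0 by (auto intro: less_le_trans[of 0 "1 / G (2 * x0)"])
  have main: "truncated_moment M x \<le> C * (x\<^sup>2 * G x)" if "x \<ge> x0" for x
  proof (rule dyadic_induct[where r=x0 and P="\<lambda>x. truncated_moment M x \<le> C * (x\<^sup>2 * G x)"])
    fix x assume x: "x0 \<le> x" "x \<le> 2 * x0"
    have "1 \<le> C * G (2 * x0)" using C(2) Gpos[of "2 * x0"] x0 by (simp add: field_simps)
    also have "\<dots> \<le> C * G x"
      using C0 x unfolding G_def by (intro mult_left_mono two_sided_tail_antimono) auto
    finally have "x\<^sup>2 * 1 \<le> x\<^sup>2 * (C * G x)" by (intro mult_left_mono) auto
    then show "truncated_moment M x \<le> C * (x\<^sup>2 * G x)"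
      using truncated_moment_le[of x] by (simp add: mult_ac)
  next
    fix x assume x: "x0 \<le> x" "truncated_moment M x \<le> C * (x\<^sup>2 * G x)"
    have "truncated_moment M (2 * x) \<le> truncated_moment M x + ((2 * x)\<^sup>2 - x\<^sup>2) * G x"
      using truncated_moment_increment_upper[of x "2 * x"] x x0 by (simp add: G_def)
    also have "\<dots> \<le> C * (x\<^sup>2 * G x) + 3 * x\<^sup>2 * G x" using x by (simp add: power_mult_distrib)
    also have "\<dots> = (C + 3) * x\<^sup>2 * G x" by (simp add: algebra_simps)
    also have "\<dots> \<le> (C + 3) * x\<^sup>2 * (\<kappa> * G (2 * x))"
      using ev(1)[OF x(1)] Gpos[of "2 * x"] x x0 C0 by (intro mult_left_mono) (auto simp: field_simps)
    also have "\<dots> = ((C + 3) * \<kappa>) * (x\<^sup>2 * G (2 * x))" by simp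
    also have "\<dots> \<le> (4 * C) * (x\<^sup>2 * G (2 * x))"
    proof (rule mult_right_mono)
      show "(C + 3) * \<kappa> \<le> 4 * C" using C(1) \<kappa> by (simp add: field_simps)
      show "0 \<le> x\<^sup>2 * G (2 * x)" using Gpos[of "2 * x"] x x0 by simp
    qed
    finally show "truncated_moment M (2 * x) \<le> C * ((2 * x)\<^sup>2 * G (2 * x))"
      by (simp add: power_mult_distrib)
  qed (use x0 that in auto)
  show ?thesis
  proof (rule exI[of _ "C * (2 * \<sigma>)"], rule exI[of _ x0], intro conjI allI impI)
    fix x assume x: "x0 \<le> x"
    have "truncated_moment M x \<le> C * (x\<^sup>2 * G x)" by (rule main[OF x])
    also have "\<dots> \<le> C * (x\<^sup>2 * (2 * \<sigma> * q x))"
      using ev(3)[OF x] qpos[of x] x x0 C0 by (intro mult_left_mono) (auto simp: field_simps)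
    also have "x\<^sup>2 * (2 * \<sigma> * q x) = 2 * \<sigma> * (x powr (2 - \<alpha>) * h x)"
    proof -
      have "x\<^sup>2 * x powr (-\<alpha>) = x powr (2 - \<alpha>)"
        using x x0 powr_add[of x 2 "-\<alpha>"] by (simp add: powr_numeral)
      then show ?thesis by (simp add: q_def mult_ac)
    qed
    finally show "truncated_moment M x \<le> C * (2 * \<sigma>) * (x powr (2 - \<alpha>) * h x)" by simp
  qed (use x0 C0 \<sigma> in auto)
qed

text \<open>
  Integration by parts: \<open>\<integral> x\<^sup>2 dq = t\<^sup>2 * q t - s\<^sup>2 * q s - \<integral> q d(x\<^sup>2)\<close>, and where \<open>c * q\<close> dominates the tail, the
  last integral is at least the increment of the truncated moment divided by \<open>c\<close>. The tail bound holds only beyond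
  \<open>r0\<close>; therefore the increment is taken from \<open>r\<close>, and the mesh is smaller than \<open>r - r0\<close>, so that an interval of the
  division that reaches beyond \<open>r\<close> starts beyond \<open>r0\<close>.
\<close>
lemma stieltjes_integral_le_truncated_moment:
  assumes st: "0 < s" "s \<le> r" "r \<le> t" and r0: "r0 < r" and q: "\<And>x. x > 0 \<Longrightarrow> q x > 0"
    and tail: "\<And>x. x \<ge> r0 \<Longrightarrow> two_sided_tail M x \<le> c * q x" and c: "c > 0"
    and I: "has_stieltjes_integral (\<lambda>x. x\<^sup>2) q s t I"
  shows "I \<le> t\<^sup>2 * q t - s\<^sup>2 * q s - (truncated_moment M t - truncated_moment M r) / c"
proof (rule field_le_epsilon)
  fix e :: real assume "e > 0"
  then obtain D where D: "D tagged_division_of {s..t}"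
    and mesh: "\<And>x k. (x, k) \<in> D \<Longrightarrow> Sup k - Inf k < r - r0"
    and sum: "\<bar>(\<Sum>(x, k)\<in>D. (Sup k)\<^sup>2 * (q (Sup k) - q (Inf k))) - I\<bar> < e"
    using stieltjes_sum_right_tags[OF I, of e "r - r0"] r0 by auto
  have le: "s \<le> t" using st by simp
  \<comment> \<open>constant to the left of \<open>r\<close>\<close>
  define m where "m x = max (truncated_moment M x) (truncated_moment M r)" for x
  have "(truncated_moment M t - truncated_moment M r) / c = (m t - m s) / c"
    using truncated_moment_mono[of s r] truncated_moment_mono[of r t] st by (simp add: m_def)
  also have "\<dots> = (\<Sum>(x, k)\<in>D. m (Sup k) - m (Inf k)) / c"
    using additive_tagged_division_1[OF le D, of m] by simp
  also have "\<dots> = (\<Sum>(x, k)\<in>D. (m (Sup k) - m (Inf k)) / c)"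
    by (simp add: sum_divide_distrib case_prod_unfold)
  also have "\<dots> \<le> (\<Sum>(x, k)\<in>D. q (Inf k) * ((Sup k)\<^sup>2 - (Inf k)\<^sup>2))"
  proof (rule sum_mono, clarify)
    fix x k assume xk: "(x, k) \<in> D"
    obtain u v where "k = {u..v}" using tagged_division_ofD(4)[OF D xk] by auto
    moreover have "x \<in> k" "k \<subseteq> {s..t}" using tagged_division_ofD(2,3)[OF D xk] by auto
    ultimately have uv: "Inf k = u" "Sup k = v" "u \<le> v" "s \<le> u" by auto
    have u0: "u > 0" using uv st by simp
    have sq: "0 \<le> v\<^sup>2 - u\<^sup>2" using power_mono[of u v 2] uv u0 by simp
    have nn: "0 \<le> q u * (v\<^sup>2 - u\<^sup>2)" using q[OF u0] sq by simp
    have "m v - m u \<le> c * (q u * (v\<^sup>2 - u\<^sup>2))"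
    proof (cases "v \<le> r")
      case True
      then have "m v = m u"
        using truncated_moment_mono[of v r] truncated_moment_mono[of u r] uv u0 by (simp add: m_def)
      then show ?thesis using c nn by simp
    next
      case False
      then have u: "r0 \<le> u" using mesh[OF xk] uv by simp
      have "m v - m u \<le> truncated_moment M v - truncated_moment M u"
        using truncated_moment_mono[of r v] truncated_moment_mono[of u v] False uv u0 st
        by (simp add: m_def)
      also have "\<dots> \<le> (v\<^sup>2 - u\<^sup>2) * two_sided_tail M u"
        using uv u0 by (intro truncated_moment_increment_upper) auto
      also have "\<dots> \<le> (v\<^sup>2 - u\<^sup>2) * (c * q u)"
        using sq tail[OF u] by (intro mult_left_mono) auto
      finally show ?thesis by (simp add: mult_ac)
    qed
    then show "(m (Sup k) - m (Inf k)) / c \<le> q (Inf k) * ((Sup k)\<^sup>2 - (Inf k)\<^sup>2)"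
      using c uv by (simp add: field_simps)
  qed
  also have "\<dots> = (\<Sum>(x, k)\<in>D. (Sup k)\<^sup>2 * q (Sup k) - (Inf k)\<^sup>2 * q (Inf k))
      - (\<Sum>(x, k)\<in>D. (Sup k)\<^sup>2 * (q (Sup k) - q (Inf k)))"
    unfolding sum_subtractf[symmetric] by (rule sum.cong) (auto simp: algebra_simps)
  also have "(\<Sum>(x, k)\<in>D. (Sup k)\<^sup>2 * q (Sup k) - (Inf k)\<^sup>2 * q (Inf k)) = t\<^sup>2 * q t - s\<^sup>2 * q s"
    using additive_tagged_division_1[OF le D, of "\<lambda>x. x\<^sup>2 * q x"] .
  finally show "I \<le> t\<^sup>2 * q t - s\<^sup>2 * q s - (truncated_moment M t - truncated_moment M r) / c + e"
    using sum by linarith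
qed

text \<open>
  Let \<open>m\<close> be the truncated moment and \<open>G\<close> the tail. Integration by parts gives roughly
  \<open>\<sigma> * H t \<ge> m t - \<sigma> * h t\<close>, and \<open>\<sigma> * h t\<close> is close to \<open>t\<^sup>2 * G t\<close>; so \<open>t\<^sup>2 * G t\<close> must be shown to be at most a
  fixed fraction of \<open>m t\<close>. Now \<open>G (t / 2)\<close> is close to \<open>4 * G t\<close>, so each of the shells \<open>[t / 2, t]\<close>, \<open>[t / 4, t / 2]\<close>
  and \<open>[t / 8, t / 4]\<close> contributes nearly \<open>3 / 4 * t\<^sup>2 * G t\<close> to \<open>m t\<close>, together more than twice \<open>t\<^sup>2 * G t\<close>.
\<close>
lemma truncated_moment_index_2:
  fixes h H :: "real \<Rightarrow> real"
  assumes h: "slowly_varying h" and H: "tail_normalizer 2 h H"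
    and tail: "((\<lambda>x. two_sided_tail M x / (x powr (-2) * h x)) \<longlongrightarrow> \<sigma>) at_top" and \<sigma>: "\<sigma> > 0"
  shows "\<exists>C x0. 0 < x0 \<and> 0 < C \<and> (\<forall>x\<ge>x0. truncated_moment M x \<le> C * H x)"
proof -
  define G where "G = two_sided_tail M"
  define q where "q x = h x / x\<^sup>2" for x
  define m where "m = truncated_moment M"
  have hpos: "h x > 0" if "x > 0" for x using h that by (simp add: slowly_varying_def)
  have qpos: "q x > 0" if "x > 0" for x using hpos[OF that] that by (simp add: q_def)
  have lim: "((\<lambda>x. G x / q x) \<longlongrightarrow> \<sigma>) at_top"
  proof (rule Lim_transform_eventually[OF tail])
    show "\<forall>\<^sub>F x in at_top. two_sided_tail M x / (x powr (-2) * h x) = G x / q x"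
      using eventually_gt_at_top[of 0]
      by eventually_elim (simp add: G_def q_def powr_minus powr_numeral field_simps)
  qed
  have half: "filterlim (\<lambda>x::real. x / 2) at_top at_top"
    using filterlim_tendsto_pos_mult_at_top[OF tendsto_const _ filterlim_ident, of "1/2 :: real"] by simp
  have hr: "((\<lambda>x. h (1 / 2 * x) / h x) \<longlongrightarrow> 1) at_top"
  proof -
    have "\<forall>c>0. ((\<lambda>x. h (c * x) / h x) \<longlongrightarrow> 1) at_top" using h by (simp add: slowly_varying_def)
    then show ?thesis by (rule allE[of _ "1/2"]) simp
  qed
  have ratio: "((\<lambda>x. G (x / 2) / G x) \<longlongrightarrow> 4) at_top"
  proof -
    have "((\<lambda>x. (G (x / 2) / q (x / 2)) / (G x / q x) * (4 * (h (1 / 2 * x) / h x))) \<longlongrightarrow> \<sigma> / \<sigma> * (4 * 1)) at_top"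
      using \<sigma> by (intro tendsto_intros lim hr filterlim_compose[OF lim half]) auto
    moreover have "\<forall>\<^sub>F x in at_top. (G (x / 2) / q (x / 2)) / (G x / q x) * (4 * (h (1 / 2 * x) / h x)) = G (x / 2) / G x"
      using eventually_gt_at_top[of 0]
    proof eventually_elim
      case (elim x)
      have "q (x / 2) = q x * (4 * (h (1 / 2 * x) / h x))"
        using elim hpos[OF elim] by (simp add: q_def field_simps power2_eq_square)
      moreover have "q (x / 2) > 0" "q x > 0" using elim by (auto intro: qpos)
      ultimately show ?case using hpos[OF elim] hpos[of "x / 2"] elim by (simp add: field_simps)
    qed
    ultimately have "((\<lambda>x. G (x / 2) / G x) \<longlongrightarrow> \<sigma> / \<sigma> * (4 * 1)) at_top"
      by (rule Lim_transform_eventually)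
    then show ?thesis using \<sigma> by simp
  qed
  \<comment> \<open>\<open>36 / 10\<close> is \<open>9 / 10\<close> of the limit 4\<close>
  have "\<forall>\<^sub>F x in at_top. 36 / 10 < G (x / 2) / G x \<and> 9 / 10 * \<sigma> < G x / q x \<and> G x / q x < 11 / 10 * \<sigma>"
    using \<sigma> by (intro eventually_conj order_tendstoD[OF ratio] order_tendstoD[OF lim]) auto
  then obtain b where b: "\<And>x. x \<ge> b \<Longrightarrow> 36 / 10 < G (x / 2) / G x \<and> 9 / 10 * \<sigma> < G x / q x \<and> G x / q x < 11 / 10 * \<sigma>"
    unfolding eventually_at_top_linorder by blast
  define x0 where "x0 = max 1 b"
  have x0: "x0 > 0" "x0 \<ge> b" by (auto simp: x0_def)
  have Glo: "9 / 10 * \<sigma> * q x < G x" and Gup: "G x < 11 / 10 * \<sigma> * q x" and Gpos: "G x > 0"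
    and Ghalf: "36 / 10 * G x < G (x / 2)" if x: "x \<ge> x0" for x
  proof -
    have qx: "q x > 0" using x x0 by (intro qpos) simp
    show 1: "9 / 10 * \<sigma> * q x < G x" and "G x < 11 / 10 * \<sigma> * q x"
      using b[of x] x x0 qx by (auto simp: field_simps)
    have "0 < 9 / 10 * \<sigma> * q x" using \<sigma> qx by simp
    with 1 show "G x > 0" by linarith
    then show "36 / 10 * G x < G (x / 2)" using b[of x] x x0 by (auto simp: field_simps)
  qed
  define D where "D t = m t - m (2 * x0)" for t
  \<comment> \<open>the three shells yield \<open>3 / 4 * (1 + 9 / 10 + 81 / 100) = 2.0325\<close>\<close>
  have D_ge: "203 / 100 * (t\<^sup>2 * G t) \<le> D t" if t: "t \<ge> 16 * x0" for t
  proof -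
    have 1: "(t\<^sup>2 - (t/2)\<^sup>2) * G t \<le> m t - m (t / 2)"
      and 2: "((t/2)\<^sup>2 - (t/4)\<^sup>2) * G (t/2) \<le> m (t/2) - m (t/4)"
      and 3: "((t/4)\<^sup>2 - (t/8)\<^sup>2) * G (t/4) \<le> m (t/4) - m (t/8)"
      using t x0 unfolding m_def G_def by (auto intro!: truncated_moment_increment_lower)
    have g1: "36 / 10 * G t \<le> G (t/2)" using Ghalf[of t] t x0 by simp
    have g2: "36 / 10 * G (t/2) \<le> G (t/4)" using Ghalf[of "t/2"] t x0 by simp
    have "m (2 * x0) \<le> m (t / 8)" using t x0 unfolding m_def by (intro truncated_moment_mono) auto
    then have "D t \<ge> (t\<^sup>2 - (t/2)\<^sup>2) * G t + ((t/2)\<^sup>2 - (t/4)\<^sup>2) * G (t/2) + ((t/4)\<^sup>2 - (t/8)\<^sup>2) * G (t/4)"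
      using 1 2 3 by (simp add: D_def)
    moreover have "((t/2)\<^sup>2 - (t/4)\<^sup>2) * G (t/2) \<ge> ((t/2)\<^sup>2 - (t/4)\<^sup>2) * (36 / 10 * G t)"
      using g1 by (intro mult_left_mono) (auto simp: power_divide)
    moreover have "((t/4)\<^sup>2 - (t/8)\<^sup>2) * G (t/4) \<ge> ((t/4)\<^sup>2 - (t/8)\<^sup>2) * (36 / 10 * (36 / 10 * G t))"
      using g1 g2 by (intro mult_left_mono) (auto simp: power_divide)
    ultimately have "D t \<ge> (t\<^sup>2 - (t/2)\<^sup>2) * G t + ((t/2)\<^sup>2 - (t/4)\<^sup>2) * (36 / 10 * G t) + ((t/4)\<^sup>2 - (t/8)\<^sup>2) * (36 / 10 * (36 / 10 * G t))"
      by linarith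
    also have "(t\<^sup>2 - (t/2)\<^sup>2) * G t + ((t/2)\<^sup>2 - (t/4)\<^sup>2) * (36 / 10 * G t) + ((t/4)\<^sup>2 - (t/8)\<^sup>2) * (36 / 10 * (36 / 10 * G t))
        = (3/4 + 3/16 * (36/10) + 3/64 * (36/10) * (36/10)) * (t\<^sup>2 * G t)"
      by (simp add: power_divide algebra_simps)
    finally have "(3/4 + 3/16 * (36/10) + 3/64 * (36/10) * (36/10)) * (t\<^sup>2 * G t) \<le> D t" .
    moreover have "203 / 100 * (t\<^sup>2 * G t) \<le> (3/4 + 3/16 * (36/10) + 3/64 * (36/10) * (36/10)) * (t\<^sup>2 * G t)"
      using Gpos[of t] t x0 by (intro mult_right_mono) auto
    ultimately show ?thesis by linarith
  qed
  have H_ge: "D t / (11 / 10 * \<sigma>) - h t \<le> H t" if t: "t \<ge> 16 * x0" for t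
  proof -
    have t0: "t > 0" using t x0 by simp
    have "q = (\<lambda>s. h s / s\<^sup>2)" by (simp add: q_def fun_eq_iff)
    then have "has_stieltjes_integral_from_0 (\<lambda>s. s\<^sup>2) q t (- H t)"
      using H t0 by (simp add: tail_normalizer_def)
    then obtain F where F: "\<forall>s. 0 < s \<and> s < t \<longrightarrow> has_stieltjes_integral (\<lambda>s. s\<^sup>2) q s t (F s)"
      and Flim: "(F \<longlongrightarrow> - H t) (at_right 0)"
      unfolding has_stieltjes_integral_from_0_def by (elim exE conjE)
    have x0': "0 < 2 * x0" using x0 by simp
    have "\<forall>\<^sub>F s in at_right 0. F s \<le> h t - D t / (11 / 10 * \<sigma>)"
      using eventually_at_right_real[of 0 "2 * x0", OF x0']
    proof (eventually_elim)
      case (elim s)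
      then have s: "0 < s" "s < 2 * x0" by auto
      have "F s \<le> t\<^sup>2 * q t - s\<^sup>2 * q s - (m t - m (2 * x0)) / (11 / 10 * \<sigma>)"
        unfolding m_def
      proof (rule stieltjes_integral_le_truncated_moment[where ?r0.0=x0])
        show "two_sided_tail M x \<le> 11 / 10 * \<sigma> * q x" if "x \<ge> x0" for x
          using Gup[OF that] by (simp add: G_def)
        show "has_stieltjes_integral (\<lambda>x. x\<^sup>2) q s t (F s)" using F s t by simp
      qed (use s t x0 \<sigma> qpos in auto)
      also have "t\<^sup>2 * q t = h t" using t0 by (simp add: q_def)
      also have "s\<^sup>2 * q s = h s" using s by (simp add: q_def)
      finally show ?case using hpos[OF s(1)] by (simp add: D_def)
    qed
    then have "- H t \<le> h t - D t / (11 / 10 * \<sigma>)"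
      by (rule tendsto_upperbound[OF Flim]) simp
    then show ?thesis by simp
  qed
  \<comment> \<open>a positive lower bound of \<open>D\<close> beyond \<open>16 * x0\<close>, which absorbs the constant \<open>m (2 * x0)\<close>\<close>
  define \<kappa> where "\<kappa> = D (16 * x0)"
  have \<kappa>: "\<kappa> > 0"
  proof -
    have "0 < 203 / 100 * ((16 * x0)\<^sup>2 * G (16 * x0))" using Gpos[of "16 * x0"] x0 by simp
    also have "\<dots> \<le> \<kappa>" unfolding \<kappa>_def by (rule D_ge) simp
    finally show ?thesis .
  qed
  define C where "C = (1 + m (2 * x0) / \<kappa>) * (10 * \<sigma>)"
  have m0: "m (2 * x0) \<ge> 0" unfolding m_def by (rule truncated_moment_nonneg)
  show ?thesis
  proof (rule exI[of _ C], rule exI[of _ "16 * x0"], intro conjI allI impI)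
    show "0 < C" using m0 \<kappa> \<sigma> by (auto simp: C_def intro!: mult_pos_pos add_pos_nonneg)
    fix t assume t: "16 * x0 \<le> t"
    have t0: "t > 0" using t x0 by simp
    have "h t * \<sigma> \<le> 10 / 9 * (t\<^sup>2 * G t)"
      using Glo[of t] t x0 by (simp add: q_def field_simps)
    also have "\<dots> \<le> 10 / 9 * (100 / 203 * D t)" using D_ge[OF t] by linarith
    finally have h\<sigma>: "h t * \<sigma> \<le> 1000 / 1827 * D t" by simp
    have D\<kappa>: "\<kappa> \<le> D t"
      unfolding \<kappa>_def D_def m_def using t x0 truncated_moment_mono[of "16 * x0" t] by simp
    have "10 / 11 * D t - h t * \<sigma> \<le> H t * \<sigma>"
    proof -
      have "(D t / (11 / 10 * \<sigma>) - h t) * \<sigma> \<le> H t * \<sigma>"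
        using H_ge[OF t] \<sigma> by (intro mult_right_mono) auto
      then show ?thesis using \<sigma> by (simp add: left_diff_distrib)
    qed
    \<comment> \<open>\<open>10 / 11 - 1000 / 1827\<close> is about \<open>0.36\<close>, more than \<open>1 / 10\<close>\<close>
    then have "D t \<le> 10 * (H t * \<sigma>)"
      using h\<sigma> D\<kappa> \<kappa> by linarith
    then have DH: "D t \<le> 10 * \<sigma> * H t" by (simp add: mult_ac)
    have "m t = D t + m (2 * x0) / \<kappa> * \<kappa>" using \<kappa> by (simp add: D_def)
    also have "\<dots> \<le> D t + m (2 * x0) / \<kappa> * D t"
      using D\<kappa> m0 \<kappa> by (intro add_left_mono mult_left_mono) auto
    also have "\<dots> = (1 + m (2 * x0) / \<kappa>) * D t" by (simp add: algebra_simps)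
    also have "\<dots> \<le> (1 + m (2 * x0) / \<kappa>) * (10 * \<sigma> * H t)"
      using m0 \<kappa> DH by (intro mult_left_mono) (auto intro: add_nonneg_nonneg)
    finally show "truncated_moment M t \<le> C * H t" by (simp add: C_def m_def mult_ac)
  qed (use x0 in auto)
qed

lemma truncated_moment_le_tail_normalizer:
  fixes h H :: "real \<Rightarrow> real"
  assumes \<alpha>: "0 < \<alpha>" "\<alpha> \<le> 2" and h: "slowly_varying h" and H: "tail_normalizer \<alpha> h H"
    and tail: "((\<lambda>x. two_sided_tail M x / (x powr (-\<alpha>) * h x)) \<longlongrightarrow> \<sigma>) at_top" and \<sigma>: "\<sigma> > 0"
  shows "\<exists>C x0. 0 < x0 \<and> 0 < C \<and> (\<forall>x\<ge>x0. truncated_moment M x \<le> C * (x powr (2 - \<alpha>) * H x))"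
proof (cases "\<alpha> = 2")
  case True
  then obtain C x0 where "0 < x0" "0 < C" "\<forall>x\<ge>x0. truncated_moment M x \<le> C * H x"
    using truncated_moment_index_2[of h H \<sigma>] assms by auto
  then show ?thesis using True by - (rule exI[of _ C], rule exI[of _ x0], auto)
next
  case False
  then have "\<alpha> < 2" using \<alpha> by simp
  then obtain C x0 where "0 < x0" "0 < C" "\<forall>x\<ge>x0. truncated_moment M x \<le> C * (x powr (2 - \<alpha>) * h x)"
    using truncated_moment_index_lt_2[OF \<alpha>(1) _ h tail \<sigma>] by blast
  moreover have "H x = h x" if "x > 0" for x
    using H that \<open>\<alpha> < 2\<close> by (auto simp: tail_normalizer_def)
  ultimately show ?thesis by - (rule exI[of _ C], rule exI[of _ x0], auto)
qed

end

section \<open>Smoothing by a Lipschitz density\<close>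

text \<open>The mean of \<open>K (A + t)\<close> when \<open>A\<close> has density \<open>p\<close>.\<close>
definition smoothed :: "(real \<Rightarrow> real) \<Rightarrow> (real \<Rightarrow> real) \<Rightarrow> real \<Rightarrow> real" where
  "smoothed p K t = (\<integral>z. K z * p (z - t) \<partial>lborel)"

text \<open>Independence of two variables whose values may have different types.\<close>
definition independent_pair ::
    "'a measure \<Rightarrow> 'b measure \<Rightarrow> ('a \<Rightarrow> 'b) \<Rightarrow> 'c measure \<Rightarrow> ('a \<Rightarrow> 'c) \<Rightarrow> bool" where
  "independent_pair M S X T Y \<longleftrightarrow> X \<in> M \<rightarrow>\<^sub>M S \<and> Y \<in> M \<rightarrow>\<^sub>M T \<and>
     distr M (S \<Otimes>\<^sub>M T) (\<lambda>\<omega>. (X \<omega>, Y \<omega>)) = distr M S X \<Otimes>\<^sub>M distr M T Y"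

lemma (in prob_space) independent_pair_of_indep_var:
  assumes ind: "indep_var S X T Y" and f: "f \<in> S \<rightarrow>\<^sub>M S'" and g: "g \<in> T \<rightarrow>\<^sub>M T'"
  shows "independent_pair M S' (\<lambda>\<omega>. f (X \<omega>)) T' (\<lambda>\<omega>. g (Y \<omega>))"
proof -
  have rv[measurable]: "X \<in> M \<rightarrow>\<^sub>M S" "Y \<in> M \<rightarrow>\<^sub>M T"
    using indep_var_rv1[OF ind] indep_var_rv2[OF ind] by auto
  note [measurable] = f g
  have fX: "(\<lambda>\<omega>. f (X \<omega>)) \<in> M \<rightarrow>\<^sub>M S'" and gY: "(\<lambda>\<omega>. g (Y \<omega>)) \<in> M \<rightarrow>\<^sub>M T'" by measurable
  have sf: "sigma_finite_measure (distr (distr M T Y) T' g)"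
  proof -
    interpret Z: prob_space "distr M T Y" by (rule prob_space_distr) simp
    interpret Z': prob_space "distr (distr M T Y) T' g" by (rule Z.prob_space_distr) simp
    show ?thesis ..
  qed
  have "distr M S' (\<lambda>\<omega>. f (X \<omega>)) \<Otimes>\<^sub>M distr M T' (\<lambda>\<omega>. g (Y \<omega>))
      = distr (distr M S X) S' f \<Otimes>\<^sub>M distr (distr M T Y) T' g"
    by (simp add: distr_distr comp_def)
  also have "\<dots> = distr (distr M S X \<Otimes>\<^sub>M distr M T Y) (S' \<Otimes>\<^sub>M T') (\<lambda>(x, y). (f x, g y))"
    by (rule pair_measure_distr) (use sf in auto)
  also have "distr M S X \<Otimes>\<^sub>M distr M T Y = distr M (S \<Otimes>\<^sub>M T) (\<lambda>\<omega>. (X \<omega>, Y \<omega>))"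
    using ind by (simp add: indep_var_distribution_eq)
  also have "distr \<dots> (S' \<Otimes>\<^sub>M T') (\<lambda>(x, y). (f x, g y)) = distr M (S' \<Otimes>\<^sub>M T') (\<lambda>\<omega>. (f (X \<omega>), g (Y \<omega>)))"
    by (subst distr_distr) (auto simp: comp_def)
  finally show ?thesis using fX gY by (simp add: independent_pair_def)
qed

text \<open>One constant for both bounds suits the way they are combined, through \<open>min 1 \<bar>s - t\<bar>\<close>.\<close>
locale lipschitz_density =
  fixes p :: "real \<Rightarrow> real" and C :: real
  assumes measurable_p[measurable]: "p \<in> borel_measurable borel"
    and p_nonneg: "\<And>x. 0 \<le> p x" and p_le: "\<And>x. p x \<le> C"
    and p_lipschitz: "\<And>x y. \<bar>p x - p y\<bar> \<le> C * \<bar>x - y\<bar>"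
begin

lemma C_nonneg: "0 \<le> C"
  using p_nonneg[of 0] p_le[of 0] by linarith

context
  fixes K :: "real \<Rightarrow> real"
  assumes K: "integrable lborel K"
begin

lemma measurable_K [measurable]: "K \<in> borel_measurable borel"
  using K by auto

lemma integrable_smoothed: "integrable lborel (\<lambda>z. K z * p (z - t))"
proof (rule Bochner_Integration.integrable_bound[where f="\<lambda>z. C * K z"])
  show "AE z in lborel. norm (K z * p (z - t)) \<le> norm (C * K z)"
  proof (rule AE_I2)
    fix z
    have "p (z - t) * \<bar>K z\<bar> \<le> C * \<bar>K z\<bar>" by (intro mult_right_mono p_le) auto
    then show "norm (K z * p (z - t)) \<le> norm (C * K z)"
      using p_nonneg C_nonneg by (simp add: abs_mult mult.commute)
  qed
qed (use K in auto)

lemma smoothed_bound: "\<bar>smoothed p K t\<bar> \<le> C * (\<integral>z. \<bar>K z\<bar> \<partial>lborel)"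
proof -
  have "\<bar>smoothed p K t\<bar> \<le> (\<integral>z. C * \<bar>K z\<bar> \<partial>lborel)"
    unfolding smoothed_def real_norm_def[symmetric]
  proof (rule Bochner_Integration.integral_norm_bound_integral[OF integrable_smoothed])
    show "norm (K z * p (z - t)) \<le> C * norm (K z)" for z
    proof -
      have "p (z - t) * \<bar>K z\<bar> \<le> C * \<bar>K z\<bar>" by (intro mult_right_mono p_le) auto
      then show ?thesis using p_nonneg by (simp add: abs_mult mult.commute)
    qed
  qed (use K in auto)
  then show ?thesis by simp
qed

lemma smoothed_diff:
  "\<bar>smoothed p K s - smoothed p K t\<bar> \<le> C * (\<integral>z. \<bar>K z\<bar> \<partial>lborel) * min 1 \<bar>s - t\<bar>"
proof -
  have "smoothed p K s - smoothed p K t = (\<integral>z. K z * p (z - s) - K z * p (z - t) \<partial>lborel)"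
    unfolding smoothed_def
    by (rule Bochner_Integration.integral_diff[symmetric]) (rule integrable_smoothed)+
  also have "\<bar>\<dots>\<bar> \<le> (\<integral>z. (C * min 1 \<bar>s - t\<bar>) * \<bar>K z\<bar> \<partial>lborel)"
    unfolding real_norm_def[symmetric]
  proof (rule Bochner_Integration.integral_norm_bound_integral)
    show "integrable lborel (\<lambda>z. K z * p (z - s) - K z * p (z - t))"
      by (intro Bochner_Integration.integrable_diff integrable_smoothed)
    fix z
    have "\<bar>p (z - s) - p (z - t)\<bar> \<le> C * min 1 \<bar>s - t\<bar>"
      using p_lipschitz[of "z - s" "z - t"] p_le[of "z - s"] p_le[of "z - t"]
        p_nonneg[of "z - s"] p_nonneg[of "z - t"] C_nonneg
      by (auto simp: min_def abs_minus_commute abs_le_iff)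
    then have "\<bar>K z\<bar> * \<bar>p (z - s) - p (z - t)\<bar> \<le> \<bar>K z\<bar> * (C * min 1 \<bar>s - t\<bar>)"
      by (intro mult_left_mono) auto
    then show "norm (K z * p (z - s) - K z * p (z - t)) \<le> C * min 1 (norm (s - t)) * norm (K z)"
      by (simp add: right_diff_distrib[symmetric] abs_mult mult_ac)
  qed (intro integrable_mult_right integrable_norm K)
  also have "\<dots> = C * (\<integral>z. \<bar>K z\<bar> \<partial>lborel) * min 1 \<bar>s - t\<bar>" by simp
  finally show ?thesis .
qed

lemma measurable_smoothed [measurable]: "smoothed p K \<in> borel_measurable borel"
  unfolding smoothed_def by measurable

lemma smoothed_eq_integral_density:
  "smoothed p K t = (\<integral>x. K (x + t) \<partial>density lborel (\<lambda>x. ennreal (p x)))"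
proof -
  have "smoothed p K t = (\<integral>x. K (t + 1 * x) * p ((t + 1 * x) - t) \<partial>lborel)"
    unfolding smoothed_def by (subst lborel_integral_real_affine[where c=1 and t=t]) auto
  also have "\<dots> = (\<integral>x. p x *\<^sub>R K (x + t) \<partial>lborel)" by (simp add: mult.commute add.commute)
  also have "\<dots> = (\<integral>x. K (x + t) \<partial>density lborel (\<lambda>x. ennreal (p x)))"
    by (rule integral_density[symmetric]) (auto simp: p_nonneg)
  finally show ?thesis .
qed

end

end

text \<open>Given \<open>T\<close>, the sum \<open>A + T\<close> has density \<open>x \<mapsto> p (x - T)\<close>, which is at most \<open>C\<close>.\<close>
lemma (in prob_space) nn_integral_sum_density_le:
  fixes A T :: "'a \<Rightarrow> real" and F :: "real \<Rightarrow> ennreal"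
  assumes "lipschitz_density p C" and ind: "independent_pair M borel A borel T"
    and law: "distr M borel A = density lborel (\<lambda>x. ennreal (p x))"
    and [measurable]: "F \<in> borel_measurable borel"
  shows "(\<integral>\<^sup>+\<omega>. F (A \<omega> + T \<omega>) \<partial>M) \<le> ennreal C * (\<integral>\<^sup>+x. F x \<partial>lborel)"
proof -
  interpret lipschitz_density p C by fact
  have [measurable]: "A \<in> borel_measurable M" "T \<in> borel_measurable M"
    using ind by (auto simp: independent_pair_def)
  let ?N = "distr M borel T" and ?L = "distr M borel A"
  interpret \<nu>: prob_space "?N" by (rule prob_space_distr) simp
  interpret \<lambda>: prob_space "?L" by (rule prob_space_distr) simp
  interpret P: pair_sigma_finite "?L" "?N" ..
  have joint: "distr M (borel \<Otimes>\<^sub>M borel) (\<lambda>\<omega>. (A \<omega>, T \<omega>)) = ?L \<Otimes>\<^sub>M ?N"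
    using ind by (simp add: independent_pair_def)
  have "(\<integral>\<^sup>+\<omega>. F (A \<omega> + T \<omega>) \<partial>M) = (\<integral>\<^sup>+z. F (fst z + snd z) \<partial>(?L \<Otimes>\<^sub>M ?N))"
    unfolding joint[symmetric] by (subst nn_integral_distr) auto
  also have "\<dots> = (\<integral>\<^sup>+t. (\<integral>\<^sup>+x. F (x + t) \<partial>?L) \<partial>?N)"
    by (subst P.nn_integral_snd[symmetric]) auto
  also have "\<dots> \<le> (\<integral>\<^sup>+t. ennreal C * (\<integral>\<^sup>+x. F x \<partial>lborel) \<partial>?N)"
  proof (rule nn_integral_mono)
    fix t
    have "(\<integral>\<^sup>+x. F (x + t) \<partial>?L) = (\<integral>\<^sup>+x. ennreal (p x) * F (x + t) \<partial>lborel)"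
      unfolding law by (subst nn_integral_density) auto
    also have "\<dots> \<le> (\<integral>\<^sup>+x. ennreal C * F (t + 1 * x) \<partial>lborel)"
      by (intro nn_integral_mono mult_mono) (auto simp: add.commute intro: ennreal_leI p_le)
    also have "\<dots> = ennreal C * (\<integral>\<^sup>+x. F (t + 1 * x) \<partial>lborel)"
      by (rule nn_integral_cmult) auto
    also have "(\<integral>\<^sup>+x. F (t + 1 * x) \<partial>lborel) = (\<integral>\<^sup>+x. F x \<partial>lborel)"
      by (subst (2) nn_integral_real_affine[where c=1 and t=t]) auto
    finally show "(\<integral>\<^sup>+x. F (x + t) \<partial>?L) \<le> ennreal C * (\<integral>\<^sup>+x. F x \<partial>lborel)" .
  qed
  also have "\<dots> = ennreal C * (\<integral>\<^sup>+x. F x \<partial>lborel)" using \<nu>.emeasure_space_1 by simp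
  finally show ?thesis .
qed

lemma (in prob_space) square_integrable_comp_sum_density:
  fixes A T :: "'a \<Rightarrow> real" and f :: "real \<Rightarrow> real"
  assumes "lipschitz_density p C" and ind: "independent_pair M borel A borel T"
    and law: "distr M borel A = density lborel (\<lambda>x. ennreal (p x))"
    and f: "square_integrable lborel f"
  shows "square_integrable M (\<lambda>\<omega>. f (A \<omega> + T \<omega>))"
    and "(norm2 M (\<lambda>\<omega>. f (A \<omega> + T \<omega>)))\<^sup>2 \<le> C * (\<integral>x. (f x)\<^sup>2 \<partial>lborel)"
proof -
  interpret lipschitz_density p C by fact
  have [measurable]: "A \<in> borel_measurable M" "T \<in> borel_measurable M" "f \<in> borel_measurable borel"
    using ind f by (auto simp: square_integrable_def independent_pair_def)
  have f2: "integrable lborel (\<lambda>x. (f x)\<^sup>2)" using f by (simp add: square_integrable_def)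
  have le: "(\<integral>\<^sup>+\<omega>. ennreal ((f (A \<omega> + T \<omega>))\<^sup>2) \<partial>M) \<le> ennreal (C * (\<integral>x. (f x)\<^sup>2 \<partial>lborel))"
  proof -
    have "(\<integral>\<^sup>+\<omega>. ennreal ((f (A \<omega> + T \<omega>))\<^sup>2) \<partial>M) \<le> ennreal C * (\<integral>\<^sup>+x. ennreal ((f x)\<^sup>2) \<partial>lborel)"
      by (rule nn_integral_sum_density_le[OF assms(1) ind law, of "\<lambda>x. ennreal ((f x)\<^sup>2)"]) simp
    also have "(\<integral>\<^sup>+x. ennreal ((f x)\<^sup>2) \<partial>lborel) = ennreal (\<integral>x. (f x)\<^sup>2 \<partial>lborel)"
      by (rule nn_integral_eq_integral[OF f2]) simp
    finally show ?thesis using C_nonneg by (simp add: ennreal_mult)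
  qed
  have int: "integrable M (\<lambda>\<omega>. (f (A \<omega> + T \<omega>))\<^sup>2)"
    by (rule integrableI_nonneg) (use le_less_trans[OF le ennreal_less_top] in auto)
  then show "square_integrable M (\<lambda>\<omega>. f (A \<omega> + T \<omega>))" by (simp add: square_integrable_def)
  have "ennreal (\<integral>\<omega>. (f (A \<omega> + T \<omega>))\<^sup>2 \<partial>M) \<le> ennreal (C * (\<integral>x. (f x)\<^sup>2 \<partial>lborel))"
    using le nn_integral_eq_integral[OF int] by simp
  then show "(norm2 M (\<lambda>\<omega>. f (A \<omega> + T \<omega>)))\<^sup>2 \<le> C * (\<integral>x. (f x)\<^sup>2 \<partial>lborel)"
    unfolding norm2_squared using C_nonneg by (subst (asm) ennreal_le_iff) auto
qed

text \<open>By independence, \<open>smoothed p K T\<close> is the conditional expectation of \<open>K (A + T)\<close> given \<open>(T, Q)\<close>.\<close>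
lemma (in prob_space) smoothed_residual_orthogonal:
  fixes A T Q :: "'a \<Rightarrow> real" and K :: "real \<Rightarrow> real"
  assumes "lipschitz_density p C" and ind: "independent_pair M borel A (borel \<Otimes>\<^sub>M borel) (\<lambda>\<omega>. (T \<omega>, Q \<omega>))"
    and law: "distr M borel A = density lborel (\<lambda>x. ennreal (p x))"
    and K: "integrable lborel K"
    and KL2: "square_integrable M (\<lambda>\<omega>. K (A \<omega> + T \<omega>))" and Q: "square_integrable M Q"
  shows "(\<integral>\<omega>. (K (A \<omega> + T \<omega>) - smoothed p K (T \<omega>)) * Q \<omega> \<partial>M) = 0"
proof -
  interpret lipschitz_density p C by fact
  have rv[measurable]: "A \<in> borel_measurable M" "(\<lambda>\<omega>. (T \<omega>, Q \<omega>)) \<in> M \<rightarrow>\<^sub>M borel \<Otimes>\<^sub>M borel"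
    using ind by (auto simp: independent_pair_def)
  have [measurable]: "K \<in> borel_measurable borel" "smoothed p K \<in> borel_measurable borel"
    using measurable_smoothed[OF K] K by auto
  have [measurable]: "T \<in> borel_measurable M" "Q \<in> borel_measurable M"
    using measurable_compose[OF rv(2) measurable_fst] measurable_compose[OF rv(2) measurable_snd] by auto
  let ?N = "distr M (borel \<Otimes>\<^sub>M borel) (\<lambda>\<omega>. (T \<omega>, Q \<omega>))" and ?L = "distr M borel A"
  interpret \<nu>: prob_space "?N" by (rule prob_space_distr) simp
  interpret \<lambda>: prob_space "?L" by (rule prob_space_distr) simp
  interpret P: pair_sigma_finite "?L" "?N" ..
  have joint: "distr M (borel \<Otimes>\<^sub>M (borel \<Otimes>\<^sub>M borel)) (\<lambda>\<omega>. (A \<omega>, (T \<omega>, Q \<omega>))) = ?L \<Otimes>\<^sub>M ?N"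
    using ind by (simp add: independent_pair_def)
  have 1: "integrable M (\<lambda>\<omega>. K (A \<omega> + T \<omega>) * Q \<omega>)" by (rule square_integrable_mult[OF KL2 Q])
  have 2: "integrable M (\<lambda>\<omega>. smoothed p K (T \<omega>) * Q \<omega>)"
    using smoothed_bound[OF K]
    by (intro square_integrable_mult Q square_integrable_bounded[where B="C * (\<integral>z. \<bar>K z\<bar> \<partial>lborel)"]) auto
  have "(\<integral>\<omega>. K (A \<omega> + T \<omega>) * Q \<omega> \<partial>M)
      = (\<integral>z. K (fst z + fst (snd z)) * snd (snd z) \<partial>(?L \<Otimes>\<^sub>M ?N))"
    unfolding joint[symmetric] by (subst integral_distr) auto
  also have "\<dots> = (\<integral>y. (\<integral>x. K (x + fst y) * snd y \<partial>?L) \<partial>?N)"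
  proof -
    have "integrable (?L \<Otimes>\<^sub>M ?N) (\<lambda>z. K (fst z + fst (snd z)) * snd (snd z))"
      unfolding joint[symmetric] by (subst integrable_distr_eq) (use 1 in auto)
    then have "integrable (?L \<Otimes>\<^sub>M ?N) (\<lambda>(x, y). K (x + fst y) * snd y)"
      by (simp add: case_prod_unfold)
    from P.integral_snd[OF this] show ?thesis by (simp add: case_prod_unfold)
  qed
  also have "\<dots> = (\<integral>y. smoothed p K (fst y) * snd y \<partial>?N)"
    by (simp add: smoothed_eq_integral_density[OF K] law)
  also have "\<dots> = (\<integral>\<omega>. smoothed p K (T \<omega>) * Q \<omega> \<partial>M)"
    by (subst integral_distr) auto
  finally show ?thesis using 1 2 by (simp add: left_diff_distrib)
qed

section \<open>Composition with square-integrable functions\<close>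

definition clip :: "real \<Rightarrow> real \<Rightarrow> real" where
  "clip R x = max (- R) (min R x)"

lemma clip_le: "R \<ge> 0 \<Longrightarrow> \<bar>clip R x\<bar> \<le> R"
  by (auto simp: clip_def)

lemma clip_eq: "\<bar>x\<bar> \<le> R \<Longrightarrow> clip R x = x"
  by (auto simp: clip_def)

lemma abs_clip_le: "R \<ge> 0 \<Longrightarrow> \<bar>clip R x\<bar> \<le> \<bar>x\<bar>"
  by (auto simp: clip_def)

lemma continuous_on_clip [continuous_intros]:
  "continuous_on S f \<Longrightarrow> continuous_on S (\<lambda>x. clip R (f x))"
  unfolding clip_def by (intro continuous_intros)

lemma measurable_clip [measurable (raw)]:
  "f \<in> borel_measurable M \<Longrightarrow> (\<lambda>x. clip R (f x)) \<in> borel_measurable M"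
  unfolding clip_def by simp

lemma square_integrable_approx_bounded_support:
  assumes K: "square_integrable lborel K" and e: "e > 0"
  obtains R :: nat where "norm2 lborel (\<lambda>x. K x - clip R (K x) * indicator {-real R..real R} x) < e"
proof -
  have [measurable]: "K \<in> borel_measurable borel" and K2: "integrable lborel (\<lambda>x. (K x)\<^sup>2)"
    using K by (auto simp: square_integrable_def)
  let ?D = "\<lambda>R x. K x - clip (real R) (K x) * indicator {-real R..real R} x"
  have le: "\<bar>?D R x\<bar> \<le> \<bar>K x\<bar>" for R x
    by (auto simp: indicator_def clip_def)
  have "(\<lambda>R. \<integral>x. (?D R x)\<^sup>2 \<partial>lborel) \<longlonglongrightarrow> (\<integral>x. 0 \<partial>(lborel :: real measure))"
  proof (rule integral_dominated_convergence[OF _ _ K2])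
    show "AE x in lborel. norm ((?D R x)\<^sup>2) \<le> (K x)\<^sup>2" for R
      using le by (auto simp: abs_le_square_iff[symmetric])
    show "AE x in lborel. (\<lambda>R. (?D R x)\<^sup>2) \<longlonglongrightarrow> 0"
    proof (rule AE_I2)
      fix x
      have "\<forall>\<^sub>F R in sequentially. (?D R x)\<^sup>2 = 0"
        using eventually_ge_at_top[of "nat \<lceil>max \<bar>x\<bar> \<bar>K x\<bar>\<rceil>"]
      proof eventually_elim
        case (elim R)
        then have "\<bar>x\<bar> \<le> R" "\<bar>K x\<bar> \<le> R" by linarith+
        then show ?case by (simp add: clip_eq indicator_def abs_le_iff)
      qed
      then show "(\<lambda>R. (?D R x)\<^sup>2) \<longlonglongrightarrow> 0" by (rule tendsto_eventually)
    qed
  qed simp_all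
  then have "(\<lambda>R. \<integral>x. (?D R x)\<^sup>2 \<partial>lborel) \<longlonglongrightarrow> 0" by simp
  then have "\<forall>\<^sub>F R in sequentially. (\<integral>x. (?D R x)\<^sup>2 \<partial>lborel) < e\<^sup>2"
    using e by (intro order_tendstoD(2)) auto
  then obtain R where "(\<integral>x. (?D R x)\<^sup>2 \<partial>lborel) < e\<^sup>2" by (auto simp: eventually_sequentially)
  then have "norm2 lborel (?D R) < e"
    unfolding norm2_def using e by (metis real_sqrt_less_mono real_sqrt_abs abs_of_pos)
  then show ?thesis by (rule that)
qed

text \<open>
  First \<open>K\<close> is replaced by a bounded function with bounded support. A measurable function is almost everywhere
  a limit of continuous functions; clipping these and multiplying them by a continuous cutoff gives a common
  square-integrable majorant.
\<close>
lemma square_integrable_approx_continuous: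
  fixes K :: "real \<Rightarrow> real"
  assumes K: "square_integrable lborel K" and e: "e > 0"
  obtains G B where "continuous_on UNIV G" "\<And>x. \<bar>G x\<bar> \<le> B" "square_integrable lborel G"
    "norm2 lborel (\<lambda>x. K x - G x) < e"
proof -
  have [measurable]: "K \<in> borel_measurable borel"
    using K by (auto simp: square_integrable_def)
  obtain R :: nat where R: "norm2 lborel (\<lambda>x. K x - clip R (K x) * indicator {-real R..real R} x) < e / 2"
    using square_integrable_approx_bounded_support[OF K, of "e / 2"] e by auto
  define L where "L x = clip R (K x) * indicator {-real R..real R} x" for x
  have [measurable]: "L \<in> borel_measurable borel" unfolding L_def by measurable
  have LR: "\<bar>L x\<bar> \<le> R" for x by (auto simp: L_def indicator_def clip_le)
  have "L measurable_on UNIV"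
    by (rule lebesgue_measurable_imp_measurable_on_real) (auto intro: measurable_completion)
  then obtain N g where N: "negligible N" and g: "\<And>n. continuous_on UNIV (g n)"
    and lim: "\<And>x. x \<notin> N \<Longrightarrow> (\<lambda>n. g n x) \<longlonglongrightarrow> L x"
    unfolding measurable_on_def by auto
  \<comment> \<open>1 on the support of \<open>L\<close>, 0 at distance 1 from it\<close>
  define c where "c x = max 0 (min 1 (real R + 1 - \<bar>x\<bar>))" for x
  have c: "0 \<le> c x" "c x \<le> 1" "\<bar>x\<bar> \<le> R \<Longrightarrow> c x = 1" "\<bar>x\<bar> > real R + 1 \<Longrightarrow> c x = 0" for x
    by (auto simp: c_def)
  define G where "G n x = clip R (g n x) * c x" for n x
  have Gcont: "continuous_on UNIV (G n)" for n
    unfolding G_def c_def by (intro continuous_intros g)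
  then have [measurable]: "G n \<in> borel_measurable borel" for n
    by (rule borel_measurable_continuous_onI)
  have GR: "\<bar>G n x\<bar> \<le> real R * indicat_real {-(real R + 1)..real R + 1} x" for n x
  proof (cases "\<bar>x\<bar> \<le> real R + 1")
    case True
    have "\<bar>G n x\<bar> \<le> real R * 1"
      unfolding G_def abs_mult using c by (intro mult_mono clip_le) auto
    then show ?thesis using True by (simp add: abs_le_iff)
  next
    case False
    then show ?thesis using c(4)[of x] by (simp add: G_def)
  qed
  have LR': "\<bar>L x\<bar> \<le> real R * indicat_real {-(real R + 1)..real R + 1} x" for x
    using LR[of x] by (auto simp: L_def indicator_def)
  have intR: "integrable lborel (\<lambda>x. (2 * real R * indicat_real {-(real R + 1)..real R + 1} x)\<^sup>2 :: real)"
  proof -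
    have "(\<lambda>x. (2 * real R * indicat_real {-(real R + 1)..real R + 1} x)\<^sup>2)
        = (\<lambda>x. (2 * real R)\<^sup>2 * indicat_real {-(real R + 1)..real R + 1} x)"
      by (auto simp: fun_eq_iff indicator_def)
    moreover have "integrable lborel (\<lambda>x. (2 * real R)\<^sup>2 * indicat_real {-(real R + 1)..real R + 1} x)"
      by (intro integrable_mult_right integrable_real_indicator) (auto simp: emeasure_lborel_Icc_eq)
    ultimately show ?thesis by simp
  qed
  have Gint: "square_integrable lborel (G n)" for n
  proof (rule square_integrable_bound[where g="\<lambda>x. 2 * real R * indicat_real {-(real R + 1)..real R + 1} x"])
    show "square_integrable lborel (\<lambda>x. 2 * real R * indicat_real {-(real R + 1)..real R + 1} x)"
      using intR by (simp add: square_integrable_def)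
    show "AE x in lborel. \<bar>G n x\<bar> \<le> \<bar>2 * real R * indicat_real {-(real R + 1)..real R + 1} x\<bar>"
    proof (rule AE_I2)
      fix x
      have "\<bar>G n x\<bar> \<le> 2 * (real R * indicat_real {-(real R + 1)..real R + 1} x)"
        using GR[of n x] by (simp add: indicator_def split: if_splits)
      then show "\<bar>G n x\<bar> \<le> \<bar>2 * real R * indicat_real {-(real R + 1)..real R + 1} x\<bar>" by simp
    qed
  qed simp
  have AE_N: "AE x in lborel. x \<notin> N"
  proof -
    have "AE x in lebesgue. x \<notin> N"
      using N by (simp add: AE_not_in negligible_iff_null_sets)
    then show ?thesis by (simp add: AE_completion_iff)
  qed
  have "(\<lambda>n. \<integral>x. (L x - G n x)\<^sup>2 \<partial>lborel) \<longlonglongrightarrow> (\<integral>x. 0 \<partial>(lborel :: real measure))"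
  proof (rule integral_dominated_convergence[OF _ _ intR])
    show "AE x in lborel. norm ((L x - G n x)\<^sup>2) \<le> (2 * real R * indicat_real {-(real R + 1)..real R + 1} x)\<^sup>2" for n
    proof (rule AE_I2)
      fix x
      have "\<bar>L x - G n x\<bar> \<le> 2 * real R * indicat_real {-(real R + 1)..real R + 1} x"
        using GR[of n x] LR'[of x] by linarith
      then have "\<bar>L x - G n x\<bar>\<^sup>2 \<le> (2 * real R * indicat_real {-(real R + 1)..real R + 1} x)\<^sup>2"
        by (intro power_mono) auto
      then show "norm ((L x - G n x)\<^sup>2) \<le> (2 * real R * indicat_real {-(real R + 1)..real R + 1} x)\<^sup>2" by simp
    qed
    show "AE x in lborel. (\<lambda>n. (L x - G n x)\<^sup>2) \<longlonglongrightarrow> 0"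
      using AE_N
    proof eventually_elim
      case (elim x)
      have "(\<lambda>n. clip R (g n x)) \<longlonglongrightarrow> clip R (L x)"
        unfolding clip_def by (intro tendsto_intros lim elim)
      also have "clip R (L x) = L x" by (rule clip_eq[OF LR])
      finally have "(\<lambda>n. G n x) \<longlonglongrightarrow> L x * c x"
        unfolding G_def by (intro tendsto_intros)
      moreover have "L x * c x = L x" using c(3)[of x] by (auto simp: L_def indicator_def)
      ultimately have "(\<lambda>n. (L x - G n x)\<^sup>2) \<longlonglongrightarrow> (L x - L x)\<^sup>2" by (intro tendsto_intros) simp
      then show ?case by simp
    qed
  qed simp_all
  then have "\<forall>\<^sub>F n in sequentially. (\<integral>x. (L x - G n x)\<^sup>2 \<partial>lborel) < (e / 2)\<^sup>2"
    using e by (intro order_tendstoD(2)) auto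
  then obtain n where "(\<integral>x. (L x - G n x)\<^sup>2 \<partial>lborel) < (e / 2)\<^sup>2" by (auto simp: eventually_sequentially)
  then have 2: "norm2 lborel (\<lambda>x. L x - G n x) < e / 2"
    unfolding norm2_def using e by (metis real_sqrt_less_mono real_sqrt_abs abs_of_pos half_gt_zero)
  have Lint: "square_integrable lborel L"
  proof (rule square_integrable_bound[OF K])
    show "AE x in lborel. \<bar>L x\<bar> \<le> \<bar>K x\<bar>" by (auto simp: L_def indicator_def abs_clip_le)
  qed simp
  have "norm2 lborel (\<lambda>x. K x - G n x) < e"
    using norm2_triangle_diff[OF K Lint Gint[of n]] 2 R unfolding L_def by simp
  moreover have "\<bar>G n x\<bar> \<le> R" for x
    using GR[of n x] by (cases "x \<in> {-(real R + 1)..real R + 1}") auto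
  ultimately show ?thesis using that[OF Gcont _ Gint] by blast
qed

text \<open>
  Convergence of \<open>Y\<close> does not pass pointwise through a discontinuous \<open>K\<close>. But \<open>Y m\<close> and \<open>Z\<close> have
  densities bounded by \<open>C\<close>, in the sense of the hypotheses \<open>Y\<close> and \<open>Z\<close>; so replacing \<open>K\<close> by a continuous function
  that is close to it in the mean square costs little, uniformly in \<open>m\<close>.
\<close>
lemma (in prob_space) norm2_comp_tendsto:
  fixes Y :: "nat \<Rightarrow> 'a \<Rightarrow> real" and Z :: "'a \<Rightarrow> real"
  assumes [measurable]: "\<And>m. Y m \<in> borel_measurable M" "Z \<in> borel_measurable M"
    and lim: "AE \<omega> in M. (\<lambda>m. Y m \<omega>) \<longlonglongrightarrow> Z \<omega>"
    and Y: "\<And>m f. m \<ge> k \<Longrightarrow> square_integrable lborel f \<Longrightarrow>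
      square_integrable M (\<lambda>\<omega>. f (Y m \<omega>)) \<and> (norm2 M (\<lambda>\<omega>. f (Y m \<omega>)))\<^sup>2 \<le> C * (\<integral>x. (f x)\<^sup>2 \<partial>lborel)"
    and Z: "\<And>f. square_integrable lborel f \<Longrightarrow>
      square_integrable M (\<lambda>\<omega>. f (Z \<omega>)) \<and> (norm2 M (\<lambda>\<omega>. f (Z \<omega>)))\<^sup>2 \<le> C * (\<integral>x. (f x)\<^sup>2 \<partial>lborel)"
    and C: "C \<ge> 0" and K: "square_integrable lborel K"
  shows "(\<lambda>m. norm2 M (\<lambda>\<omega>. K (Y m \<omega>) - K (Z \<omega>))) \<longlonglongrightarrow> 0"
proof (rule LIMSEQ_I)
  fix r :: real assume r: "r > 0"
  define e where "e = r / (3 * (sqrt C + 1))"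
  have e: "e > 0" using r C by (auto simp: e_def intro!: divide_pos_pos mult_pos_pos add_nonneg_pos)
  obtain G B where G: "continuous_on UNIV G" "\<And>x. \<bar>G x\<bar> \<le> B" "square_integrable lborel G"
    and KG: "norm2 lborel (\<lambda>x. K x - G x) < e"
    using square_integrable_approx_continuous[OF K e] by blast
  have [measurable]: "G \<in> borel_measurable borel" using G(1) by (rule borel_measurable_continuous_onI)
  have [measurable]: "K \<in> borel_measurable borel" using K by (auto simp: square_integrable_def)
  have KG2: "square_integrable lborel (\<lambda>x. K x - G x)" by (rule square_integrable_diff[OF K G(3)])
  have small: "norm2 M (\<lambda>\<omega>. K (W \<omega>) - G (W \<omega>)) \<le> r / 3"
    if "(norm2 M (\<lambda>\<omega>. K (W \<omega>) - G (W \<omega>)))\<^sup>2 \<le> C * (\<integral>x. (K x - G x)\<^sup>2 \<partial>lborel)" for W :: "'a \<Rightarrow> real"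
  proof -
    have "(norm2 M (\<lambda>\<omega>. K (W \<omega>) - G (W \<omega>)))\<^sup>2 \<le> (sqrt C * norm2 lborel (\<lambda>x. K x - G x))\<^sup>2"
      using that C by (simp add: power_mult_distrib norm2_squared)
    then have "norm2 M (\<lambda>\<omega>. K (W \<omega>) - G (W \<omega>)) \<le> sqrt C * norm2 lborel (\<lambda>x. K x - G x)"
      by (rule power2_le_imp_le) (simp add: C)
    also have "\<dots> \<le> (sqrt C + 1) * e" using KG e C by (intro mult_mono) auto
    also have "\<dots> = r / 3" using C by (simp add: e_def field_simps add_nonneg_eq_0_iff)
    finally show ?thesis .
  qed
  have "(\<lambda>m. \<integral>\<omega>. (G (Y m \<omega>) - G (Z \<omega>))\<^sup>2 \<partial>M) \<longlonglongrightarrow> (\<integral>\<omega>. 0 \<partial>M)"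
  proof (rule integral_dominated_convergence[where w="\<lambda>_. (2 * B)\<^sup>2"])
    show "AE \<omega> in M. (\<lambda>m. (G (Y m \<omega>) - G (Z \<omega>))\<^sup>2) \<longlonglongrightarrow> 0"
      using lim
    proof eventually_elim
      case (elim \<omega>)
      have "(\<lambda>m. G (Y m \<omega>)) \<longlonglongrightarrow> G (Z \<omega>)"
        using G(1) elim by (auto intro: continuous_on_tendsto_compose)
      then have "(\<lambda>m. (G (Y m \<omega>) - G (Z \<omega>))\<^sup>2) \<longlonglongrightarrow> (G (Z \<omega>) - G (Z \<omega>))\<^sup>2" by (intro tendsto_intros)
      then show ?case by simp
    qed
    show "AE \<omega> in M. norm ((G (Y m \<omega>) - G (Z \<omega>))\<^sup>2) \<le> (2 * B)\<^sup>2" for m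
    proof (rule AE_I2)
      fix \<omega>
      have "\<bar>G (Y m \<omega>) - G (Z \<omega>)\<bar> \<le> 2 * B" using G(2)[of "Y m \<omega>"] G(2)[of "Z \<omega>"] by linarith
      then have "\<bar>G (Y m \<omega>) - G (Z \<omega>)\<bar>\<^sup>2 \<le> (2 * B)\<^sup>2" by (intro power_mono) auto
      then show "norm ((G (Y m \<omega>) - G (Z \<omega>))\<^sup>2) \<le> (2 * B)\<^sup>2" by simp
    qed
  qed simp_all
  then have "\<forall>\<^sub>F m in sequentially. (\<integral>\<omega>. (G (Y m \<omega>) - G (Z \<omega>))\<^sup>2 \<partial>M) < (r / 3)\<^sup>2"
    using r by (intro order_tendstoD(2)) auto
  then have ev: "\<forall>\<^sub>F m in sequentially. norm2 M (\<lambda>\<omega>. G (Y m \<omega>) - G (Z \<omega>)) < r / 3"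
  proof eventually_elim
    case (elim m)
    then have "sqrt (\<integral>\<omega>. (G (Y m \<omega>) - G (Z \<omega>))\<^sup>2 \<partial>M) < sqrt ((r / 3)\<^sup>2)" by (rule real_sqrt_less_mono)
    then show ?case using r by (simp add: norm2_def)
  qed
  have "\<forall>\<^sub>F m in sequentially. norm (norm2 M (\<lambda>\<omega>. K (Y m \<omega>) - K (Z \<omega>)) - 0) < r"
    using ev eventually_ge_at_top[of k]
  proof eventually_elim
    case (elim m)
    note L2 = Y[OF elim(2), THEN conjunct1] Z[THEN conjunct1]
    have "norm2 M (\<lambda>\<omega>. K (Y m \<omega>) - K (Z \<omega>))
        \<le> norm2 M (\<lambda>\<omega>. K (Y m \<omega>) - G (Y m \<omega>)) + norm2 M (\<lambda>\<omega>. G (Y m \<omega>) - K (Z \<omega>))"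
      by (intro norm2_triangle_diff L2 K G)
    also have "norm2 M (\<lambda>\<omega>. G (Y m \<omega>) - K (Z \<omega>))
        \<le> norm2 M (\<lambda>\<omega>. G (Y m \<omega>) - G (Z \<omega>)) + norm2 M (\<lambda>\<omega>. G (Z \<omega>) - K (Z \<omega>))"
      by (intro norm2_triangle_diff L2 K G)
    also have "norm2 M (\<lambda>\<omega>. G (Z \<omega>) - K (Z \<omega>)) = norm2 M (\<lambda>\<omega>. K (Z \<omega>) - G (Z \<omega>))"
      by (rule norm2_minus_commute)
    finally show ?case
      using elim(1) small[OF Y[OF elim(2) KG2, THEN conjunct2]] small[OF Z[OF KG2, THEN conjunct2]] by simp
  qed
  then show "\<exists>n0. \<forall>m\<ge>n0. norm (norm2 M (\<lambda>\<omega>. K (Y m \<omega>) - K (Z \<omega>)) - 0) < r"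
    by (simp add: eventually_sequentially)
qed

section \<open>Coordinates of product measures\<close>

lemma indep_vars_PiM_coordinates:
  assumes I: "I \<noteq> {}" and Q: "\<And>i. i \<in> I \<Longrightarrow> prob_space (Q i)"
  shows "prob_space.indep_vars (Pi\<^sub>M I Q) Q (\<lambda>i x. x i) I"
proof -
  interpret P: prob_space "Pi\<^sub>M I Q" using Q by (rule prob_space_PiM)
  have "distr (Pi\<^sub>M I Q) (Pi\<^sub>M I Q) (\<lambda>x. \<lambda>i\<in>I. x i) = distr (Pi\<^sub>M I Q) (Pi\<^sub>M I Q) (\<lambda>x. x)"
    by (rule distr_cong) (auto simp: space_PiM)
  also have "\<dots> = Pi\<^sub>M I Q" by (rule distr_id2) simp
  also have "\<dots> = Pi\<^sub>M I (\<lambda>i. distr (Pi\<^sub>M I Q) (Q i) (\<lambda>x. x i))"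
    by (rule PiM_cong) (auto intro!: distr_PiM_component[symmetric] Q)
  finally show ?thesis
    by (subst P.indep_vars_iff_distr_eq_PiM'[OF I]) auto
qed

lemma (in prob_space) iid_window_law:
  fixes X :: "'i \<Rightarrow> 'a \<Rightarrow> 'b" and N :: "'b measure"
  assumes ind: "indep_vars (\<lambda>_. N) X UNIV" and law: "\<And>i. distr M N (X i) = \<mu>"
    and f: "inj_on f J"
  shows "distr M (Pi\<^sub>M J (\<lambda>_. N)) (\<lambda>\<omega>. \<lambda>j\<in>J. X (f j) \<omega>) = Pi\<^sub>M J (\<lambda>_. \<mu>)"
proof -
  have X[measurable]: "X i \<in> M \<rightarrow>\<^sub>M N" for i using ind by (auto simp: indep_vars_def)
  have ps: "prob_space \<mu>" unfolding law[of undefined, symmetric] by (rule prob_space_distr) simp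
  have [measurable_cong]: "sets \<mu> = sets N" unfolding law[of undefined, symmetric] by simp
  then have sets: "sets (Pi\<^sub>M I (\<lambda>_. \<mu>)) = sets (Pi\<^sub>M I (\<lambda>_. N))" for I :: "'c set"
    by (intro sets_PiM_cong) auto
  have U: "distr M (Pi\<^sub>M UNIV (\<lambda>_. N)) (\<lambda>\<omega>. \<lambda>i\<in>UNIV. X i \<omega>) = Pi\<^sub>M UNIV (\<lambda>_. \<mu>)"
    using ind by (subst (asm) indep_vars_iff_distr_eq_PiM) (auto simp: law)
  have "Pi\<^sub>M J (\<lambda>_. \<mu>) = distr (Pi\<^sub>M UNIV (\<lambda>_. \<mu>)) (Pi\<^sub>M J (\<lambda>_. \<mu>)) (\<lambda>\<omega>. \<lambda>n\<in>J. \<omega> (f n))"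
    using distr_PiM_reindex[where K=UNIV and M="\<lambda>_. \<mu>", OF ps f] by simp
  also have "\<dots> = distr M (Pi\<^sub>M J (\<lambda>_. \<mu>)) (\<lambda>\<omega>. \<lambda>j\<in>J. X (f j) \<omega>)"
    unfolding U[symmetric] by (subst distr_distr) (auto simp: comp_def intro!: measurable_restrict)
  also have "\<dots> = distr M (Pi\<^sub>M J (\<lambda>_. N)) (\<lambda>\<omega>. \<lambda>j\<in>J. X (f j) \<omega>)"
    by (intro distr_cong sets) auto
  finally show ?thesis ..
qed

section \<open>The linear process\<close>

text \<open>The size of an innovation with coefficient \<open>s\<close> as seen by a bounded Lipschitz function.\<close>
definition clipped_norm :: "real measure \<Rightarrow> real \<Rightarrow> real" where
  "clipped_norm \<mu> s = norm2 \<mu> (\<lambda>x. min 1 \<bar>s * x\<bar>)"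

lemma min_one_sum_le:
  fixes f :: "'i \<Rightarrow> real"
  shows "min 1 \<bar>\<Sum>i\<in>I. f i\<bar> \<le> (\<Sum>i\<in>I. min 1 \<bar>f i\<bar>)"
proof (induction I rule: infinite_finite_induct)
  case (insert i I)
  have "min 1 \<bar>f i + (\<Sum>i\<in>I. f i)\<bar> \<le> min 1 \<bar>f i\<bar> + min 1 \<bar>\<Sum>i\<in>I. f i\<bar>"
    by (auto simp: min_def)
  then show ?case using insert by simp
qed auto

text \<open>The series starts with \<open>a 1\<close>, hence the shift of the index in the summability condition.\<close>
locale linear_innovations = prob_space M for M :: "'a measure" +
  fixes \<epsilon> :: "int \<Rightarrow> 'a \<Rightarrow> real" and \<mu> :: "real measure" and a :: "nat \<Rightarrow> real"
  assumes indep: "indep_vars (\<lambda>_. borel) \<epsilon> UNIV"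
    and distr_eps: "\<And>n. distr M borel (\<epsilon> n) = \<mu>"
    and summable_clipped: "summable (\<lambda>j. clipped_norm \<mu> (a (Suc j)))"
begin

lemma measurable_eps [measurable]: "\<epsilon> n \<in> borel_measurable M"
  using indep by (auto simp: indep_vars_def)

lemma prob_space_mu: "prob_space \<mu>"
  unfolding distr_eps[of 0, symmetric] by (rule prob_space_distr) simp

lemma sets_mu [measurable_cong, simp]: "sets \<mu> = sets borel"
  unfolding distr_eps[of 0, symmetric] by simp

lemma space_mu [simp]: "space \<mu> = UNIV"
  unfolding distr_eps[of 0, symmetric] by simp

lemma sets_PiM_mu [measurable_cong]: "sets (Pi\<^sub>M I (\<lambda>_. \<mu>)) = sets (Pi\<^sub>M I (\<lambda>_. borel))"
  by (rule sets_PiM_cong) auto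

lemma window_law:
  assumes f: "inj_on f J"
  shows "distr M (Pi\<^sub>M J (\<lambda>_. borel)) (\<lambda>\<omega>. \<lambda>j\<in>J. \<epsilon> (f j) \<omega>) = Pi\<^sub>M J (\<lambda>_. \<mu>)"
  by (rule iid_window_law[OF indep distr_eps f])

lemma measurable_window [measurable]: "(\<lambda>\<omega>. \<lambda>j\<in>J. \<epsilon> (f j) \<omega>) \<in> M \<rightarrow>\<^sub>M Pi\<^sub>M J (\<lambda>_. borel)"
  by (rule measurable_restrict) simp

lemma integral_window:
  fixes F :: "('i \<Rightarrow> real) \<Rightarrow> real"
  assumes f: "inj_on f J" and F: "F \<in> borel_measurable (Pi\<^sub>M J (\<lambda>_. borel))"
  shows "(\<integral>\<omega>. F (\<lambda>j\<in>J. \<epsilon> (f j) \<omega>) \<partial>M) = (\<integral>x. F x \<partial>(Pi\<^sub>M J (\<lambda>_. \<mu>)))"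
  unfolding window_law[OF f, symmetric] using F by (subst integral_distr) auto

lemma norm2_window:
  fixes F :: "('i \<Rightarrow> real) \<Rightarrow> real"
  assumes f: "inj_on f J" and F: "F \<in> borel_measurable (Pi\<^sub>M J (\<lambda>_. borel))"
  shows "norm2 M (\<lambda>\<omega>. F (\<lambda>j\<in>J. \<epsilon> (f j) \<omega>)) = norm2 (Pi\<^sub>M J (\<lambda>_. \<mu>)) F"
proof -
  have "(\<lambda>x. (F x)\<^sup>2) \<in> borel_measurable (Pi\<^sub>M J (\<lambda>_. borel))" using F by simp
  from integral_window[OF f this] show ?thesis by (simp add: norm2_def)
qed

lemma independent_pair_windows:
  assumes AB: "A \<inter> B = {}"
    and f: "f \<in> Pi\<^sub>M A (\<lambda>_. borel) \<rightarrow>\<^sub>M S" and g: "g \<in> Pi\<^sub>M B (\<lambda>_. borel) \<rightarrow>\<^sub>M T"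
  shows "independent_pair M S (\<lambda>\<omega>. f (\<lambda>i\<in>A. \<epsilon> i \<omega>)) T (\<lambda>\<omega>. g (\<lambda>i\<in>B. \<epsilon> i \<omega>))"
  by (rule independent_pair_of_indep_var[OF indep_var_restrict[OF indep AB] f g]) auto

lemma square_integrable_clipped_eps: "square_integrable M (\<lambda>\<omega>. min 1 \<bar>s * \<epsilon> i \<omega>\<bar>)"
  by (rule square_integrable_bounded[where B=1]) auto

lemma norm2_clipped_eps: "norm2 M (\<lambda>\<omega>. min 1 \<bar>s * \<epsilon> i \<omega>\<bar>) = clipped_norm \<mu> s"
  unfolding clipped_norm_def norm2_def distr_eps[of i, symmetric]
  by (subst integral_distr) auto

lemma clipped_norm_nonneg: "0 \<le> clipped_norm \<mu> s"
  by (simp add: clipped_norm_def)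

text \<open>
  The clipped terms have summable means, so almost surely their sum is finite; then only finitely many terms
  are affected by the clipping.
\<close>
lemma AE_summable: "AE \<omega> in M. summable (\<lambda>j. \<bar>a (Suc j) * \<epsilon> (n - int (Suc j)) \<omega>\<bar>)"
proof -
  define c where "c j \<omega> = min 1 \<bar>a (Suc j) * \<epsilon> (n - int (Suc j)) \<omega>\<bar>" for j \<omega>
  have [measurable]: "c j \<in> borel_measurable M" for j unfolding c_def by measurable
  have c: "0 \<le> c j \<omega>" for j \<omega> by (simp add: c_def)
  have sq: "square_integrable M (c j)" for j unfolding c_def by (rule square_integrable_clipped_eps)
  have cE: "expectation (c j) \<le> clipped_norm \<mu> (a (Suc j))" for j
    using abs_expectation_le_norm2[OF sq] unfolding c_def norm2_clipped_eps by simp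
  have "(\<integral>\<^sup>+\<omega>. (\<Sum>j. ennreal (c j \<omega>)) \<partial>M) = (\<Sum>j. \<integral>\<^sup>+\<omega>. ennreal (c j \<omega>) \<partial>M)"
    by (rule nn_integral_suminf) simp
  also have "\<dots> = (\<Sum>j. ennreal (expectation (c j)))"
    using sq c by (intro suminf_cong nn_integral_eq_integral square_integrable_integrable) auto
  also have "\<dots> \<le> (\<Sum>j. ennreal (clipped_norm \<mu> (a (Suc j))))"
    by (intro suminf_le ennreal_leI cE) auto
  also have "\<dots> = ennreal (\<Sum>j. clipped_norm \<mu> (a (Suc j)))"
    by (rule suminf_ennreal2[OF clipped_norm_nonneg summable_clipped])
  also have "\<dots> < \<infinity>" by simp
  finally have "(\<integral>\<^sup>+\<omega>. (\<Sum>j. ennreal (c j \<omega>)) \<partial>M) \<noteq> \<infinity>" by simp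
  then have "AE \<omega> in M. (\<Sum>j. ennreal (c j \<omega>)) \<noteq> \<infinity>"
    by (intro nn_integral_PInf_AE) auto
  then show ?thesis
  proof eventually_elim
    case (elim \<omega>)
    then have s: "summable (\<lambda>j. c j \<omega>)" by (intro summable_suminf_not_top c) simp
    then have "(\<lambda>j. c j \<omega>) \<longlonglongrightarrow> 0" by (rule summable_LIMSEQ_zero)
    then have "\<forall>\<^sub>F j in sequentially. c j \<omega> < 1" by (rule order_tendstoD) simp
    then have "\<forall>\<^sub>F j in sequentially. norm \<bar>a (Suc j) * \<epsilon> (n - int (Suc j)) \<omega>\<bar> \<le> c j \<omega>"
      by eventually_elim (auto simp: c_def min_def split: if_splits)
    then show ?case using s by (rule summable_comparison_test_ev)
  qed
qed

text \<open>The contribution of the lags in \<open>J\<close> to the linear process at time \<open>n\<close>.\<close>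
definition lin :: "nat set \<Rightarrow> int \<Rightarrow> 'a \<Rightarrow> real" where
  "lin J n \<omega> = (\<Sum>j\<in>J. a j * \<epsilon> (n - int j) \<omega>)"

definition lin_limit :: "int \<Rightarrow> 'a \<Rightarrow> real" where
  "lin_limit n \<omega> = (\<Sum>j. a (Suc j) * \<epsilon> (n - int (Suc j)) \<omega>)"

lemma measurable_lin [measurable]: "lin J n \<in> borel_measurable M"
  unfolding lin_def by measurable

lemma measurable_lin_limit [measurable]: "lin_limit n \<in> borel_measurable M"
  unfolding lin_limit_def by measurable

lemma AE_lin_tendsto: "AE \<omega> in M. (\<lambda>m. lin {1..m} n \<omega>) \<longlonglongrightarrow> lin_limit n \<omega>"
  using AE_summable[of n]
proof eventually_elim
  case (elim \<omega>)
  then have "summable (\<lambda>j. a (Suc j) * \<epsilon> (n - int (Suc j)) \<omega>)" by (rule summable_rabs_cancel)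
  then have "(\<lambda>m. \<Sum>j<m. a (Suc j) * \<epsilon> (n - int (Suc j)) \<omega>) \<longlonglongrightarrow> lin_limit n \<omega>"
    unfolding lin_limit_def by (rule summable_LIMSEQ)
  then show ?case by (simp add: lin_def sum.atLeast1_atMost_eq)
qed

text \<open>
  The same contribution as a function of the sequence of innovations, so that single innovations can be
  resampled.
\<close>
definition lin_window :: "nat set \<Rightarrow> int \<Rightarrow> (int \<Rightarrow> real) \<Rightarrow> real" where
  "lin_window J n x = (\<Sum>j\<in>J. a j * x (n - int j))"

lemma measurable_lin_window:
  assumes "\<And>j. j \<in> J \<Longrightarrow> n - int j \<in> B"
  shows "lin_window J n \<in> borel_measurable (Pi\<^sub>M B (\<lambda>_. borel))"
  unfolding lin_window_def using assms
  by (intro borel_measurable_sum borel_measurable_times measurable_component_singleton) auto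

lemma lin_eq_window:
  assumes "\<And>j. j \<in> J \<Longrightarrow> n - int j \<in> B"
  shows "lin J n \<omega> = lin_window J n (\<lambda>i\<in>B. \<epsilon> i \<omega>)"
  unfolding lin_def lin_window_def using assms by (intro sum.cong) auto

end

text \<open>The \<open>k\<close> most recent innovations contribute a variable with density \<open>p\<close>, which smooths \<open>K\<close>.\<close>
locale smoothed_functional = linear_innovations +
  fixes K :: "real \<Rightarrow> real" and k :: nat and p :: "real \<Rightarrow> real" and C :: real
  assumes density: "lipschitz_density p C"
    and head_law: "\<And>n. distr M borel (lin {1..k} n) = density lborel (\<lambda>x. ennreal (p x))"
    and K1: "integrable lborel K" and K2: "square_integrable lborel K"
begin

sublocale lipschitz_density p C by (rule density)

lemma lin_split:
  assumes "k \<le> m" shows "lin {1..m} n \<omega> = lin {1..k} n \<omega> + lin {k+1..m} n \<omega>"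
proof -
  have "{1..m} = {1..k} \<union> {k+1..m}" using assms by auto
  then show ?thesis unfolding lin_def by (simp add: sum.union_disjoint)
qed

lemma independent_head:
  assumes "g \<in> Pi\<^sub>M {..<n - int k} (\<lambda>_. borel) \<rightarrow>\<^sub>M T"
  shows "independent_pair M borel (lin {1..k} n) T (\<lambda>\<omega>. g (\<lambda>i\<in>{..<n - int k}. \<epsilon> i \<omega>))"
proof -
  have w: "n - int j \<in> {n - int k..n}" if "j \<in> {1..k}" for j using that by auto
  have eq: "lin {1..k} n = (\<lambda>\<omega>. lin_window {1..k} n (\<lambda>i\<in>{n - int k..n}. \<epsilon> i \<omega>))"
    by (rule ext, rule lin_eq_window[OF w])
  show ?thesis
    unfolding eq by (rule independent_pair_windows[OF _ measurable_lin_window[OF w] assms]) auto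
qed

lemma independent_head_tail: "independent_pair M borel (lin {1..k} n) borel (lin {k+1..m} n)"
proof -
  have w: "n - int j \<in> {..<n - int k}" if "j \<in> {k+1..m}" for j using that by auto
  have eq: "lin {k+1..m} n = (\<lambda>\<omega>. lin_window {k+1..m} n (\<lambda>i\<in>{..<n - int k}. \<epsilon> i \<omega>))"
    by (rule ext, rule lin_eq_window[OF w])
  show ?thesis
    unfolding eq by (rule independent_head[OF measurable_lin_window[OF w]])
qed

lemma square_integrable_comp_lin:
  assumes m: "m \<ge> k" and f: "square_integrable lborel f"
  shows "square_integrable M (\<lambda>\<omega>. f (lin {1..m} n \<omega>))"
    and "(norm2 M (\<lambda>\<omega>. f (lin {1..m} n \<omega>)))\<^sup>2 \<le> C * (\<integral>x. (f x)\<^sup>2 \<partial>lborel)"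
  unfolding lin_split[OF m]
  using square_integrable_comp_sum_density[OF density independent_head_tail head_law f] by auto

text \<open>
  Almost surely the process is the head plus a variable that depends only on the innovations before
  \<open>n - k\<close>. The two may differ where the series diverges and its value is a default.
\<close>
lemma square_integrable_comp_lin_limit:
  assumes f: "square_integrable lborel f"
  shows "square_integrable M (\<lambda>\<omega>. f (lin_limit n \<omega>))"
    and "(norm2 M (\<lambda>\<omega>. f (lin_limit n \<omega>)))\<^sup>2 \<le> C * (\<integral>x. (f x)\<^sup>2 \<partial>lborel)"
proof -
  have [measurable]: "f \<in> borel_measurable borel" using f by (auto simp: square_integrable_def)
  let ?g = "\<lambda>x. \<Sum>j. a (Suc (j + k)) * x (n - int (Suc (j + k)))"
  define T where "T \<omega> = ?g (\<lambda>i\<in>{..<n - int k}. \<epsilon> i \<omega>)" for \<omega>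
  have ind: "independent_pair M borel (lin {1..k} n) borel T"
    unfolding T_def
    by (rule independent_head)
      (intro borel_measurable_suminf borel_measurable_times measurable_component_singleton; simp)
  have T_eq: "T \<omega> = (\<Sum>j. a (Suc (j + k)) * \<epsilon> (n - int (Suc (j + k))) \<omega>)" for \<omega>
    unfolding T_def by (rule suminf_cong) auto
  have AE: "AE \<omega> in M. lin_limit n \<omega> = lin {1..k} n \<omega> + T \<omega>"
    using AE_summable[of n]
  proof eventually_elim
    case (elim \<omega>)
    then have "summable (\<lambda>j. a (Suc j) * \<epsilon> (n - int (Suc j)) \<omega>)" by (rule summable_rabs_cancel)
    from suminf_split_initial_segment[OF this, of k] show ?case
      by (simp add: lin_limit_def T_eq lin_def sum.atLeast1_atMost_eq)
  qed
  have sq: "square_integrable M (\<lambda>\<omega>. f (lin {1..k} n \<omega> + T \<omega>))"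
    and le: "(norm2 M (\<lambda>\<omega>. f (lin {1..k} n \<omega> + T \<omega>)))\<^sup>2 \<le> C * (\<integral>x. (f x)\<^sup>2 \<partial>lborel)"
    using square_integrable_comp_sum_density[OF density ind head_law f] by auto
  have AE': "AE \<omega> in M. \<bar>f (lin_limit n \<omega>)\<bar> \<le> \<bar>f (lin {1..k} n \<omega> + T \<omega>)\<bar>" using AE by auto
  show "square_integrable M (\<lambda>\<omega>. f (lin_limit n \<omega>))"
    by (rule square_integrable_bound[OF sq _ AE']) measurable
  have "norm2 M (\<lambda>\<omega>. f (lin_limit n \<omega>)) \<le> norm2 M (\<lambda>\<omega>. f (lin {1..k} n \<omega> + T \<omega>))"
    by (rule norm2_mono[OF sq _ AE']) measurable
  then have "(norm2 M (\<lambda>\<omega>. f (lin_limit n \<omega>)))\<^sup>2 \<le> (norm2 M (\<lambda>\<omega>. f (lin {1..k} n \<omega> + T \<omega>)))\<^sup>2"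
    by (intro power_mono) auto
  with le show "(norm2 M (\<lambda>\<omega>. f (lin_limit n \<omega>)))\<^sup>2 \<le> C * (\<integral>x. (f x)\<^sup>2 \<partial>lborel)" by linarith
qed

lemma norm2_K_lin_tendsto:
  "(\<lambda>m. norm2 M (\<lambda>\<omega>. K (lin {1..m} n \<omega>) - K (lin_limit n \<omega>))) \<longlonglongrightarrow> 0"
  using square_integrable_comp_lin square_integrable_comp_lin_limit C_nonneg K2 AE_lin_tendsto
  by (intro norm2_comp_tendsto[where C=C and k=k]) auto

lemma norm2_K_lin_shift:
  "norm2 M (\<lambda>\<omega>. K (lin {1..m} n \<omega>) - K (lin {1..m'} n \<omega>))
    = norm2 M (\<lambda>\<omega>. K (lin {1..m} 0 \<omega>) - K (lin {1..m'} 0 \<omega>))"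
proof -
  have [measurable]: "K \<in> borel_measurable borel" using K1 by auto
  let ?J = "{1..max m m'}"
  let ?F = "\<lambda>x. K (\<Sum>j\<in>{1..m}. a j * x j) - K (\<Sum>j\<in>{1..m'}. a j * x j)"
  have F: "?F \<in> borel_measurable (Pi\<^sub>M ?J (\<lambda>_. borel))"
    by (intro borel_measurable_diff measurable_compose[OF _ measurable_K[OF K1]] borel_measurable_sum
        borel_measurable_times measurable_component_singleton borel_measurable_const) auto
  have inj: "inj_on (\<lambda>j. n - int j) ?J" for n by (auto simp: inj_on_def)
  have "norm2 M (\<lambda>\<omega>. K (lin {1..m} n \<omega>) - K (lin {1..m'} n \<omega>)) = norm2 (Pi\<^sub>M ?J (\<lambda>_. \<mu>)) ?F" for n
  proof -
    have eq: "(\<Sum>j\<in>{1..l}. a j * (\<lambda>j\<in>?J. \<epsilon> (n - int j) \<omega>) j) = lin {1..l} n \<omega>" if "l \<le> max m m'" for l \<omega>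
      unfolding lin_def using that by (intro sum.cong) auto
    show ?thesis
      unfolding norm2_window[OF inj F, symmetric, of n] eq[OF max.cobounded1] eq[OF max.cobounded2] ..
  qed
  then show ?thesis by simp
qed

text \<open>Stationarity makes the convergence uniform in \<open>n\<close>.\<close>
lemma norm2_K_lin_cauchy:
  assumes e: "e > 0"
  obtains m0 where "m0 \<ge> k"
    "\<And>m m' n. m \<ge> m0 \<Longrightarrow> m' \<ge> m0 \<Longrightarrow> norm2 M (\<lambda>\<omega>. K (lin {1..m} n \<omega>) - K (lin {1..m'} n \<omega>)) \<le> e"
proof -
  have "\<forall>\<^sub>F m in sequentially. norm2 M (\<lambda>\<omega>. K (lin {1..m} 0 \<omega>) - K (lin_limit 0 \<omega>)) < e / 2"
    using e by (intro order_tendstoD(2)[OF norm2_K_lin_tendsto]) simp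
  then obtain m1 where m1: "\<And>m. m \<ge> m1 \<Longrightarrow> norm2 M (\<lambda>\<omega>. K (lin {1..m} 0 \<omega>) - K (lin_limit 0 \<omega>)) < e / 2"
    by (auto simp: eventually_sequentially)
  show ?thesis
  proof (rule that[of "max m1 k"])
    fix m m' :: nat and n :: int assume m: "m \<ge> max m1 k" "m' \<ge> max m1 k"
    have "norm2 M (\<lambda>\<omega>. K (lin {1..m} 0 \<omega>) - K (lin {1..m'} 0 \<omega>))
        \<le> norm2 M (\<lambda>\<omega>. K (lin {1..m} 0 \<omega>) - K (lin_limit 0 \<omega>))
          + norm2 M (\<lambda>\<omega>. K (lin_limit 0 \<omega>) - K (lin {1..m'} 0 \<omega>))"
      using m by (intro norm2_triangle_diff square_integrable_comp_lin square_integrable_comp_lin_limit K2) auto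
    also have "norm2 M (\<lambda>\<omega>. K (lin_limit 0 \<omega>) - K (lin {1..m'} 0 \<omega>))
        = norm2 M (\<lambda>\<omega>. K (lin {1..m'} 0 \<omega>) - K (lin_limit 0 \<omega>))"
      by (rule norm2_minus_commute)
    finally show "norm2 M (\<lambda>\<omega>. K (lin {1..m} n \<omega>) - K (lin {1..m'} n \<omega>)) \<le> e"
      using m1[of m] m1[of m'] m unfolding norm2_K_lin_shift[of m n m'] by simp
  qed simp
qed

end

section \<open>Resampling a single innovation\<close>

lemma min_one_diff_le: "min 1 \<bar>u - v\<bar> \<le> min 1 \<bar>u\<bar> + min 1 \<bar>v\<bar>" for u v :: real
  using abs_triangle_ineq4[of u v] by (simp add: min_def) linarith

context linear_innovations
begin

abbreviation innovation_product :: "int set \<Rightarrow> (int \<Rightarrow> real) measure" where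
  "innovation_product I \<equiv> Pi\<^sub>M I (\<lambda>_. \<mu>)"

lemma norm2_pair_component:
  assumes i: "i \<in> I"
  shows "norm2 (innovation_product I \<Otimes>\<^sub>M \<mu>) (\<lambda>z. min 1 \<bar>s * fst z i\<bar>) = clipped_norm \<mu> s"
    and "norm2 (innovation_product I \<Otimes>\<^sub>M \<mu>) (\<lambda>z. min 1 \<bar>s * snd z\<bar>) = clipped_norm \<mu> s"
proof -
  let ?P = "innovation_product I"
  interpret mu: prob_space \<mu> by (rule prob_space_mu)
  interpret P: prob_space ?P by (intro prob_space_PiM prob_space_mu)
  interpret PM: pair_prob_space ?P \<mu> ..
  have "distr ?P borel (\<lambda>\<omega>. \<omega> i) = distr ?P \<mu> (\<lambda>\<omega>. \<omega> i)"
    by (rule distr_cong) auto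
  also have "\<dots> = \<mu>" by (rule distr_PiM_component[OF prob_space_mu i])
  finally have comp: "distr ?P borel (\<lambda>\<omega>. \<omega> i) = \<mu>" .
  have xi[measurable]: "(\<lambda>x. x i) \<in> borel_measurable ?P"
    using measurable_component_singleton[OF i, of "\<lambda>_. \<mu>"] by (simp cong: measurable_cong_sets)
  have [measurable]: "(\<lambda>z. fst z i) \<in> borel_measurable (?P \<Otimes>\<^sub>M \<mu>)"
    by (rule measurable_compose[OF measurable_fst xi])
  have b: "\<bar>(min 1 \<bar>u\<bar>)\<^sup>2\<bar> \<le> (1::real)" for u :: real
    using power_mono[of "min 1 \<bar>u\<bar>" 1 2] by simp
  have "(\<integral>z. (min 1 \<bar>s * fst z i\<bar>)\<^sup>2 \<partial>(?P \<Otimes>\<^sub>M \<mu>)) = (\<integral>x. (\<integral>y. (min 1 \<bar>s * x i\<bar>)\<^sup>2 \<partial>\<mu>) \<partial>?P)"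
    using b by (subst PM.integral_fst'[symmetric]) (auto intro!: PM.P.integrable_const_bound[where B=1])
  also have "\<dots> = (\<integral>x. (min 1 \<bar>s * x i\<bar>)\<^sup>2 \<partial>?P)" using mu.prob_space by simp
  also have "\<dots> = (\<integral>x. (min 1 \<bar>s * x\<bar>)\<^sup>2 \<partial>distr ?P borel (\<lambda>\<omega>. \<omega> i))"
    by (subst integral_distr) auto
  also have "\<dots> = (\<integral>x. (min 1 \<bar>s * x\<bar>)\<^sup>2 \<partial>\<mu>)" unfolding comp ..
  finally show "norm2 (?P \<Otimes>\<^sub>M \<mu>) (\<lambda>z. min 1 \<bar>s * fst z i\<bar>) = clipped_norm \<mu> s"
    by (simp add: norm2_def clipped_norm_def)
  have "(\<integral>z. (min 1 \<bar>s * snd z\<bar>)\<^sup>2 \<partial>(?P \<Otimes>\<^sub>M \<mu>)) = (\<integral>x. (\<integral>y. (min 1 \<bar>s * y\<bar>)\<^sup>2 \<partial>\<mu>) \<partial>?P)"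
    using b by (subst PM.integral_fst'[symmetric]) (auto intro!: PM.P.integrable_const_bound[where B=1])
  also have "\<dots> = (\<integral>y. (min 1 \<bar>s * y\<bar>)\<^sup>2 \<partial>\<mu>)" using P.prob_space by simp
  finally show "norm2 (?P \<Otimes>\<^sub>M \<mu>) (\<lambda>z. min 1 \<bar>s * snd z\<bar>) = clipped_norm \<mu> s"
    by (simp add: norm2_def clipped_norm_def)
qed

lemma lin_window_upd:
  assumes "finite J"
  shows "lin_window J n x - lin_window J n (x(i := y))
    = (if 0 \<le> n - i \<and> nat (n - i) \<in> J then a (nat (n - i)) * (x i - y) else 0)"
proof -
  have "lin_window J n x - lin_window J n (x(i := y))
      = (\<Sum>j\<in>J. if n - int j = i then a j * (x i - y) else 0)"
    unfolding lin_window_def sum_subtractf[symmetric] by (rule sum.cong) (auto simp: right_diff_distrib)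
  also have "\<dots> = (\<Sum>j\<in>J. if j = nat (n - i) then (if 0 \<le> n - i then a (nat (n - i)) * (x i - y) else 0) else 0)"
    by (rule sum.cong) auto
  finally show ?thesis using assms by (simp add: sum.delta)
qed

end

context smoothed_functional
begin

definition smoothed_lipschitz :: real where
  "smoothed_lipschitz = C * (\<integral>z. \<bar>K z\<bar> \<partial>lborel)"

lemma smoothed_lipschitz_nonneg: "0 \<le> smoothed_lipschitz"
  unfolding smoothed_lipschitz_def using C_nonneg by simp

lemma smoothed_le: "\<bar>smoothed p K s\<bar> \<le> smoothed_lipschitz"
  unfolding smoothed_lipschitz_def by (rule smoothed_bound[OF K1])

lemma smoothed_diff_le: "\<bar>smoothed p K s - smoothed p K t\<bar> \<le> smoothed_lipschitz * min 1 \<bar>s - t\<bar>"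
  unfolding smoothed_lipschitz_def by (rule smoothed_diff[OF K1])

lemma measurable_smoothed_K [measurable]: "smoothed p K \<in> borel_measurable borel"
  by (rule measurable_smoothed[OF K1])

text \<open>
  The effect on a smoothed summand of raising the truncation level of the series from \<open>m\<close> to \<open>m'\<close>; the lags up to
  \<open>k\<close> have been integrated out.
\<close>
definition window_increment :: "nat \<Rightarrow> nat \<Rightarrow> int \<Rightarrow> (int \<Rightarrow> real) \<Rightarrow> real" where
  "window_increment m m' n x =
     smoothed p K (lin_window {k+1..m'} n x) - smoothed p K (lin_window {k+1..m} n x)"

lemma window_increment_le:
  assumes "k \<le> m" "m \<le> m'"
  shows "\<bar>window_increment m m' n x\<bar> \<le> smoothed_lipschitz * (\<Sum>l=m+1..m'. min 1 \<bar>a l * x (n - int l)\<bar>)"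
proof -
  have "{k+1..m'} = {k+1..m} \<union> {m+1..m'}" using assms by auto
  then have "lin_window {k+1..m'} n x - lin_window {k+1..m} n x = (\<Sum>l=m+1..m'. a l * x (n - int l))"
    unfolding lin_window_def by (simp add: sum.union_disjoint)
  then have "\<bar>window_increment m m' n x\<bar>
      \<le> smoothed_lipschitz * min 1 \<bar>\<Sum>l=m+1..m'. a l * x (n - int l)\<bar>"
    using smoothed_diff_le[of "lin_window {k+1..m'} n x" "lin_window {k+1..m} n x"]
    by (simp add: window_increment_def)
  also have "\<dots> \<le> smoothed_lipschitz * (\<Sum>l=m+1..m'. min 1 \<bar>a l * x (n - int l)\<bar>)"
    by (intro mult_left_mono min_one_sum_le smoothed_lipschitz_nonneg)
  finally show ?thesis .
qed

lemma window_increment_upd_le: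
  "\<bar>window_increment m m' n x - window_increment m m' n (x(i := y))\<bar>
    \<le> 2 * smoothed_lipschitz * (min 1 \<bar>a (nat (n - i)) * x i\<bar> + min 1 \<bar>a (nat (n - i)) * y\<bar>)"
proof -
  have one: "\<bar>smoothed p K (lin_window J n x) - smoothed p K (lin_window J n (x(i := y)))\<bar>
      \<le> smoothed_lipschitz * (min 1 \<bar>a (nat (n - i)) * x i\<bar> + min 1 \<bar>a (nat (n - i)) * y\<bar>)"
    if "finite J" for J
  proof -
    have "\<bar>smoothed p K (lin_window J n x) - smoothed p K (lin_window J n (x(i := y)))\<bar>
        \<le> smoothed_lipschitz * min 1 \<bar>lin_window J n x - lin_window J n (x(i := y))\<bar>"
      by (rule smoothed_diff_le)
    also have "min 1 \<bar>lin_window J n x - lin_window J n (x(i := y))\<bar>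
        \<le> min 1 \<bar>a (nat (n - i)) * x i\<bar> + min 1 \<bar>a (nat (n - i)) * y\<bar>"
      unfolding lin_window_upd[OF that] using min_one_diff_le by (auto simp: right_diff_distrib)
    finally show ?thesis using smoothed_lipschitz_nonneg by (simp add: mult_left_mono)
  qed
  show ?thesis
    using one[of "{k+1..m'}"] one[of "{k+1..m}"] unfolding window_increment_def by simp linarith
qed

lemma window_increment_upd_eq:
  assumes "m \<le> m'" "\<not> (1 \<le> n - i \<and> n - i \<le> int m')"
  shows "window_increment m m' n (x(i := y)) = window_increment m m' n x"
proof -
  have "lin_window J n (x(i := y)) = lin_window J n x" if "J \<subseteq> {1..m'}" for J
  proof -
    have "n - int j \<noteq> i" if "j \<in> J" for j using \<open>J \<subseteq> {1..m'}\<close> that assms(2) by auto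
    then show ?thesis unfolding lin_window_def by (intro sum.cong refl) simp
  qed
  from this[of "{k+1..m}"] this[of "{k+1..m'}"] show ?thesis
    using assms by (simp add: window_increment_def subset_eq)
qed

text \<open>
  Resampling innovation \<open>i\<close> moves the increment in two ways that are both small. By the Lipschitz property the
  change is governed by the coefficient \<open>a (n - i)\<close>, and as the increment itself comes from the lags beyond \<open>m\<close>, it
  is at most the sum over these. Neither bound alone suffices: the first does not tend to 0 with growing \<open>m\<close>, and
  the second is the same for all \<open>m'\<close> values of \<open>i\<close> that matter.
\<close>
lemma norm2_window_increment_upd:
  assumes m: "k \<le> m" "m \<le> m'" and I: "i \<in> I" "\<And>l. l \<in> {1..m'} \<Longrightarrow> n - int l \<in> I"
  shows "norm2 (innovation_product I \<Otimes>\<^sub>M \<mu>)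
      (\<lambda>z. window_increment m m' n (fst z) - window_increment m m' n ((fst z)(i := snd z)))
    \<le> (if 1 \<le> n - i \<and> n - i \<le> int m'
        then 4 * smoothed_lipschitz * min (clipped_norm \<mu> (a (nat (n - i)))) (\<Sum>l=m+1..m'. clipped_norm \<mu> (a l))
        else 0)"
proof (cases "1 \<le> n - i \<and> n - i \<le> int m'")
  case False
  show ?thesis
    unfolding window_increment_upd_eq[OF m(2) False] if_not_P[OF False] by simp
next
  case True
  let ?P = "innovation_product I"
  let ?L = smoothed_lipschitz
  let ?D = "\<lambda>z. window_increment m m' n (fst z) - window_increment m m' n ((fst z)(i := snd z))"
  interpret mu: prob_space \<mu> by (rule prob_space_mu)
  interpret P: prob_space ?P by (intro prob_space_PiM prob_space_mu)
  interpret PM: pair_prob_space ?P \<mu> ..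
  have comp[measurable]: "(\<lambda>z. fst z i') \<in> borel_measurable (?P \<Otimes>\<^sub>M \<mu>)" if "i' \<in> I" for i'
  proof -
    have "(\<lambda>x. x i') \<in> borel_measurable ?P"
      using measurable_component_singleton[OF that, of "\<lambda>_. \<mu>"] by (simp cong: measurable_cong_sets)
    then show ?thesis by (rule measurable_compose[OF measurable_fst])
  qed
  have [measurable]: "snd \<in> borel_measurable (?P \<Otimes>\<^sub>M \<mu>)"
    using measurable_snd[of ?P \<mu>] by (simp cong: measurable_cong_sets)
  have compu[measurable]: "(\<lambda>z. ((fst z)(i := snd z)) i') \<in> borel_measurable (?P \<Otimes>\<^sub>M \<mu>)" if "i' \<in> I" for i'
    using that by (cases "i' = i") (simp_all add: comp)
  have lw: "(\<lambda>z. lin_window J n (fst z)) \<in> borel_measurable (?P \<Otimes>\<^sub>M \<mu>)"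
    "(\<lambda>z. lin_window J n ((fst z)(i := snd z))) \<in> borel_measurable (?P \<Otimes>\<^sub>M \<mu>)" if "J \<subseteq> {1..m'}" for J
    unfolding lin_window_def using that I(2)
    by (auto intro!: borel_measurable_sum borel_measurable_times comp compu simp del: fun_upd_apply)
  have D[measurable]: "?D \<in> borel_measurable (?P \<Otimes>\<^sub>M \<mu>)"
    unfolding window_increment_def using m
    by (intro borel_measurable_diff measurable_compose[OF lw(1) measurable_smoothed_K]
        measurable_compose[OF lw(2) measurable_smoothed_K]) auto
  have sq: "square_integrable (?P \<Otimes>\<^sub>M \<mu>) (\<lambda>z. min 1 \<bar>s * f z\<bar>)" if "f \<in> borel_measurable (?P \<Otimes>\<^sub>M \<mu>)" for s f
    using that by (intro PM.P.square_integrable_bounded[where B=1]) auto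
  have "norm2 (?P \<Otimes>\<^sub>M \<mu>) ?D \<le> 4 * ?L * clipped_norm \<mu> (a (nat (n - i)))"
  proof -
    let ?s = "a (nat (n - i))"
    let ?f = "\<lambda>z. min 1 \<bar>?s * fst z i\<bar> + min 1 \<bar>?s * snd z\<bar>"
    have f: "square_integrable (?P \<Otimes>\<^sub>M \<mu>) ?f"
      by (intro square_integrable_add sq comp I) measurable
    have "norm2 (?P \<Otimes>\<^sub>M \<mu>) ?D \<le> norm2 (?P \<Otimes>\<^sub>M \<mu>) (\<lambda>z. 2 * ?L * ?f z)"
    proof (rule norm2_mono[OF square_integrable_cmult[OF f] D], rule AE_I2)
      fix z
      show "\<bar>?D z\<bar> \<le> \<bar>2 * ?L * ?f z\<bar>"
        using window_increment_upd_le[of m m' n "fst z" i "snd z"] by linarith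
    qed
    also have "\<dots> = 2 * ?L * norm2 (?P \<Otimes>\<^sub>M \<mu>) ?f"
      using smoothed_lipschitz_nonneg unfolding norm2_cmult by simp
    also have "norm2 (?P \<Otimes>\<^sub>M \<mu>) ?f \<le> clipped_norm \<mu> ?s + clipped_norm \<mu> ?s"
      using norm2_add[OF sq[OF comp[OF I(1)], of ?s] sq[of snd ?s]] norm2_pair_component[OF I(1), of ?s] by simp
    finally show ?thesis using smoothed_lipschitz_nonneg by (simp add: mult_left_mono)
  qed
  moreover have "norm2 (?P \<Otimes>\<^sub>M \<mu>) ?D \<le> 4 * ?L * (\<Sum>l=m+1..m'. clipped_norm \<mu> (a l))"
  proof -
    let ?f = "\<lambda>l z. min 1 \<bar>a l * fst z (n - int l)\<bar> + min 1 \<bar>a l * ((fst z)(i := snd z)) (n - int l)\<bar>"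
    have f: "square_integrable (?P \<Otimes>\<^sub>M \<mu>) (?f l)" and fn: "norm2 (?P \<Otimes>\<^sub>M \<mu>) (?f l) \<le> 2 * clipped_norm \<mu> (a l)"
      if "l \<in> {m+1..m'}" for l
    proof -
      have l: "n - int l \<in> I" using that by (intro I(2)) auto
      have s1: "square_integrable (?P \<Otimes>\<^sub>M \<mu>) (\<lambda>z. min 1 \<bar>a l * fst z (n - int l)\<bar>)"
        by (intro sq comp l)
      have s2: "square_integrable (?P \<Otimes>\<^sub>M \<mu>) (\<lambda>z. min 1 \<bar>a l * ((fst z)(i := snd z)) (n - int l)\<bar>)"
        by (intro sq compu l)
      show "square_integrable (?P \<Otimes>\<^sub>M \<mu>) (?f l)" by (intro square_integrable_add s1 s2)
      have "norm2 (?P \<Otimes>\<^sub>M \<mu>) (\<lambda>z. min 1 \<bar>a l * ((fst z)(i := snd z)) (n - int l)\<bar>) = clipped_norm \<mu> (a l)"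
        using norm2_pair_component[OF l, of "a l"] by (cases "n - int l = i") simp_all
      then show "norm2 (?P \<Otimes>\<^sub>M \<mu>) (?f l) \<le> 2 * clipped_norm \<mu> (a l)"
        using norm2_add[OF s1 s2] norm2_pair_component(1)[OF l, of "a l"] by simp
    qed
    let ?F = "\<lambda>z. \<Sum>l=m+1..m'. ?f l z"
    have F: "square_integrable (?P \<Otimes>\<^sub>M \<mu>) ?F" by (intro square_integrable_sum f)
    have "norm2 (?P \<Otimes>\<^sub>M \<mu>) ?D \<le> norm2 (?P \<Otimes>\<^sub>M \<mu>) (\<lambda>z. ?L * ?F z)"
    proof (rule norm2_mono[OF square_integrable_cmult[OF F] D], rule AE_I2)
      fix z
      have "\<bar>?D z\<bar> \<le> ?L * ?F z"
        using window_increment_le[OF m, of n "fst z"] window_increment_le[OF m, of n "(fst z)(i := snd z)"]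
        unfolding sum.distrib distrib_left by linarith
      then show "\<bar>?D z\<bar> \<le> \<bar>?L * ?F z\<bar>" by linarith
    qed
    then have 1: "norm2 (?P \<Otimes>\<^sub>M \<mu>) ?D \<le> ?L * norm2 (?P \<Otimes>\<^sub>M \<mu>) ?F"
      using smoothed_lipschitz_nonneg unfolding norm2_cmult by simp
    have "norm2 (?P \<Otimes>\<^sub>M \<mu>) ?F \<le> (\<Sum>l=m+1..m'. norm2 (?P \<Otimes>\<^sub>M \<mu>) (?f l))"
      by (rule norm2_sum[OF f])
    also have "\<dots> \<le> (\<Sum>l=m+1..m'. 2 * clipped_norm \<mu> (a l))" by (rule sum_mono[OF fn])
    also have "\<dots> \<le> 4 * (\<Sum>l=m+1..m'. clipped_norm \<mu> (a l))"
      by (simp add: sum_distrib_left[symmetric] sum_nonneg clipped_norm_nonneg)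
    finally have "?L * norm2 (?P \<Otimes>\<^sub>M \<mu>) ?F \<le> ?L * (4 * (\<Sum>l=m+1..m'. clipped_norm \<mu> (a l)))"
      by (rule mult_left_mono[OF _ smoothed_lipschitz_nonneg])
    with 1 have "norm2 (?P \<Otimes>\<^sub>M \<mu>) ?D \<le> ?L * (4 * (\<Sum>l=m+1..m'. clipped_norm \<mu> (a l)))"
      by (rule order_trans)
    then show ?thesis by (simp only: mult_ac)
  qed
  ultimately show ?thesis using True by (simp add: min_def)
qed

end

section \<open>The error of truncating the series\<close>

context smoothed_functional
begin

text \<open>
  The total influence of one innovation on all increments, which is also that of all innovations on one
  increment.
\<close>
definition increment_bound :: "nat \<Rightarrow> nat \<Rightarrow> real" where
  "increment_bound m m' = (\<Sum>j=1..m'. 4 * smoothed_lipschitz *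
     min (clipped_norm \<mu> (a j)) (\<Sum>l=m+1..m'. clipped_norm \<mu> (a l)))"

lemma window_increment_eps:
  assumes "\<And>j. j \<in> {k+1..max m m'} \<Longrightarrow> n - int j \<in> I"
  shows "window_increment m m' n (\<lambda>i\<in>I. \<epsilon> i \<omega>)
    = smoothed p K (lin {k+1..m'} n \<omega>) - smoothed p K (lin {k+1..m} n \<omega>)"
proof -
  have "lin {k+1..l} n \<omega> = lin_window {k+1..l} n (\<lambda>i\<in>I. \<epsilon> i \<omega>)" if "l \<le> max m m'" for l
    using assms that by (intro lin_eq_window) auto
  from this[of m] this[of m'] show ?thesis by (simp add: window_increment_def)
qed

text \<open>
  By the Efron--Stein inequality. The influence of innovation \<open>i\<close> on the increment at time \<open>n\<close> depends on \<open>n - i\<close>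
  only, so that its sums over \<open>i\<close> and over \<open>n\<close> have the same bound; one factor of the square is estimated by the
  row sum, and the other one yields \<open>N\<close> column sums.
\<close>
lemma norm2_sum_smoothed_increments:
  assumes m: "k \<le> m" "m \<le> m'"
  defines "Z \<equiv> \<lambda>n \<omega>. smoothed p K (lin {k+1..m'} (int n) \<omega>) - smoothed p K (lin {k+1..m} (int n) \<omega>)"
  shows "(norm2 M (\<lambda>\<omega>. \<Sum>n=1..N. Z n \<omega> - expectation (Z n)))\<^sup>2 \<le> real N * (increment_bound m m')\<^sup>2"
proof -
  \<comment> \<open>the innovations that enter the increments at the times \<open>1, ..., N\<close>\<close>
  define I where "I = {1 - int m'..int N}"
  define c where "c j = 4 * smoothed_lipschitz * min (clipped_norm \<mu> (a j)) (\<Sum>l=m+1..m'. clipped_norm \<mu> (a l))" for j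
  define \<beta> where "\<beta> i n = (if 1 \<le> int n - i \<and> int n - i \<le> int m' then c (nat (int n - i)) else 0)" for i n
  define F where "F n = window_increment m m' (int n)" for n
  let ?B = "increment_bound m m'"
  have B: "?B = (\<Sum>j=1..m'. c j)" by (simp add: increment_bound_def c_def)
  have c0: "0 \<le> c j" for j
    unfolding c_def using smoothed_lipschitz_nonneg
    by (intro mult_nonneg_nonneg) (auto simp: clipped_norm_nonneg intro: sum_nonneg)
  have B0: "0 \<le> ?B" unfolding B by (intro sum_nonneg c0)
  have \<beta>0: "0 \<le> \<beta> i n" for i n by (simp add: \<beta>_def c0)
  have wI: "int n - int l \<in> I" if "n \<in> {1..N}" "l \<in> {1..m'}" for n l
    using that by (auto simp: I_def)
  have Z_eq: "Z n \<omega> = F n (\<lambda>i\<in>I. \<epsilon> i \<omega>)" if "n \<in> {1..N}" for n \<omega>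
    unfolding Z_def F_def using that m by (intro window_increment_eps[symmetric] wI) auto
  have lwm: "lin_window J (int n) \<in> borel_measurable (Pi\<^sub>M I (\<lambda>_. borel))" if "J \<subseteq> {1..m'}" "n \<in> {1..N}" for J n
    using that wI by (intro measurable_lin_window) blast
  have Fm: "F n \<in> borel_measurable (Pi\<^sub>M I (\<lambda>_. borel))" if "n \<in> {1..N}" for n
    unfolding F_def window_increment_def using m that
    by (intro borel_measurable_diff measurable_compose[OF lwm measurable_smoothed_K]) auto
  then have Fm': "F n \<in> borel_measurable (Pi\<^sub>M I (\<lambda>_. \<mu>))" if "n \<in> {1..N}" for n
    using that by (simp cong: measurable_cong_sets add: sets_PiM_mu)
  have FB: "\<bar>F n x\<bar> \<le> 2 * smoothed_lipschitz" for n x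
    using smoothed_le[of "lin_window {k+1..m'} (int n) x"] smoothed_le[of "lin_window {k+1..m} (int n) x"]
    unfolding F_def window_increment_def by linarith
  have es: "(\<integral>x. (\<Sum>n\<in>{1..N}. F n x)\<^sup>2 \<partial>(Pi\<^sub>M I (\<lambda>_. \<mu>))) - (\<integral>x. (\<Sum>n\<in>{1..N}. F n x) \<partial>(Pi\<^sub>M I (\<lambda>_. \<mu>)))\<^sup>2
      \<le> (\<Sum>i\<in>I. (\<Sum>n\<in>{1..N}. \<beta> i n)\<^sup>2) / 2"
  proof (rule efron_stein_sum[where B="2 * smoothed_lipschitz"])
    fix i n assume "i \<in> I" "n \<in> {1..N}"
    then show "norm2 (Pi\<^sub>M I (\<lambda>_. \<mu>) \<Otimes>\<^sub>M \<mu>) (\<lambda>z. F n (fst z) - F n ((fst z)(i := snd z))) \<le> \<beta> i n"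
      unfolding F_def \<beta>_def c_def by (intro norm2_window_increment_upd m wI)
  qed (use prob_space_mu Fm' FB in \<open>auto simp: I_def\<close>)
  have row: "(\<Sum>n\<in>{1..N}. \<beta> i n) \<le> ?B" for i
  proof -
    let ?S = "{n \<in> {1..N}. 1 \<le> int n - i \<and> int n - i \<le> int m'}"
    have "(\<Sum>n\<in>{1..N}. \<beta> i n) = (\<Sum>n\<in>?S. c (nat (int n - i)))"
      unfolding \<beta>_def by (rule sum.inter_filter[symmetric]) simp
    also have "\<dots> = (\<Sum>j\<in>(\<lambda>n. nat (int n - i)) ` ?S. c j)"
      by (rule sum.reindex_cong[symmetric, OF _ refl refl]) (auto simp: inj_on_def)
    also have "\<dots> \<le> ?B" unfolding B by (intro sum_mono2 c0) auto
    finally show ?thesis .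
  qed
  have col: "(\<Sum>i\<in>I. \<beta> i n) \<le> ?B" for n
  proof -
    let ?S = "{i \<in> I. 1 \<le> int n - i \<and> int n - i \<le> int m'}"
    have fin: "finite I" by (simp add: I_def)
    have "(\<Sum>i\<in>I. \<beta> i n) = (\<Sum>i\<in>?S. c (nat (int n - i)))"
      unfolding \<beta>_def by (rule sum.inter_filter[symmetric, OF fin])
    also have "\<dots> = (\<Sum>j\<in>(\<lambda>i. nat (int n - i)) ` ?S. c j)"
      by (rule sum.reindex_cong[symmetric, OF _ refl refl]) (auto simp: inj_on_def)
    also have "\<dots> \<le> ?B" unfolding B by (intro sum_mono2 c0) auto
    finally show ?thesis .
  qed
  have "(\<Sum>i\<in>I. (\<Sum>n\<in>{1..N}. \<beta> i n)\<^sup>2) \<le> (\<Sum>i\<in>I. ?B * (\<Sum>n\<in>{1..N}. \<beta> i n))"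
    unfolding power2_eq_square by (intro sum_mono mult_right_mono row sum_nonneg \<beta>0)
  also have "\<dots> = ?B * (\<Sum>n\<in>{1..N}. \<Sum>i\<in>I. \<beta> i n)"
    by (subst sum.swap) (simp add: sum_distrib_left)
  also have "\<dots> \<le> ?B * (\<Sum>n\<in>{1..N}. ?B)"
    by (intro mult_left_mono sum_mono col B0)
  also have "\<dots> = real N * ?B\<^sup>2" by (simp add: power2_eq_square)
  finally have tot: "(\<Sum>i\<in>I. (\<Sum>n\<in>{1..N}. \<beta> i n)\<^sup>2) \<le> real N * ?B\<^sup>2" .
  have Zm[measurable]: "Z n \<in> borel_measurable M" for n unfolding Z_def by measurable
  have Zb: "square_integrable M (Z n)" for n
  proof (rule square_integrable_bounded[OF Zm])
    show "\<bar>Z n \<omega>\<bar> \<le> 2 * smoothed_lipschitz" for \<omega>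
      using smoothed_le[of "lin {k+1..m'} (int n) \<omega>"] smoothed_le[of "lin {k+1..m} (int n) \<omega>"]
      unfolding Z_def by linarith
  qed
  then have Zi: "integrable M (Z n)" for n by (rule square_integrable_integrable)
  define W where "W \<omega> = (\<Sum>n=1..N. Z n \<omega>)" for \<omega>
  have W: "square_integrable M W" unfolding W_def by (intro square_integrable_sum Zb)
  have W_eq: "W \<omega> = (\<Sum>n\<in>{1..N}. F n (\<lambda>i\<in>I. \<epsilon> i \<omega>))" for \<omega>
    unfolding W_def by (intro sum.cong Z_eq) auto
  have Fsum: "(\<lambda>x. \<Sum>n\<in>{1..N}. F n x) \<in> borel_measurable (Pi\<^sub>M I (\<lambda>_. borel))"
    by (intro borel_measurable_sum Fm)
  then have Fsum2: "(\<lambda>x. (\<Sum>n\<in>{1..N}. F n x)\<^sup>2) \<in> borel_measurable (Pi\<^sub>M I (\<lambda>_. borel))"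
    by simp
  have inj: "inj_on (\<lambda>i::int. i) I" by (simp add: inj_on_def)
  have "(norm2 M (\<lambda>\<omega>. \<Sum>n=1..N. Z n \<omega> - expectation (Z n)))\<^sup>2 = variance W"
    unfolding norm2_squared W_def using Zi by (simp add: sum_subtractf)
  also have "\<dots> = expectation (\<lambda>\<omega>. (W \<omega>)\<^sup>2) - (expectation W)\<^sup>2"
    using W square_integrable_integrable[OF W] by (intro variance_eq) (auto simp: square_integrable_def)
  also have "\<dots> = (\<integral>x. (\<Sum>n\<in>{1..N}. F n x)\<^sup>2 \<partial>(Pi\<^sub>M I (\<lambda>_. \<mu>))) - (\<integral>x. (\<Sum>n\<in>{1..N}. F n x) \<partial>(Pi\<^sub>M I (\<lambda>_. \<mu>)))\<^sup>2"
    unfolding W_eq integral_window[OF inj Fsum, symmetric] integral_window[OF inj Fsum2, symmetric] ..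
  also have "\<dots> \<le> real N * ?B\<^sup>2 / 2" using es tot by linarith
  also have "\<dots> \<le> real N * ?B\<^sup>2" by simp
  finally show ?thesis .
qed

lemma clipped_tail_small:
  assumes e: "e > 0"
  obtains m0 where "\<And>m m'. m \<ge> m0 \<Longrightarrow> (\<Sum>l=m+1..m'. clipped_norm \<mu> (a l)) < e"
proof -
  obtain m0 where m0: "\<And>m n. m \<ge> m0 \<Longrightarrow> norm (\<Sum>j=m..<n. clipped_norm \<mu> (a (Suc j))) < e"
    using summable_clipped e unfolding summable_Cauchy by blast
  show ?thesis
  proof (rule that)
    fix m m' assume "m \<ge> m0"
    have "(\<Sum>l=m+1..m'. clipped_norm \<mu> (a l)) = (\<Sum>j=m..<m'. clipped_norm \<mu> (a (Suc j)))"
      by (rule sum.reindex_cong[where l=Suc]) (auto simp: image_Suc_atLeastLessThan atLeastLessThanSuc_atLeastAtMost)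
    then show "(\<Sum>l=m+1..m'. clipped_norm \<mu> (a l)) < e" using m0[OF \<open>m \<ge> m0\<close>, of m'] by (simp add: abs_less_iff)
  qed
qed

text \<open>
  Summability of the clipped norms implies that the sum of \<open>min (clipped_norm \<mu> (a j)) r\<close> over \<open>j\<close> tends to 0 with
  \<open>r\<close>: the terms up to \<open>J\<close> contribute at most \<open>J * r\<close>, the others a tail of the series.
\<close>
lemma increment_bound_small:
  assumes e: "e > 0"
  obtains m0 where "\<And>m m'. m \<ge> m0 \<Longrightarrow> increment_bound m m' \<le> e"
proof -
  define e' where "e' = e / (8 * (smoothed_lipschitz + 1))"
  have e': "e' > 0" using e smoothed_lipschitz_nonneg by (simp add: e'_def)
  obtain J where J: "\<And>m m'. m \<ge> J \<Longrightarrow> (\<Sum>l=m+1..m'. clipped_norm \<mu> (a l)) < e'"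
    using clipped_tail_small[OF e'] by blast
  have e'': "e' / (real J + 1) > 0" using e' by simp
  obtain m0 where m0: "\<And>m m'. m \<ge> m0 \<Longrightarrow> (\<Sum>l=m+1..m'. clipped_norm \<mu> (a l)) < e' / (real J + 1)"
    using clipped_tail_small[OF e''] by blast
  show ?thesis
  proof (rule that)
    fix m m' assume m: "m \<ge> m0"
    define r where "r = (\<Sum>l=m+1..m'. clipped_norm \<mu> (a l))"
    have r0: "r \<ge> 0" unfolding r_def by (intro sum_nonneg clipped_norm_nonneg)
    have r: "r < e' / (real J + 1)" unfolding r_def by (rule m0[OF m])
    have "(\<Sum>j=1..m'. min (clipped_norm \<mu> (a j)) r) \<le> (\<Sum>j\<in>{1..J} \<union> {J+1..m'}. min (clipped_norm \<mu> (a j)) r)"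
      using r0 by (intro sum_mono2) (auto simp: clipped_norm_nonneg)
    also have "\<dots> = (\<Sum>j\<in>{1..J}. min (clipped_norm \<mu> (a j)) r) + (\<Sum>j\<in>{J+1..m'}. min (clipped_norm \<mu> (a j)) r)"
      by (rule sum.union_disjoint) auto
    also have "\<dots> \<le> (\<Sum>j\<in>{1..J}. r) + (\<Sum>j\<in>{J+1..m'}. clipped_norm \<mu> (a j))"
      by (intro add_mono sum_mono) auto
    also have "\<dots> \<le> real J * r + e'" using J[of J m'] by simp
    also have "\<dots> \<le> (real J + 1) * (e' / (real J + 1)) + e'"
      using r r0 by (intro add_right_mono mult_mono) auto
    also have "\<dots> = 2 * e'" by simp
    finally have s: "(\<Sum>j=1..m'. min (clipped_norm \<mu> (a j)) r) \<le> 2 * e'" .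
    have "increment_bound m m' = 4 * smoothed_lipschitz * (\<Sum>j=1..m'. min (clipped_norm \<mu> (a j)) r)"
      by (simp add: increment_bound_def r_def sum_distrib_left)
    also have "\<dots> \<le> (4 * (smoothed_lipschitz + 1)) * (2 * e')"
      using s e' smoothed_lipschitz_nonneg r0
      by (intro mult_mono) (auto intro!: sum_nonneg simp: clipped_norm_nonneg)
    also have "\<dots> = e" using smoothed_lipschitz_nonneg by (simp add: e'_def field_simps add_nonneg_eq_0_iff)
    finally show "increment_bound m m' \<le> e" .
  qed
qed

text \<open>What remains of \<open>K\<close> after subtracting its conditional expectation given the innovations before \<open>n - k\<close>.\<close>
definition residual :: "nat \<Rightarrow> int \<Rightarrow> 'a \<Rightarrow> real" where
  "residual m n \<omega> = K (lin {1..m} n \<omega>) - smoothed p K (lin {k+1..m} n \<omega>)"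

lemma square_integrable_smoothed_lin: "square_integrable M (\<lambda>\<omega>. smoothed p K (lin J n \<omega>))"
  by (rule square_integrable_bounded[where B=smoothed_lipschitz]) (auto simp: smoothed_le)

lemma square_integrable_residual: "m \<ge> k \<Longrightarrow> square_integrable M (residual m n)"
  unfolding residual_def
  by (intro square_integrable_diff square_integrable_comp_lin K2 square_integrable_smoothed_lin)

lemma residual_orthogonal:
  assumes m: "m \<ge> k" and g: "g \<in> borel_measurable (Pi\<^sub>M {..<n - int k} (\<lambda>_. borel))"
    and Q: "square_integrable M (\<lambda>\<omega>. g (\<lambda>i\<in>{..<n - int k}. \<epsilon> i \<omega>))"
  shows "(\<integral>\<omega>. residual m n \<omega> * g (\<lambda>i\<in>{..<n - int k}. \<epsilon> i \<omega>) \<partial>M) = 0"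
proof -
  let ?B = "{..<n - int k}"
  have w: "n - int j \<in> ?B" if "j \<in> {k+1..m}" for j using that by auto
  have weq: "lin {k+1..m} n \<omega> = lin_window {k+1..m} n (\<lambda>i\<in>?B. \<epsilon> i \<omega>)" for \<omega>
    by (rule lin_eq_window) (rule w)
  have "(\<lambda>x. (lin_window {k+1..m} n x, g x)) \<in> Pi\<^sub>M ?B (\<lambda>_. borel) \<rightarrow>\<^sub>M borel \<Otimes>\<^sub>M borel"
    using measurable_lin_window[OF w] g by (intro measurable_Pair)
  from independent_head[OF this]
  have ind: "independent_pair M borel (lin {1..k} n) (borel \<Otimes>\<^sub>M borel)
      (\<lambda>\<omega>. (lin {k+1..m} n \<omega>, g (\<lambda>i\<in>?B. \<epsilon> i \<omega>)))"
    by (simp only: weq)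
  have L: "square_integrable M (\<lambda>\<omega>. K (lin {1..k} n \<omega> + lin {k+1..m} n \<omega>))"
    unfolding lin_split[OF m, symmetric] by (rule square_integrable_comp_lin[OF m K2])
  from smoothed_residual_orthogonal[OF density ind head_law K1 L Q] show ?thesis
    unfolding lin_split[OF m, symmetric] residual_def .
qed

lemma expectation_residual:
  assumes m: "m \<ge> k" shows "expectation (residual m n) = 0"
  using residual_orthogonal[OF m, of "\<lambda>_. 1" n] by simp

lemma residual_orthogonal_residual:
  assumes m: "m \<ge> k" "m' \<ge> k" and lag: "l + int k \<le> n"
  shows "(\<integral>\<omega>. residual m n \<omega> * residual m' l \<omega> \<partial>M) = 0"
proof -
  let ?B = "{..<n - int k}"
  let ?g = "\<lambda>x. K (lin_window {1..m'} l x) - smoothed p K (lin_window {k+1..m'} l x)"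
  have w: "l - int j \<in> ?B" if "j \<in> J" "J \<subseteq> {1..m'}" for j J using that lag by auto
  have lw: "lin_window J l \<in> borel_measurable (Pi\<^sub>M ?B (\<lambda>_. borel))" if "J \<subseteq> {1..m'}" for J
    by (rule measurable_lin_window) (rule w[OF _ that])
  have g: "?g \<in> borel_measurable (Pi\<^sub>M ?B (\<lambda>_. borel))"
    by (intro borel_measurable_diff measurable_compose[OF lw measurable_K[OF K1]]
        measurable_compose[OF lw measurable_smoothed_K]) auto
  have eq: "residual m' l \<omega> = ?g (\<lambda>i\<in>?B. \<epsilon> i \<omega>)" for \<omega>
  proof -
    have "lin J l \<omega> = lin_window J l (\<lambda>i\<in>?B. \<epsilon> i \<omega>)" if "J \<subseteq> {1..m'}" for J
      by (rule lin_eq_window) (rule w[OF _ that])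
    from this[of "{1..m'}"] this[of "{k+1..m'}"] show ?thesis by (simp add: residual_def)
  qed
  have Q: "square_integrable M (\<lambda>\<omega>. ?g (\<lambda>i\<in>?B. \<epsilon> i \<omega>))"
    unfolding eq[symmetric] using square_integrable_residual[OF m(2), of l] by (simp add: eta_contract_eq)
  from residual_orthogonal[OF m(1) g Q] show ?thesis unfolding eq[symmetric] .
qed

definition centered_lin :: "nat \<Rightarrow> int \<Rightarrow> 'a \<Rightarrow> real" where
  "centered_lin m n \<omega> = K (lin {1..m} n \<omega>) - expectation (\<lambda>\<omega>. K (lin {1..m} n \<omega>))"

lemma square_integrable_centered_lin: "m \<ge> k \<Longrightarrow> square_integrable M (centered_lin m n)"
  unfolding centered_lin_def
  by (intro square_integrable_diff square_integrable_comp_lin K2 square_integrable_const)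

lemma centered_lin_eq:
  assumes m: "m \<ge> k"
  shows "centered_lin m n \<omega> = residual m n \<omega>
    + (smoothed p K (lin {k+1..m} n \<omega>) - expectation (\<lambda>\<omega>. smoothed p K (lin {k+1..m} n \<omega>)))"
proof -
  have "expectation (\<lambda>\<omega>. K (lin {1..m} n \<omega>)) - expectation (\<lambda>\<omega>. smoothed p K (lin {k+1..m} n \<omega>))
      = expectation (residual m n)"
    unfolding residual_def
    by (intro Bochner_Integration.integral_diff[symmetric] square_integrable_integrable
        square_integrable_comp_lin[OF m K2] square_integrable_smoothed_lin)
  then show ?thesis unfolding expectation_residual[OF m] by (simp add: centered_lin_def residual_def)
qed

lemma norm2_smoothed_increment:
  assumes m: "k \<le> m" "m \<le> m'"
  shows "norm2 M (\<lambda>\<omega>. smoothed p K (lin {k+1..m'} n \<omega>) - smoothed p K (lin {k+1..m} n \<omega>))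
    \<le> smoothed_lipschitz * (\<Sum>l=m+1..m'. clipped_norm \<mu> (a l))"
proof -
  let ?D = "\<lambda>\<omega>. smoothed p K (lin {k+1..m'} n \<omega>) - smoothed p K (lin {k+1..m} n \<omega>)"
  let ?f = "\<lambda>l \<omega>. min 1 \<bar>a l * \<epsilon> (n - int l) \<omega>\<bar>"
  have f: "square_integrable M (\<lambda>\<omega>. \<Sum>l=m+1..m'. ?f l \<omega>)"
    by (intro square_integrable_sum square_integrable_clipped_eps)
  have "norm2 M ?D \<le> norm2 M (\<lambda>\<omega>. smoothed_lipschitz * (\<Sum>l=m+1..m'. ?f l \<omega>))"
  proof (rule norm2_mono[OF square_integrable_cmult[OF f]], measurable, rule AE_I2)
    fix \<omega>
    have "?D \<omega> = window_increment m m' n (\<lambda>i\<in>UNIV. \<epsilon> i \<omega>)"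
      by (rule window_increment_eps[symmetric]) simp
    then show "\<bar>?D \<omega>\<bar> \<le> \<bar>smoothed_lipschitz * (\<Sum>l=m+1..m'. ?f l \<omega>)\<bar>"
      using window_increment_le[OF m, of n "\<lambda>i\<in>UNIV. \<epsilon> i \<omega>"] by simp
  qed
  also have "\<dots> = smoothed_lipschitz * norm2 M (\<lambda>\<omega>. \<Sum>l=m+1..m'. ?f l \<omega>)"
    unfolding norm2_cmult using smoothed_lipschitz_nonneg by simp
  also have "\<dots> \<le> smoothed_lipschitz * (\<Sum>l=m+1..m'. norm2 M (?f l))"
    by (intro mult_left_mono norm2_sum square_integrable_clipped_eps smoothed_lipschitz_nonneg)
  finally show ?thesis unfolding norm2_clipped_eps .
qed

text \<open>
  A change of the truncation level splits into a change of the residuals and a centred change of the smoothed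
  summands. The changes of the residuals are orthogonal at lags from \<open>k\<close> on and small one by one, because \<open>K\<close> of the
  truncated series converges in mean square. The smoothed part is controlled by
  \<open>norm2_sum_smoothed_increments\<close>. The bound is uniform in \<open>m'\<close>, which allows \<open>m'\<close> to tend to infinity.
\<close>
lemma truncation_error:
  assumes \<eta>: "\<eta> > 0"
  obtains m where "m \<ge> k"
    "\<And>m' N. m' \<ge> m \<Longrightarrow> norm2 M (\<lambda>\<omega>. \<Sum>n=1..N. centered_lin m' (int n) \<omega> - centered_lin m (int n) \<omega>) \<le> \<eta> * sqrt N"
proof -
  define e where "e = \<eta> / (2 * (sqrt (2 * real k) * (1 + smoothed_lipschitz) + 1))"
  have d0: "0 \<le> sqrt (2 * real k) * (1 + smoothed_lipschitz)"
    using smoothed_lipschitz_nonneg by simp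
  then have e: "e > 0" unfolding e_def using \<eta> by (intro divide_pos_pos) auto
  obtain m1 where m1: "m1 \<ge> k" "\<And>m m' n. m \<ge> m1 \<Longrightarrow> m' \<ge> m1 \<Longrightarrow>
      norm2 M (\<lambda>\<omega>. K (lin {1..m} n \<omega>) - K (lin {1..m'} n \<omega>)) \<le> e"
    using norm2_K_lin_cauchy[OF e] by blast
  obtain m2 where m2: "\<And>m m'. m \<ge> m2 \<Longrightarrow> (\<Sum>l=m+1..m'. clipped_norm \<mu> (a l)) < e"
    using clipped_tail_small[OF e] by blast
  obtain m3 where m3: "\<And>m m'. m \<ge> m3 \<Longrightarrow> increment_bound m m' \<le> \<eta> / 2"
    using increment_bound_small[of "\<eta> / 2"] \<eta> by auto
  define m where "m = max m1 (max m2 m3)"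
  have m: "m \<ge> m1" "m \<ge> m2" "m \<ge> m3" "m \<ge> k" using m1(1) by (auto simp: m_def)
  show ?thesis
  proof (rule that[OF m(4)])
    fix m' N assume m': "m' \<ge> m"
    have m'k: "m' \<ge> k" using m' m by simp
    define Q where "Q n \<omega> = residual m' (int n) \<omega> - residual m (int n) \<omega>" for n \<omega>
    define Z where "Z n \<omega> = smoothed p K (lin {k+1..m'} (int n) \<omega>) - smoothed p K (lin {k+1..m} (int n) \<omega>)" for n \<omega>
    have Zsq: "square_integrable M (Z n)" for n
      unfolding Z_def by (intro square_integrable_diff square_integrable_smoothed_lin)
    have Qsq: "square_integrable M (Q n)" for n
      unfolding Q_def by (intro square_integrable_diff square_integrable_residual m m'k)
    have EZ: "expectation (Z n) = expectation (\<lambda>\<omega>. smoothed p K (lin {k+1..m'} (int n) \<omega>))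
        - expectation (\<lambda>\<omega>. smoothed p K (lin {k+1..m} (int n) \<omega>))" for n
      unfolding Z_def
      by (intro Bochner_Integration.integral_diff square_integrable_integrable square_integrable_smoothed_lin)
    have split: "centered_lin m' (int n) \<omega> - centered_lin m (int n) \<omega> = Q n \<omega> + (Z n \<omega> - expectation (Z n))" for n \<omega>
      unfolding centered_lin_eq[OF m(4)] centered_lin_eq[OF m'k] Q_def Z_def[of n \<omega>] EZ by simp
    have Qn: "norm2 M (Q n) \<le> (1 + smoothed_lipschitz) * e" for n
    proof -
      have "Q n = (\<lambda>\<omega>. (K (lin {1..m'} (int n) \<omega>) - K (lin {1..m} (int n) \<omega>)) - Z n \<omega>)"
        by (simp add: Q_def Z_def residual_def fun_eq_iff)
      then have "norm2 M (Q n) \<le> norm2 M (\<lambda>\<omega>. K (lin {1..m'} (int n) \<omega>) - K (lin {1..m} (int n) \<omega>)) + norm2 M (Z n)"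
        using norm2_diff[OF square_integrable_diff[OF square_integrable_comp_lin(1)[OF m'k K2]
            square_integrable_comp_lin(1)[OF m(4) K2]] Zsq[of n]] by simp
      also have "norm2 M (\<lambda>\<omega>. K (lin {1..m'} (int n) \<omega>) - K (lin {1..m} (int n) \<omega>)) \<le> e"
        using m m' by (intro m1) auto
      also have "norm2 M (Z n) \<le> smoothed_lipschitz * (\<Sum>l=m+1..m'. clipped_norm \<mu> (a l))"
        unfolding Z_def by (rule norm2_smoothed_increment[OF m(4) m'])
      also have "\<dots> \<le> smoothed_lipschitz * e"
        using m2[OF m(2), of m'] by (intro mult_left_mono smoothed_lipschitz_nonneg) simp
      finally show ?thesis by (simp add: distrib_right)
    qed
    have Qorth: "(\<integral>\<omega>. Q n \<omega> * Q l \<omega> \<partial>M) = 0" if "l + k \<le> n" for n l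
    proof -
      have lag: "int l + int k \<le> int n" using that by linarith
      have int: "integrable M (\<lambda>\<omega>. residual i (int n) \<omega> * residual j (int l) \<omega>)" if "i \<ge> k" "j \<ge> k" for i j
        using that by (intro square_integrable_mult square_integrable_residual)
      have "(\<lambda>\<omega>. Q n \<omega> * Q l \<omega>) = (\<lambda>\<omega>. residual m' (int n) \<omega> * residual m' (int l) \<omega>
          - residual m' (int n) \<omega> * residual m (int l) \<omega>
          - (residual m (int n) \<omega> * residual m' (int l) \<omega> - residual m (int n) \<omega> * residual m (int l) \<omega>))"
        by (simp add: Q_def fun_eq_iff algebra_simps)
      then show ?thesis
        using int[OF m'k m'k] int[OF m'k m(4)] int[OF m(4) m'k] int[OF m(4) m(4)]
          residual_orthogonal_residual[OF m'k m'k lag] residual_orthogonal_residual[OF m'k m(4) lag]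
          residual_orthogonal_residual[OF m(4) m'k lag] residual_orthogonal_residual[OF m(4) m(4) lag]
        by simp
    qed
    have "(norm2 M (\<lambda>\<omega>. \<Sum>n\<in>{1..N}. Q n \<omega>))\<^sup>2
        \<le> 2 * real k * real (card {1..N}) * ((1 + smoothed_lipschitz) * e)\<^sup>2"
      by (rule norm2_sum_lag_orthogonal) (use Qsq Qn Qorth in auto)
    also have "\<dots> = (sqrt (2 * real k) * (1 + smoothed_lipschitz) * e * sqrt N)\<^sup>2"
      by (simp add: power_mult_distrib)
    finally have 1: "norm2 M (\<lambda>\<omega>. \<Sum>n\<in>{1..N}. Q n \<omega>) \<le> sqrt (2 * real k) * (1 + smoothed_lipschitz) * e * sqrt N"
      by (rule power2_le_imp_le) (use e smoothed_lipschitz_nonneg in auto)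
    have "(norm2 M (\<lambda>\<omega>. \<Sum>n=1..N. Z n \<omega> - expectation (Z n)))\<^sup>2 \<le> real N * (increment_bound m m')\<^sup>2"
      unfolding Z_def by (rule norm2_sum_smoothed_increments[OF m(4) m'])
    also have "\<dots> \<le> real N * (\<eta> / 2)\<^sup>2"
      using m3[OF m(3), of m'] smoothed_lipschitz_nonneg
      by (intro mult_left_mono power_mono) (auto simp: increment_bound_def clipped_norm_nonneg intro!: sum_nonneg mult_nonneg_nonneg)
    also have "\<dots> = (\<eta> / 2 * sqrt N)\<^sup>2" by (simp add: power_mult_distrib power_divide)
    finally have 2: "norm2 M (\<lambda>\<omega>. \<Sum>n=1..N. Z n \<omega> - expectation (Z n)) \<le> \<eta> / 2 * sqrt N"
      by (rule power2_le_imp_le) (use \<eta> in auto)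
    have "norm2 M (\<lambda>\<omega>. \<Sum>n=1..N. centered_lin m' (int n) \<omega> - centered_lin m (int n) \<omega>)
        = norm2 M (\<lambda>\<omega>. (\<Sum>n=1..N. Q n \<omega>) + (\<Sum>n=1..N. Z n \<omega> - expectation (Z n)))"
      unfolding split by (simp add: sum.distrib)
    also have "\<dots> \<le> norm2 M (\<lambda>\<omega>. \<Sum>n=1..N. Q n \<omega>) + norm2 M (\<lambda>\<omega>. \<Sum>n=1..N. Z n \<omega> - expectation (Z n))"
      by (intro norm2_add square_integrable_sum square_integrable_diff Qsq Zsq square_integrable_const)
    also have "\<dots> \<le> (sqrt (2 * real k) * (1 + smoothed_lipschitz) * e + \<eta> / 2) * sqrt N"
      using 1 2 by (simp add: distrib_right)
    also have "sqrt (2 * real k) * (1 + smoothed_lipschitz) * e \<le> (sqrt (2 * real k) * (1 + smoothed_lipschitz) + 1) * e"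
      using e by simp
    also have "\<dots> = \<eta> / 2"
    proof -
      have "sqrt (2 * real k) * (1 + smoothed_lipschitz) + 1 \<noteq> 0" using d0 by linarith
      then show ?thesis unfolding e_def by (simp add: field_simps)
    qed
    finally show "norm2 M (\<lambda>\<omega>. \<Sum>n=1..N. centered_lin m' (int n) \<omega> - centered_lin m (int n) \<omega>) \<le> \<eta> * sqrt N"
      by (simp add: mult_right_mono)
  qed
qed

end

section \<open>Approximation by independent blocks\<close>

context smoothed_functional
begin

definition centered_limit :: "int \<Rightarrow> 'a \<Rightarrow> real" where
  "centered_limit n \<omega> = K (lin_limit n \<omega>) - expectation (\<lambda>\<omega>. K (lin_limit n \<omega>))"

lemma square_integrable_centered_limit: "square_integrable M (centered_limit n)"
  unfolding centered_limit_def
  by (intro square_integrable_diff square_integrable_comp_lin_limit K2 square_integrable_const)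

lemma norm2_centered_limit_diff:
  assumes m: "m \<ge> k"
  shows "norm2 M (\<lambda>\<omega>. centered_limit n \<omega> - centered_lin m n \<omega>)
    \<le> norm2 M (\<lambda>\<omega>. K (lin {1..m} n \<omega>) - K (lin_limit n \<omega>))"
proof -
  let ?D = "\<lambda>\<omega>. K (lin_limit n \<omega>) - K (lin {1..m} n \<omega>)"
  note s = square_integrable_comp_lin(1)[OF m K2, of n] square_integrable_comp_lin_limit(1)[OF K2, of n]
  have E: "expectation ?D = expectation (\<lambda>\<omega>. K (lin_limit n \<omega>)) - expectation (\<lambda>\<omega>. K (lin {1..m} n \<omega>))"
    by (intro Bochner_Integration.integral_diff square_integrable_integrable s)
  have "(\<lambda>\<omega>. centered_limit n \<omega> - centered_lin m n \<omega>) = (\<lambda>\<omega>. ?D \<omega> - expectation ?D)"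
    unfolding E by (simp add: centered_limit_def centered_lin_def fun_eq_iff)
  then have "norm2 M (\<lambda>\<omega>. centered_limit n \<omega> - centered_lin m n \<omega>) \<le> norm2 M ?D"
    using norm2_centered[OF square_integrable_diff[OF s(2,1)]] by simp
  then show ?thesis by (simp add: norm2_minus_commute)
qed

lemma truncation_error_limit:
  assumes \<eta>: "\<eta> > 0"
  obtains m where "m \<ge> k"
    "\<And>N. norm2 M (\<lambda>\<omega>. \<Sum>n=1..N. centered_limit (int n) \<omega> - centered_lin m (int n) \<omega>) \<le> \<eta> * sqrt N"
proof -
  obtain m where m: "m \<ge> k" and le: "\<And>m' N. m' \<ge> m \<Longrightarrow>
      norm2 M (\<lambda>\<omega>. \<Sum>n=1..N. centered_lin m' (int n) \<omega> - centered_lin m (int n) \<omega>) \<le> \<eta> * sqrt N"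
    using truncation_error[OF \<eta>] by blast
  show ?thesis
  proof (rule that[OF m])
    fix N :: nat
    let ?D = "norm2 M (\<lambda>\<omega>. \<Sum>n=1..N. centered_limit (int n) \<omega> - centered_lin m (int n) \<omega>)"
    let ?r = "\<lambda>m'. \<Sum>n=1..N. norm2 M (\<lambda>\<omega>. K (lin {1..m'} (int n) \<omega>) - K (lin_limit (int n) \<omega>))"
    have "?r \<longlonglongrightarrow> (\<Sum>n=1..N. 0)" by (intro tendsto_sum norm2_K_lin_tendsto)
    then have lim: "(\<lambda>m'. ?r m' + \<eta> * sqrt N) \<longlonglongrightarrow> 0 + \<eta> * sqrt N"
      by (intro tendsto_add tendsto_const) simp
    have "?D \<le> ?r m' + \<eta> * sqrt N" if m': "m' \<ge> m" for m'
    proof -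
      have m'k: "m' \<ge> k" using m m' by simp
      have s1: "square_integrable M (\<lambda>\<omega>. \<Sum>n=1..N. centered_limit (int n) \<omega> - centered_lin m' (int n) \<omega>)"
        and s2: "square_integrable M (\<lambda>\<omega>. \<Sum>n=1..N. centered_lin m' (int n) \<omega> - centered_lin m (int n) \<omega>)"
        by (intro square_integrable_sum square_integrable_diff square_integrable_centered_limit square_integrable_centered_lin m m'k)+
      have "?D = norm2 M (\<lambda>\<omega>. (\<Sum>n=1..N. centered_limit (int n) \<omega> - centered_lin m' (int n) \<omega>)
          + (\<Sum>n=1..N. centered_lin m' (int n) \<omega> - centered_lin m (int n) \<omega>))"
        by (simp add: sum.distrib[symmetric])
      also have "\<dots> \<le> norm2 M (\<lambda>\<omega>. \<Sum>n=1..N. centered_limit (int n) \<omega> - centered_lin m' (int n) \<omega>) + \<eta> * sqrt N"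
        using norm2_add[OF s1 s2] le[OF m', of N] by linarith
      also have "norm2 M (\<lambda>\<omega>. \<Sum>n=1..N. centered_limit (int n) \<omega> - centered_lin m' (int n) \<omega>)
          \<le> (\<Sum>n=1..N. norm2 M (\<lambda>\<omega>. centered_limit (int n) \<omega> - centered_lin m' (int n) \<omega>))"
        by (intro norm2_sum square_integrable_diff square_integrable_centered_limit square_integrable_centered_lin m'k)
      also have "\<dots> \<le> ?r m'" by (intro sum_mono norm2_centered_limit_diff m'k)
      finally show ?thesis by simp
    qed
    then have "?D \<le> 0 + \<eta> * sqrt N"
      by (intro LIMSEQ_le_const[OF lim]) blast
    then show "?D \<le> \<eta> * sqrt N" by simp
  qed
qed

lemma centered_lin_window:
  obtains g where "g \<in> borel_measurable (Pi\<^sub>M {n - int m..n - 1} (\<lambda>_. borel))"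
    "\<And>\<omega>. centered_lin m n \<omega> = g (\<lambda>i\<in>{n - int m..n - 1}. \<epsilon> i \<omega>)"
proof -
  have w: "n - int j \<in> {n - int m..n - 1}" if "j \<in> {1..m}" for j using that by auto
  have eq: "lin {1..m} n \<omega> = lin_window {1..m} n (\<lambda>i\<in>{n - int m..n - 1}. \<epsilon> i \<omega>)" for \<omega>
    by (rule lin_eq_window) (rule w)
  show ?thesis
  proof (rule that[of "\<lambda>x. K (lin_window {1..m} n x) - expectation (\<lambda>\<omega>. K (lin {1..m} n \<omega>))"])
    show "(\<lambda>x. K (lin_window {1..m} n x) - expectation (\<lambda>\<omega>. K (lin {1..m} n \<omega>)))
        \<in> borel_measurable (Pi\<^sub>M {n - int m..n - 1} (\<lambda>_. borel))"
      by (intro borel_measurable_diff measurable_compose[OF measurable_lin_window measurable_K[OF K1]]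
          borel_measurable_const) (rule w)
  qed (simp only: centered_lin_def eq)
qed

lemma expectation_centered_lin: "m \<ge> k \<Longrightarrow> expectation (centered_lin m n) = 0"
  using square_integrable_integrable[OF square_integrable_comp_lin(1)[OF _ K2, of m n]]
  by (simp add: centered_lin_def[abs_def] prob_space)

lemma centered_lin_orthogonal:
  assumes m: "m \<ge> k" and lag: "l + int m \<le> n"
  shows "(\<integral>\<omega>. centered_lin m n \<omega> * centered_lin m l \<omega> \<partial>M) = 0"
proof -
  obtain f where f: "f \<in> borel_measurable (Pi\<^sub>M {n - int m..n - 1} (\<lambda>_. borel))"
    "\<And>\<omega>. centered_lin m n \<omega> = f (\<lambda>i\<in>{n - int m..n - 1}. \<epsilon> i \<omega>)" using centered_lin_window[where n=n and m=m] by blast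
  obtain g where g: "g \<in> borel_measurable (Pi\<^sub>M {l - int m..l - 1} (\<lambda>_. borel))"
    "\<And>\<omega>. centered_lin m l \<omega> = g (\<lambda>i\<in>{l - int m..l - 1}. \<epsilon> i \<omega>)" using centered_lin_window[where n=l and m=m] by blast
  have disj: "{n - int m..n - 1} \<inter> {l - int m..l - 1} = {}" using lag by auto
  have "indep_var borel (f \<circ> (\<lambda>\<omega>. \<lambda>i\<in>{n - int m..n - 1}. \<epsilon> i \<omega>)) borel (g \<circ> (\<lambda>\<omega>. \<lambda>i\<in>{l - int m..l - 1}. \<epsilon> i \<omega>))"
    by (rule indep_var_compose[OF indep_var_restrict[OF indep disj] f(1) g(1)]) auto
  then have "indep_var borel (centered_lin m n) borel (centered_lin m l)"
    by (simp add: comp_def f(2)[symmetric] g(2)[symmetric] eta_contract_eq)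
  from indep_var_lebesgue_integral[OF this] show ?thesis
    using square_integrable_integrable[OF square_integrable_centered_lin[OF m]]
    by (simp add: expectation_centered_lin[OF m])
qed

lemma norm2_centered_lin_le:
  assumes m: "m \<ge> k"
  shows "norm2 M (centered_lin m n) \<le> sqrt (C * (\<integral>x. (K x)\<^sup>2 \<partial>lborel))"
proof -
  have "norm2 M (centered_lin m n) \<le> norm2 M (\<lambda>\<omega>. K (lin {1..m} n \<omega>))"
    unfolding centered_lin_def by (rule norm2_centered[OF square_integrable_comp_lin(1)[OF m K2]])
  also have "\<dots> \<le> sqrt (C * (\<integral>x. (K x)\<^sup>2 \<partial>lborel))"
    using square_integrable_comp_lin(2)[OF m K2] by (rule real_le_rsqrt)
  finally show ?thesis .
qed

text \<open>The last \<open>m\<close> of the \<open>L\<close> summands are left out, so that different blocks use disjoint sets of innovations.\<close>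
definition block_sum :: "nat \<Rightarrow> nat \<Rightarrow> nat \<Rightarrow> 'a \<Rightarrow> real" where
  "block_sum m L b \<omega> = (\<Sum>r<L - m. centered_lin m (int (b * L + r + 1)) \<omega>)"

text \<open>
  The function that yields every block sum from the innovations at the times between \<open>b * L + 1 - m\<close> and
  \<open>b * L + L - m\<close>; it does not depend on \<open>b\<close>, so all blocks have the same law.
\<close>
definition block_window :: "nat \<Rightarrow> nat \<Rightarrow> (int \<Rightarrow> real) \<Rightarrow> real" where
  "block_window m L x = (\<Sum>r<L - m. K (lin_window {1..m} (int r + 1) x) - expectation (\<lambda>\<omega>. K (lin {1..m} 0 \<omega>)))"

lemma measurable_block_window:
  "block_window m L \<in> borel_measurable (Pi\<^sub>M {1 - int m..int L - int m} (\<lambda>_. borel))"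
proof -
  have w: "int r + 1 - int j \<in> {1 - int m..int L - int m}" if "r < L - m" "j \<in> {1..m}" for r j
    using that by auto
  show ?thesis
    unfolding block_window_def
    by (intro borel_measurable_sum borel_measurable_diff measurable_compose[OF measurable_lin_window measurable_K[OF K1]]
          borel_measurable_const) (auto intro: w)
qed

lemma expectation_K_lin_shift: "expectation (\<lambda>\<omega>. K (lin {1..m} n \<omega>)) = expectation (\<lambda>\<omega>. K (lin {1..m} 0 \<omega>))"
proof -
  let ?F = "\<lambda>x. K (\<Sum>j\<in>{1..m}. a j * x j)"
  have F: "?F \<in> borel_measurable (Pi\<^sub>M {1..m} (\<lambda>_. borel))"
    by (intro measurable_compose[OF _ measurable_K[OF K1]] borel_measurable_sum
        borel_measurable_times measurable_component_singleton borel_measurable_const) auto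
  have inj: "inj_on (\<lambda>j. n - int j) {1..m}" for n by (auto simp: inj_on_def)
  have "expectation (\<lambda>\<omega>. K (lin {1..m} n \<omega>)) = (\<integral>x. ?F x \<partial>(Pi\<^sub>M {1..m} (\<lambda>_. \<mu>)))" for n
  proof -
    have eq: "(\<Sum>j\<in>{1..m}. a j * (\<lambda>j\<in>{1..m}. \<epsilon> (n - int j) \<omega>) j) = lin {1..m} n \<omega>" for \<omega>
      unfolding lin_def by (intro sum.cong) auto
    show ?thesis unfolding integral_window[OF inj F, symmetric, of n] eq ..
  qed
  then show ?thesis by simp
qed

lemma block_sum_eq_window:
  "block_sum m L b \<omega> = block_window m L (\<lambda>i\<in>{1 - int m..int L - int m}. \<epsilon> (int (b * L) + i) \<omega>)"
  unfolding block_sum_def block_window_def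
proof (rule sum.cong[OF refl])
  fix r assume r: "r \<in> {..<L - m}"
  have "lin_window {1..m} (int r + 1) (\<lambda>i\<in>{1 - int m..int L - int m}. \<epsilon> (int (b * L) + i) \<omega>)
      = lin {1..m} (int (b * L + r + 1)) \<omega>"
    unfolding lin_window_def lin_def using r by (intro sum.cong refl) (auto simp: algebra_simps)
  then show "centered_lin m (int (b * L + r + 1)) \<omega> =
      K (lin_window {1..m} (int r + 1) (\<lambda>i\<in>{1 - int m..int L - int m}. \<epsilon> (int (b * L) + i) \<omega>))
      - expectation (\<lambda>\<omega>. K (lin {1..m} 0 \<omega>))"
    unfolding centered_lin_def expectation_K_lin_shift[of m "int (b * L + r + 1)"] by simp
qed

lemma distr_block_sum: "distr M borel (block_sum m L b) = distr M borel (block_sum m L 0)"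
proof -
  let ?J = "{1 - int m..int L - int m}"
  have inj: "inj_on (\<lambda>i. int (b * L) + i) ?J" for b by (simp add: inj_on_def)
  have "distr M borel (block_sum m L b) = distr (Pi\<^sub>M ?J (\<lambda>_. \<mu>)) borel (block_window m L)" for b
  proof -
    have eq: "block_sum m L b = (\<lambda>\<omega>. block_window m L (\<lambda>i\<in>?J. \<epsilon> (int (b * L) + i) \<omega>))"
      by (rule ext) (rule block_sum_eq_window)
    show ?thesis
      unfolding window_law[OF inj, of b, symmetric] eq
      by (simp only: distr_distr[OF measurable_block_window measurable_window] comp_def)
  qed
  then show ?thesis by simp
qed

lemma indep_block_sums: "indep_vars (\<lambda>_. borel) (block_sum m L) UNIV"
proof -
  let ?J = "{1 - int m..int L - int m}"
  let ?W = "\<lambda>b. {int (b * L) + 1 - int m..int (b * L) + int L - int m}"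
  have disj: "disjoint_family_on ?W UNIV"
    unfolding disjoint_family_on_def
  proof safe
    fix b c :: nat and x assume bc: "b \<noteq> c" and x: "x \<in> ?W b" "x \<in> ?W c"
    have "b < c \<or> c < b" using bc by auto
    moreover have "int (u * L) + int L \<le> int (v * L)" if "u < v" for u v :: nat
    proof -
      have "Suc u * L \<le> v * L" using that by (intro mult_right_mono) auto
      then have "u * L + L \<le> v * L" by simp
      then have "int (u * L + L) \<le> int (v * L)" by (simp only: of_nat_le_iff)
      then show ?thesis by (simp only: of_nat_add)
    qed
    ultimately show "x \<in> {}" using x by fastforce
  qed
  have "indep_vars (\<lambda>b. Pi\<^sub>M (?W b) (\<lambda>_. borel)) (\<lambda>b \<omega>. \<lambda>i\<in>?W b. \<epsilon> i \<omega>) UNIV"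
    by (rule indep_vars_restrict[OF indep _ disj]) auto
  then have "indep_vars (\<lambda>_. borel) (\<lambda>b \<omega>. block_window m L (\<lambda>i\<in>?J. (\<lambda>i\<in>?W b. \<epsilon> i \<omega>) (int (b * L) + i))) UNIV"
  proof (rule indep_vars_compose2)
    fix b :: nat
    have "(\<lambda>x. \<lambda>i\<in>?J. x (int (b * L) + i)) \<in> Pi\<^sub>M (?W b) (\<lambda>_. borel) \<rightarrow>\<^sub>M Pi\<^sub>M ?J (\<lambda>_. borel)"
      by (intro measurable_restrict measurable_component_singleton) auto
    then show "(\<lambda>x. block_window m L (\<lambda>i\<in>?J. x (int (b * L) + i))) \<in> borel_measurable (Pi\<^sub>M (?W b) (\<lambda>_. borel))"
      by (rule measurable_compose[OF _ measurable_block_window])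
  qed
  also have "(\<lambda>b \<omega>. block_window m L (\<lambda>i\<in>?J. (\<lambda>i\<in>?W b. \<epsilon> i \<omega>) (int (b * L) + i))) = block_sum m L"
    unfolding block_sum_eq_window fun_eq_iff
    by (intro allI arg_cong[where f="block_window m L"] restrict_ext) auto
  finally show ?thesis .
qed

text \<open>
  After truncation at \<open>m\<close>, summands at distance at least \<open>m\<close> are independent. Besides the incomplete last block,
  the sum over blocks omits \<open>m\<close> of every \<open>L\<close> summands, and the mean square of what is omitted is of the order
  \<open>m * (N * m / L)\<close>; it is a small multiple of \<open>N\<close> when \<open>L\<close> is large compared with \<open>m\<^sup>2\<close>.
\<close>
lemma block_approximation:
  assumes \<eta>: "\<eta> > 0"
  obtains B :: "nat \<Rightarrow> 'a \<Rightarrow> real" and L :: nat and c :: real where "L > 0" "indep_vars (\<lambda>_. borel) B UNIV"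
    "\<And>b. distr M borel (B b) = distr M borel (B 0)" "\<And>b. square_integrable M (B b)"
    "\<And>b. expectation (B b) = 0"
    "\<And>N. norm2 M (\<lambda>\<omega>. (\<Sum>n=1..N. centered_limit (int n) \<omega>) - (\<Sum>b<N div L. B b \<omega>)) \<le> \<eta> * sqrt N + c"
proof -
  obtain m where m: "m \<ge> k" and trunc: "\<And>N. norm2 M (\<lambda>\<omega>. \<Sum>n=1..N.
      centered_limit (int n) \<omega> - centered_lin m (int n) \<omega>) \<le> \<eta> / 2 * sqrt N"
    using truncation_error_limit[of "\<eta> / 2"] \<eta> by auto
  define s where "s = sqrt (C * (\<integral>x. (K x)\<^sup>2 \<partial>lborel))"
  have s: "s \<ge> 0" "\<And>n. norm2 M (centered_lin m n) \<le> s"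
    using norm2_centered_lin_le[OF m] C_nonneg by (auto simp: s_def)
  \<comment> \<open>\<open>s\<close> bounds the summands; \<open>L\<close> makes the gaps contribute at most \<open>\<eta> / 2 * sqrt N\<close>\<close>
  obtain L0 :: nat where L0: "(2 * s * real m * sqrt 2 / \<eta>)\<^sup>2 < real L0"
    using reals_Archimedean2 by blast
  define L where "L = max (Suc m) L0"
  have L: "L > m" "L > 0" "(2 * s * real m * sqrt 2 / \<eta>)\<^sup>2 \<le> real L" using L0 by (auto simp: L_def)
  define c where "c = s * sqrt (2 * real m * real L)"
  show ?thesis
  proof (rule that[of L "block_sum m L" c])
    show "L > 0" by fact
    show "indep_vars (\<lambda>_. borel) (block_sum m L) UNIV" by (rule indep_block_sums)
    show "distr M borel (block_sum m L b) = distr M borel (block_sum m L 0)" for b by (rule distr_block_sum)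
    show "square_integrable M (block_sum m L b)" for b
      unfolding block_sum_def by (intro square_integrable_sum square_integrable_centered_lin m)
    show "expectation (block_sum m L b) = 0" for b
      unfolding block_sum_def using square_integrable_integrable[OF square_integrable_centered_lin[OF m]]
      by (simp add: expectation_centered_lin[OF m])
  next
    fix N :: nat
    define q where "q = N div L"
    define h where "h = (\<lambda>(b, r). b * L + r + 1 :: nat)"
    \<comment> \<open>the times that belong to the blocks; \<open>R\<close> is the set of the other ones\<close>
    define U where "U = h ` ({..<q} \<times> {..<L - m})"
    have inj: "inj_on h ({..<q} \<times> {..<L - m})"
    proof (rule inj_onI)
      fix z z' assume "z \<in> {..<q} \<times> {..<L - m}" "z' \<in> {..<q} \<times> {..<L - m}" and eq: "h z = h z'"
      then have r: "snd z < L" "snd z' < L" by auto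
      have "fst z * L + snd z = fst z' * L + snd z'" using eq by (simp add: h_def case_prod_unfold)
      then have "(fst z * L + snd z) div L = (fst z' * L + snd z') div L"
        "(fst z * L + snd z) mod L = (fst z' * L + snd z') mod L" by simp_all
      then show "z = z'" using r by (simp add: prod_eq_iff)
    qed
    have qL: "q * L \<le> N" "N < q * L + L"
      using L(2) by (auto simp: q_def) (metis add.commute dividend_less_div_times mult.commute)
    have U: "U \<subseteq> {1..N}"
    proof
      fix n assume "n \<in> U"
      then obtain b r where br: "b < q" "r < L - m" "n = b * L + r + 1" by (auto simp: U_def h_def)
      have "Suc b * L \<le> q * L" using br(1) by (intro mult_right_mono) auto
      then show "n \<in> {1..N}" using br qL by auto
    qed
    have finU: "finite U" by (simp add: U_def)
    have cardU: "card U = q * (L - m)" unfolding U_def using card_image[OF inj] by simp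
    define R where "R = {1..N} - U"
    have cardR: "card R \<le> L + q * m"
    proof -
      have "card R = N - q * (L - m)" unfolding R_def using U finU cardU by (simp add: card_Diff_subset)
      moreover have "q * (L - m) + q * m = q * L" using L(1) by (simp add: distrib_left[symmetric])
      ultimately show ?thesis using qL by linarith
    qed
    have blocks: "(\<Sum>b<q. block_sum m L b \<omega>) = (\<Sum>n\<in>U. centered_lin m (int n) \<omega>)" for \<omega>
    proof -
      have "(\<Sum>n\<in>U. centered_lin m (int n) \<omega>) = (\<Sum>z\<in>{..<q} \<times> {..<L - m}. centered_lin m (int (h z)) \<omega>)"
        unfolding U_def using sum.reindex[OF inj] by simp
      also have "\<dots> = (\<Sum>b<q. block_sum m L b \<omega>)"
        unfolding block_sum_def h_def by (simp add: sum.cartesian_product case_prod_unfold)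
      finally show ?thesis ..
    qed
    have rest: "(\<Sum>n=1..N. centered_lin m (int n) \<omega>) - (\<Sum>b<q. block_sum m L b \<omega>) = (\<Sum>n\<in>R. centered_lin m (int n) \<omega>)" for \<omega>
      unfolding blocks R_def using U by (intro sum_diff[symmetric]) auto
    have "(norm2 M (\<lambda>\<omega>. \<Sum>n\<in>R. centered_lin m (int n) \<omega>))\<^sup>2 \<le> 2 * real m * real (card R) * s\<^sup>2"
    proof (rule norm2_sum_lag_orthogonal)
      fix n l :: nat assume "l + m \<le> n"
      then show "(\<integral>\<omega>. centered_lin m (int n) \<omega> * centered_lin m (int l) \<omega> \<partial>M) = 0"
        by (intro centered_lin_orthogonal m) linarith
    qed (auto simp: R_def intro: square_integrable_centered_lin m s)
    also have "\<dots> \<le> 2 * real m * (real L + real q * real m) * s\<^sup>2"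
    proof -
      have "real (card R) \<le> real (L + q * m)" using cardR by linarith
      then show ?thesis by (intro mult_right_mono mult_left_mono) auto
    qed
    finally have "norm2 M (\<lambda>\<omega>. \<Sum>n\<in>R. centered_lin m (int n) \<omega>) \<le> sqrt (2 * real m * (real L + real q * real m) * s\<^sup>2)"
      by (rule real_le_rsqrt)
    also have "\<dots> = s * sqrt (2 * real m * real L + 2 * real q * (real m)\<^sup>2)"
    proof -
      have "2 * real m * (real L + real q * real m) * s\<^sup>2 = s\<^sup>2 * (2 * real m * real L + 2 * real q * (real m)\<^sup>2)"
        by (simp add: power2_eq_square algebra_simps)
      then show ?thesis using s by (simp only: real_sqrt_mult real_sqrt_abs abs_of_nonneg)
    qed
    also have "\<dots> \<le> s * (sqrt (2 * real m * real L) + sqrt (2 * real q * (real m)\<^sup>2))"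
      by (intro mult_left_mono sqrt_add_le_add_sqrt s) auto
    also have "\<dots> = c + s * real m * sqrt 2 * sqrt q"
      by (simp add: c_def real_sqrt_mult distrib_left)
    also have "s * real m * sqrt 2 * sqrt q \<le> \<eta> / 2 * sqrt N"
    proof -
      have "2 * s * real m * sqrt 2 / \<eta> \<le> sqrt L" by (rule real_le_rsqrt[OF L(3)])
      then have "s * real m * sqrt 2 \<le> \<eta> / 2 * sqrt L" using \<eta> by (simp add: field_simps)
      then have "s * real m * sqrt 2 * sqrt q \<le> \<eta> / 2 * sqrt L * sqrt q" by (intro mult_right_mono) auto
      also have "\<dots> = \<eta> / 2 * sqrt (real (q * L))" by (simp add: real_sqrt_mult)
      also have "\<dots> \<le> \<eta> / 2 * sqrt N" using qL(1) \<eta> by (intro mult_left_mono real_sqrt_le_mono of_nat_mono) simp_all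
      finally show ?thesis .
    qed
    finally have R_le: "norm2 M (\<lambda>\<omega>. \<Sum>n\<in>R. centered_lin m (int n) \<omega>) \<le> c + \<eta> / 2 * sqrt N" by simp
    have "norm2 M (\<lambda>\<omega>. (\<Sum>n=1..N. centered_limit (int n) \<omega>) - (\<Sum>b<N div L. block_sum m L b \<omega>))
        = norm2 M (\<lambda>\<omega>. (\<Sum>n=1..N. centered_limit (int n) \<omega> - centered_lin m (int n) \<omega>) + (\<Sum>n\<in>R. centered_lin m (int n) \<omega>))"
      unfolding rest[symmetric] q_def by (simp add: sum_subtractf)
    also have "\<dots> \<le> norm2 M (\<lambda>\<omega>. \<Sum>n=1..N. centered_limit (int n) \<omega> - centered_lin m (int n) \<omega>)
        + norm2 M (\<lambda>\<omega>. \<Sum>n\<in>R. centered_lin m (int n) \<omega>)"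
      by (intro norm2_add square_integrable_sum square_integrable_diff square_integrable_centered_limit square_integrable_centered_lin m)
    also have "\<dots> \<le> \<eta> * sqrt N + c" using trunc[of N] R_le by simp
    finally show "norm2 M (\<lambda>\<omega>. (\<Sum>n=1..N. centered_limit (int n) \<omega>) - (\<Sum>b<N div L. block_sum m L b \<omega>)) \<le> \<eta> * sqrt N + c" .
  qed
qed

end

section \<open>Weak convergence of vectors\<close>

lemma expectation_eq_of_indep_same_law:
  fixes X :: "'i \<Rightarrow> 'a \<Rightarrow> real" and Y :: "'i \<Rightarrow> 'b \<Rightarrow> real" and F :: "('i \<Rightarrow> real) \<Rightarrow> real"
  assumes P: "prob_space P" and Q: "prob_space Q" and I: "I \<noteq> {}"
    and X: "prob_space.indep_vars P (\<lambda>_. borel) X I" and Y: "prob_space.indep_vars Q (\<lambda>_. borel) Y I"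
    and law: "\<And>i. i \<in> I \<Longrightarrow> distr P borel (X i) = distr Q borel (Y i)"
    and F: "F \<in> borel_measurable (Pi\<^sub>M I (\<lambda>_. borel))"
  shows "(\<integral>\<omega>. F (\<lambda>i\<in>I. X i \<omega>) \<partial>P) = (\<integral>\<omega>. F (\<lambda>i\<in>I. Y i \<omega>) \<partial>Q)"
proof -
  interpret P: prob_space P by fact
  interpret Q: prob_space Q by fact
  have Xm: "\<And>i. i \<in> I \<Longrightarrow> X i \<in> borel_measurable P" and Ym: "\<And>i. i \<in> I \<Longrightarrow> Y i \<in> borel_measurable Q"
    using X Y by (auto simp: P.indep_vars_def Q.indep_vars_def)
  have XI: "(\<lambda>\<omega>. \<lambda>i\<in>I. X i \<omega>) \<in> P \<rightarrow>\<^sub>M Pi\<^sub>M I (\<lambda>_. borel)" and YI: "(\<lambda>\<omega>. \<lambda>i\<in>I. Y i \<omega>) \<in> Q \<rightarrow>\<^sub>M Pi\<^sub>M I (\<lambda>_. borel)"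
    by (intro measurable_restrict Xm Ym; simp)+
  have "(\<integral>\<omega>. F (\<lambda>i\<in>I. X i \<omega>) \<partial>P) = (\<integral>x. F x \<partial>distr P (Pi\<^sub>M I (\<lambda>_. borel)) (\<lambda>\<omega>. \<lambda>i\<in>I. X i \<omega>))"
    by (rule integral_distr[symmetric, OF XI F])
  also have "distr P (Pi\<^sub>M I (\<lambda>_. borel)) (\<lambda>\<omega>. \<lambda>i\<in>I. X i \<omega>) = Pi\<^sub>M I (\<lambda>i. distr P borel (X i))"
    using X P.indep_vars_iff_distr_eq_PiM'[OF I Xm] by simp
  also have "\<dots> = Pi\<^sub>M I (\<lambda>i. distr Q borel (Y i))" by (rule PiM_cong) (auto simp: law)
  also have "\<dots> = distr Q (Pi\<^sub>M I (\<lambda>_. borel)) (\<lambda>\<omega>. \<lambda>i\<in>I. Y i \<omega>)"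
    using Y Q.indep_vars_iff_distr_eq_PiM'[OF I Ym] by simp
  also have "(\<integral>x. F x \<partial>\<dots>) = (\<integral>\<omega>. F (\<lambda>i\<in>I. Y i \<omega>) \<partial>Q)"
    by (rule integral_distr[OF YI F])
  finally show ?thesis .
qed

text \<open>
  Vectors of length \<open>r\<close> are embedded into the sequences, extended by 0, so that test functions of all numbers of
  variables have one type.
\<close>
definition pad :: "nat \<Rightarrow> (nat \<Rightarrow> real) \<Rightarrow> nat \<Rightarrow> real" where
  "pad r v = (\<lambda>i. if i < r then v i else 0)"

lemma tendsto_continuous_fun:
  fixes F :: "('i \<Rightarrow> real) \<Rightarrow> real"
  assumes F: "continuous_on UNIV F" and x: "\<And>i. (\<lambda>n. x n i) \<longlonglongrightarrow> y i"
  shows "(\<lambda>n. F (x n)) \<longlonglongrightarrow> F y"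
proof -
  have "limitin (product_topology (\<lambda>_. euclideanreal) UNIV) x y sequentially"
    using x by (simp add: limitin_componentwise)
  then have "limitin euclidean x y sequentially" by (simp add: euclidean_product_topology)
  moreover have "continuous_map euclidean euclidean F" using F by simp
  ultimately have "limitin euclidean (F \<circ> x) (F y) sequentially" by (intro continuous_map_limit)
  then show ?thesis by (simp add: comp_def)
qed

lemma measurable_pad:
  assumes "\<And>i. i < r \<Longrightarrow> (\<lambda>\<omega>. v \<omega> i) \<in> borel_measurable M"
  shows "(\<lambda>\<omega>. pad r (v \<omega>)) \<in> borel_measurable M"
proof (rule measurable_coordinatewise_then_product)
  fix i
  show "(\<lambda>\<omega>. pad r (v \<omega>) i) \<in> borel_measurable M"
    using assms by (cases "i < r") (simp_all add: pad_def)
qed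

lemma integral_tendsto_of_pointwise:
  fixes F :: "(nat \<Rightarrow> real) \<Rightarrow> real"
  assumes "prob_space P" and F: "continuous_on UNIV F" and B: "\<And>x. \<bar>F x\<bar> \<le> B"
    and U: "\<And>n i. i < r \<Longrightarrow> (\<lambda>\<omega>. U n \<omega> i) \<in> borel_measurable P" and V: "\<And>i. i < r \<Longrightarrow> (\<lambda>\<omega>. V \<omega> i) \<in> borel_measurable P"
    and lim: "AE \<omega> in P. \<forall>i<r. (\<lambda>n. U n \<omega> i) \<longlonglongrightarrow> V \<omega> i"
  shows "(\<lambda>n. \<integral>\<omega>. F (pad r (U n \<omega>)) \<partial>P) \<longlonglongrightarrow> (\<integral>\<omega>. F (pad r (V \<omega>)) \<partial>P)"
proof -
  interpret P: prob_space P by fact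
  have Fm: "F \<in> borel_measurable borel" using F by (rule borel_measurable_continuous_onI)
  show ?thesis
  proof (rule integral_dominated_convergence[where w="\<lambda>_. B"])
    show "(\<lambda>\<omega>. F (pad r (V \<omega>))) \<in> borel_measurable P"
      by (intro measurable_compose[OF measurable_pad Fm] V)
    show "(\<lambda>\<omega>. F (pad r (U n \<omega>))) \<in> borel_measurable P" for n
      by (intro measurable_compose[OF measurable_pad Fm] U)
    show "AE \<omega> in P. (\<lambda>n. F (pad r (U n \<omega>))) \<longlonglongrightarrow> F (pad r (V \<omega>))"
      using lim by eventually_elim (auto intro!: tendsto_continuous_fun[OF F] simp: pad_def)
  qed (use B in auto)
qed

text \<open>
  Skorohod's theorem realises the weak convergence to the normal law as pointwise convergence on some
  probability space \<open>\<Omega>\<close>. On the product of \<open>r\<close> copies of \<open>\<Omega>\<close> all increments are realised at once with the right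
  joint law, and dominated convergence finishes the proof.
\<close>
lemma expectation_tendsto_independent_increments:
  fixes F :: "(nat \<Rightarrow> real) \<Rightarrow> real" and D :: "nat \<Rightarrow> nat \<Rightarrow> 'a \<Rightarrow> real" and G :: "nat \<Rightarrow> 'b \<Rightarrow> real"
  assumes M: "prob_space M" and M': "prob_space M'" and F: "continuous_on UNIV F" and B: "\<And>x. \<bar>F x\<bar> \<le> B"
    and \<nu>: "\<And>n. real_distribution (\<nu> n)" and \<nu>_lim: "weak_conv_m \<nu> std_normal_distribution"
    and D: "\<And>N. prob_space.indep_vars M (\<lambda>_. borel) (D N) {..<r}"
    and D_law: "\<And>N l. l < r \<Longrightarrow> distr M borel (D N l) = distr (\<nu> (q N l)) borel (\<lambda>x. c N l * x)"
    and q: "\<And>l. l < r \<Longrightarrow> filterlim (\<lambda>N. q N l) at_top sequentially"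
    and c: "\<And>l. l < r \<Longrightarrow> (\<lambda>N. c N l) \<longlonglongrightarrow> \<gamma> l"
    and G: "prob_space.indep_vars M' (\<lambda>_. borel) G {..<r}"
    and G_law: "\<And>l. l < r \<Longrightarrow> distr M' borel (G l) = distr std_normal_distribution borel (\<lambda>x. \<gamma> l * x)"
  shows "(\<lambda>N. \<integral>\<omega>. F (pad r (\<lambda>l. D N l \<omega>)) \<partial>M) \<longlonglongrightarrow> (\<integral>\<omega>. F (pad r (\<lambda>l. G l \<omega>)) \<partial>M')"
proof (cases "r = 0")
  case True
  interpret M: prob_space M by fact
  interpret M': prob_space M' by fact
  show ?thesis using True by (simp add: pad_def M.prob_space M'.prob_space)
next
  case False
  then have I: "{..<r} \<noteq> {}" by auto
  obtain \<Omega> :: "real measure" and Ys Y where \<Omega>: "prob_space \<Omega>" and Ys: "\<forall>n. Ys n \<in> measurable \<Omega> borel"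
      and Ys_law: "\<forall>n. distr \<Omega> borel (Ys n) = \<nu> n" and Y: "Y \<in> measurable \<Omega> lborel"
      and Y_law: "distr \<Omega> borel Y = std_normal_distribution"
      and conv: "\<forall>x\<in>space \<Omega>. (\<lambda>n. Ys n x) \<longlonglongrightarrow> Y x"
    using Skorohod[OF \<nu> real_dist_normal_dist \<nu>_lim] by blast
  have Ysm[measurable]: "Ys n \<in> borel_measurable \<Omega>" for n using Ys by simp
  have Ym[measurable]: "Y \<in> borel_measurable \<Omega>" using Y by simp
  let ?P = "Pi\<^sub>M {..<r} (\<lambda>_. \<Omega>)"
  interpret P: prob_space ?P using \<Omega> by (intro prob_space_PiM)
  have coord: "P.indep_vars (\<lambda>_. \<Omega>) (\<lambda>i x. x i) {..<r}"
    using indep_vars_PiM_coordinates[OF I, of "\<lambda>_. \<Omega>"] \<Omega> by simp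
  have comp: "P.indep_vars (\<lambda>_. borel) (\<lambda>l x. c l * Z l (x l)) {..<r}"
    if "\<And>l. Z l \<in> borel_measurable \<Omega>" for c and Z :: "nat \<Rightarrow> real \<Rightarrow> real"
    using that by (intro P.indep_vars_compose2[OF coord]) simp
  have claw: "distr ?P borel (\<lambda>x. c * Z (x l)) = distr (distr \<Omega> borel Z) borel (\<lambda>x. c * x)"
    if l: "l < r" and Z[measurable]: "Z \<in> borel_measurable \<Omega>" for l c and Z :: "real \<Rightarrow> real"
  proof -
    have "distr (distr \<Omega> borel Z) borel (\<lambda>x. c * x) = distr \<Omega> borel (\<lambda>x. c * Z x)"
      by (subst distr_distr) (auto simp: comp_def)
    also have "\<dots> = distr (distr ?P \<Omega> (\<lambda>x. x l)) borel (\<lambda>x. c * Z x)"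
      using \<Omega> l by (subst distr_PiM_component) auto
    also have "\<dots> = distr ?P borel (\<lambda>x. c * Z (x l))"
      using l by (subst distr_distr) (auto simp: comp_def)
    finally show ?thesis ..
  qed
  have Fm: "F \<in> borel_measurable borel" using F by (rule borel_measurable_continuous_onI)
  have Fpad: "(\<lambda>x. F (pad r x)) \<in> borel_measurable (Pi\<^sub>M {..<r} (\<lambda>_. borel))"
    by (rule measurable_compose[OF measurable_pad Fm]) auto
  have padr: "pad r (\<lambda>i\<in>{..<r}. v i) = pad r v" for v by (auto simp: pad_def)
  have eqD: "(\<integral>\<omega>. F (pad r (\<lambda>l. D N l \<omega>)) \<partial>M) = (\<integral>x. F (pad r (\<lambda>l. c N l * Ys (q N l) (x l))) \<partial>?P)" for N
    using expectation_eq_of_indep_same_law[OF M P.prob_space_axioms I D[of N] comp[of "\<lambda>l. Ys (q N l)" "c N"] _ Fpad]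
      claw D_law Ys_law by (simp add: padr)
  have eqG: "(\<integral>\<omega>. F (pad r (\<lambda>l. G l \<omega>)) \<partial>M') = (\<integral>x. F (pad r (\<lambda>l. \<gamma> l * Y (x l))) \<partial>?P)"
    using expectation_eq_of_indep_same_law[OF M' P.prob_space_axioms I G comp[of "\<lambda>l. Y" "\<gamma>"] _ Fpad]
      claw G_law Y_law by (simp add: padr)
  show ?thesis
    unfolding eqD eqG
  proof (rule integral_tendsto_of_pointwise[OF P.prob_space_axioms F B])
    show "AE x in ?P. \<forall>i<r. (\<lambda>n. c n i * Ys (q n i) (x i)) \<longlonglongrightarrow> \<gamma> i * Y (x i)"
    proof (rule AE_I2, safe)
      fix x i assume x: "x \<in> space ?P" and i: "i < r"
      then have "x i \<in> space \<Omega>" by (auto simp: space_PiM PiE_iff)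
      then have "(\<lambda>n. Ys n (x i)) \<longlonglongrightarrow> Y (x i)" using conv by simp
      from filterlim_compose[OF this q[OF i]] show "(\<lambda>n. c n i * Ys (q n i) (x i)) \<longlonglongrightarrow> \<gamma> i * Y (x i)"
        by (intro tendsto_mult c i)
    qed
  qed auto
qed

text \<open>The sequences bounded by \<open>R + 1\<close> form a compact set, by Tychonoff's theorem.\<close>
lemma uniformly_continuous_bounded_sequences:
  fixes h :: "(nat \<Rightarrow> real) \<Rightarrow> real"
  assumes h: "continuous_on UNIV h" and e: "e > 0"
  obtains d where "0 < d" "\<And>x y. (\<And>i. \<bar>x i\<bar> \<le> R) \<Longrightarrow> (\<And>i. \<bar>x i - y i\<bar> \<le> d) \<Longrightarrow> \<bar>h x - h y\<bar> \<le> e"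
proof -
  let ?S = "Pi\<^sub>E UNIV (\<lambda>_::nat. {-(R + 1)..R + 1})"
  have "compactin (product_topology (\<lambda>_. euclideanreal) UNIV) ?S"
    by (subst compactin_PiE) auto
  then have "compact ?S" by (simp add: euclidean_product_topology)
  then have "uniformly_continuous_on ?S h"
    by (intro compact_uniformly_continuous continuous_on_subset[OF h]) auto
  then obtain d0 where d0: "d0 > 0" "\<And>x y. x \<in> ?S \<Longrightarrow> y \<in> ?S \<Longrightarrow> dist x y < d0 \<Longrightarrow> dist (h x) (h y) < e"
    unfolding uniformly_continuous_on_def using e by metis
  define d where "d = min 1 (d0 / 4)"
  have d: "d > 0" "d \<le> 1" "2 * d < d0" using d0(1) by (auto simp: d_def)
  show ?thesis
  proof (rule that[OF d(1)])
    fix x y :: "nat \<Rightarrow> real" assume x: "\<And>i. \<bar>x i\<bar> \<le> R" and xy: "\<And>i. \<bar>x i - y i\<bar> \<le> d"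
    have y: "\<bar>y i\<bar> \<le> R + 1" for i using x[of i] xy[of i] d(2) by linarith
    have in_S: "z \<in> ?S" if "\<And>i. \<bar>z i\<bar> \<le> R + 1" for z
    proof -
      have "- (R + 1) \<le> z i" "z i \<le> R + 1" for i using that[of i] by linarith+
      then show ?thesis by (auto simp: PiE_iff)
    qed
    have "\<bar>x i\<bar> \<le> R + 1" for i using x[of i] by linarith
    then have "x \<in> ?S" "y \<in> ?S" using y by (intro in_S; simp)+
    moreover have "dist x y \<le> 2 * d"
    proof -
      have "dist x y \<le> (\<Sum>n. (1/2)^n * d)"
        unfolding dist_fun_def
      proof (rule suminf_le)
        show "(1/2)^n * min (dist (x (from_nat n)) (y (from_nat n))) 1 \<le> (1/2)^n * d" for n
          using xy by (intro mult_left_mono) (auto simp: dist_real_def min_le_iff_disj)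
        show "summable (\<lambda>n. (1/2)^n * d)" by (intro summable_mult2) simp
        show "summable (\<lambda>n. (1/2)^n * min (dist (x (from_nat n)) (y (from_nat n))) 1)"
          by (rule summable_comparison_test'[of "\<lambda>n. (1/2)^n"]) auto
      qed
      also have "\<dots> = 2 * d" using suminf_geometric[of "1/2 :: real"] by (subst suminf_mult2[symmetric]) auto
      finally show ?thesis .
    qed
    ultimately have "dist (h x) (h y) < e" using d by (intro d0) auto
    then show "\<bar>h x - h y\<bar> \<le> e" by (simp add: dist_real_def)
  qed
qed

text \<open>
  Where all \<open>V i\<close> are bounded by \<open>R\<close> and within \<open>d\<close> of \<open>V' i\<close>, the values of \<open>h\<close> differ by at most \<open>e\<close>; the
  probability of the exceptional set is estimated by Chebyshev's inequality.
\<close>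
lemma (in prob_space) expectation_close_of_norm2_close:
  fixes h :: "(nat \<Rightarrow> real) \<Rightarrow> real" and V V' :: "nat \<Rightarrow> 'a \<Rightarrow> real"
  assumes h: "continuous_on UNIV h" and B: "\<And>x. \<bar>h x\<bar> \<le> B" and R: "R > 0" and d: "d > 0" and e: "e \<ge> 0"
    and uc: "\<And>x y. (\<And>i. \<bar>x i\<bar> \<le> R) \<Longrightarrow> (\<And>i. \<bar>x i - y i\<bar> \<le> d) \<Longrightarrow> \<bar>h x - h y\<bar> \<le> e"
    and V: "\<And>i. i < r \<Longrightarrow> square_integrable M (V i)" and V': "\<And>i. i < r \<Longrightarrow> square_integrable M (V' i)"
  shows "\<bar>(\<integral>\<omega>. h (pad r (\<lambda>i. V i \<omega>)) \<partial>M) - (\<integral>\<omega>. h (pad r (\<lambda>i. V' i \<omega>)) \<partial>M)\<bar>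
    \<le> e + 2 * B * (\<Sum>i<r. (norm2 M (V i))\<^sup>2 / R\<^sup>2 + (norm2 M (\<lambda>\<omega>. V i \<omega> - V' i \<omega>))\<^sup>2 / d\<^sup>2)"
proof -
  have hm: "h \<in> borel_measurable borel" using h by (rule borel_measurable_continuous_onI)
  have B0: "0 \<le> B" using B[of undefined] by linarith
  have hV: "integrable M (\<lambda>\<omega>. h (pad r (\<lambda>i. V i \<omega>)))" "integrable M (\<lambda>\<omega>. h (pad r (\<lambda>i. V' i \<omega>)))"
  proof -
    have "integrable M (\<lambda>\<omega>. h (pad r (\<lambda>i. W i \<omega>)))" if "\<And>i. i < r \<Longrightarrow> square_integrable M (W i)" for W
    proof (rule integrable_const_bound[where B=B])
      show "(\<lambda>\<omega>. h (pad r (\<lambda>i. W i \<omega>))) \<in> borel_measurable M"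
        by (intro measurable_compose[OF measurable_pad hm] square_integrable_measurable that)
    qed (use B in auto)
    note * = this
    show "integrable M (\<lambda>\<omega>. h (pad r (\<lambda>i. V i \<omega>)))" by (rule *) (rule V)
    show "integrable M (\<lambda>\<omega>. h (pad r (\<lambda>i. V' i \<omega>)))" by (rule *) (rule V')
  qed
  let ?g = "\<lambda>\<omega>. \<Sum>i<r. (V i \<omega>)\<^sup>2 / R\<^sup>2 + (V i \<omega> - V' i \<omega>)\<^sup>2 / d\<^sup>2"
  have sqi: "i < r \<Longrightarrow> integrable M (\<lambda>\<omega>. (V i \<omega>)\<^sup>2)" "i < r \<Longrightarrow> integrable M (\<lambda>\<omega>. (V i \<omega> - V' i \<omega>)\<^sup>2)" for i
    using V[of i] square_integrable_diff[OF V[of i] V'[of i]] by (auto simp: square_integrable_def)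
  have gi: "integrable M ?g" using sqi by (intro Bochner_Integration.integrable_sum Bochner_Integration.integrable_add integrable_divide) auto
  have pt: "\<bar>h (pad r (\<lambda>i. V i \<omega>)) - h (pad r (\<lambda>i. V' i \<omega>))\<bar> \<le> e + 2 * B * ?g \<omega>" for \<omega>
  proof (cases "(\<forall>i<r. \<bar>V i \<omega>\<bar> \<le> R) \<and> (\<forall>i<r. \<bar>V i \<omega> - V' i \<omega>\<bar> \<le> d)")
    case True
    have "\<bar>h (pad r (\<lambda>i. V i \<omega>)) - h (pad r (\<lambda>i. V' i \<omega>))\<bar> \<le> e"
      using True R d by (intro uc) (auto simp: pad_def)
    moreover have "0 \<le> 2 * B * ?g \<omega>" using B0 by (intro mult_nonneg_nonneg sum_nonneg) auto
    ultimately show ?thesis by linarith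
  next
    case False
    then obtain i where i: "i < r" and "\<bar>V i \<omega>\<bar> > R \<or> \<bar>V i \<omega> - V' i \<omega>\<bar> > d" by (auto simp: not_le)
    then have "1 \<le> (V i \<omega>)\<^sup>2 / R\<^sup>2 \<or> 1 \<le> (V i \<omega> - V' i \<omega>)\<^sup>2 / d\<^sup>2"
      using R d by (auto simp: le_divide_eq abs_le_square_iff[symmetric])
    then have "1 \<le> (V i \<omega>)\<^sup>2 / R\<^sup>2 + (V i \<omega> - V' i \<omega>)\<^sup>2 / d\<^sup>2"
      by (smt (verit) divide_nonneg_nonneg zero_le_power2)
    also have "\<dots> \<le> ?g \<omega>" using i by (intro member_le_sum) auto
    finally have "2 * B * 1 \<le> 2 * B * ?g \<omega>" using B0 by (intro mult_left_mono) auto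
    moreover have "\<bar>h (pad r (\<lambda>i. V i \<omega>)) - h (pad r (\<lambda>i. V' i \<omega>))\<bar> \<le> 2 * B"
      using B[of "pad r (\<lambda>i. V i \<omega>)"] B[of "pad r (\<lambda>i. V' i \<omega>)"] by linarith
    ultimately show ?thesis using e by linarith
  qed
  have "\<bar>(\<integral>\<omega>. h (pad r (\<lambda>i. V i \<omega>)) \<partial>M) - (\<integral>\<omega>. h (pad r (\<lambda>i. V' i \<omega>)) \<partial>M)\<bar>
      = \<bar>\<integral>\<omega>. h (pad r (\<lambda>i. V i \<omega>)) - h (pad r (\<lambda>i. V' i \<omega>)) \<partial>M\<bar>" using hV by simp
  also have "\<dots> \<le> (\<integral>\<omega>. e + 2 * B * ?g \<omega> \<partial>M)"
  proof -
    have "\<bar>\<integral>\<omega>. h (pad r (\<lambda>i. V i \<omega>)) - h (pad r (\<lambda>i. V' i \<omega>)) \<partial>M\<bar>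
        \<le> (\<integral>\<omega>. \<bar>h (pad r (\<lambda>i. V i \<omega>)) - h (pad r (\<lambda>i. V' i \<omega>))\<bar> \<partial>M)"
      using integral_norm_bound[of M "\<lambda>\<omega>. h (pad r (\<lambda>i. V i \<omega>)) - h (pad r (\<lambda>i. V' i \<omega>))"] by simp
    also have "\<dots> \<le> (\<integral>\<omega>. e + 2 * B * ?g \<omega> \<partial>M)"
      using hV gi pt by (intro integral_mono) auto
    finally show ?thesis .
  qed
  also have "\<dots> = e + 2 * B * (\<integral>\<omega>. ?g \<omega> \<partial>M)" using gi by (simp add: prob_space)
  also have "(\<integral>\<omega>. ?g \<omega> \<partial>M) = (\<Sum>i<r. (norm2 M (V i))\<^sup>2 / R\<^sup>2 + (norm2 M (\<lambda>\<omega>. V i \<omega> - V' i \<omega>))\<^sup>2 / d\<^sup>2)"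
    unfolding norm2_squared using sqi by (subst Bochner_Integration.integral_sum) auto
  finally show ?thesis .
qed

section \<open>Random walks and Brownian motion\<close>

lemma block_count_asymptotics:
  fixes L :: nat and s :: real
  assumes L: "L > 0" and s: "s \<ge> 0"
  shows "(\<lambda>N. real (nat \<lfloor>real N * s\<rfloor> div L) / real N) \<longlonglongrightarrow> s / L"
proof (rule tendsto_sandwich)
  have low: "s / L - (1 / L + 1) / real N \<le> real (nat \<lfloor>real N * s\<rfloor> div L) / real N"
    and up: "real (nat \<lfloor>real N * s\<rfloor> div L) / real N \<le> s / L" if N: "N > 0" for N
  proof -
    define n where "n = nat \<lfloor>real N * s\<rfloor>"
    have "0 \<le> real N * s" using s by simp
    then have n: "real N * s - 1 \<le> real n" "real n \<le> real N * s" by (auto simp: n_def)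
    have "real n = real L * real (n div L) + real (n mod L)"
      by (metis mult_div_mod_eq of_nat_add of_nat_mult)
    moreover have "real (n mod L) < real L" using L by simp
    ultimately have d: "real n - real L \<le> real L * real (n div L)" "real L * real (n div L) \<le> real n" by linarith+
    have "real L * real (n div L) \<le> real N * s" using d n by linarith
    then show "real (nat \<lfloor>real N * s\<rfloor> div L) / real N \<le> s / L"
      unfolding n_def[symmetric] using L N by (simp add: field_simps)
    have "real N * s - 1 - real L \<le> real L * real (n div L)" using d n by linarith
    then show "s / L - (1 / L + 1) / real N \<le> real (nat \<lfloor>real N * s\<rfloor> div L) / real N"
    proof -
      assume "real N * s - 1 - real L \<le> real L * real (n div L)"
      then have "(real N * s - 1 - real L) / (real L * real N) \<le> real L * real (n div L) / (real L * real N)"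
        by (rule divide_right_mono) simp
      moreover have "(real N * s - 1 - real L) / (real L * real N) = s / L - (1 / L + 1) / real N"
        using L N by (simp add: field_simps)
      moreover have "real L * real (n div L) / (real L * real N) = real (n div L) / real N"
        using L by simp
      ultimately show ?thesis by (simp only: n_def)
    qed
  qed
  show "\<forall>\<^sub>F N in sequentially. s / L - (1 / L + 1) / real N \<le> real (nat \<lfloor>real N * s\<rfloor> div L) / real N"
    using eventually_gt_at_top[of 0] by eventually_elim (rule low)
  show "\<forall>\<^sub>F N in sequentially. real (nat \<lfloor>real N * s\<rfloor> div L) / real N \<le> s / L"
    using eventually_gt_at_top[of 0] by eventually_elim (rule up)
  have "(\<lambda>N. s / L - (1 / L + 1) / real N) \<longlonglongrightarrow> s / L - 0"
    by (intro tendsto_diff tendsto_const lim_const_over_n)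
  then show "(\<lambda>N. s / L - (1 / L + 1) / real N) \<longlonglongrightarrow> s / L" by simp
qed simp

lemma standard_brownian_motionD:
  assumes "standard_brownian_motion M W"
  shows "prob_space M" and "\<And>t. 0 \<le> t \<Longrightarrow> W t \<in> borel_measurable M" and "AE \<omega> in M. W 0 \<omega> = 0"
    and "\<And>s t. 0 \<le> s \<Longrightarrow> s < t \<Longrightarrow>
      distributed M lborel (\<lambda>\<omega>. W t \<omega> - W s \<omega>) (normal_density 0 (sqrt (t - s)))"
    and "\<And>n t. 0 \<le> t 0 \<Longrightarrow> (\<And>i. i < n \<Longrightarrow> t i < t (Suc i)) \<Longrightarrow>
      prob_space.indep_vars M (\<lambda>_. borel) (\<lambda>i \<omega>. W (t (Suc i)) \<omega> - W (t i) \<omega>) {..<n :: nat}"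
  using assms unfolding standard_brownian_motion_def by blast+

lemma brownian_increment_law:
  assumes W: "standard_brownian_motion M W" and st: "0 \<le> s" "s < t"
  shows "distr M borel (\<lambda>\<omega>. c * (W t \<omega> - W s \<omega>)) = distr std_normal_distribution borel (\<lambda>x. c * sqrt (t - s) * x)"
proof -
  interpret prob_space M by (rule standard_brownian_motionD(1)[OF W])
  have [measurable]: "W t \<in> borel_measurable M" "W s \<in> borel_measurable M"
    using st by (auto intro!: standard_brownian_motionD(2)[OF W])
  have sd: "0 < sqrt (t - s)" using st by simp
  have "distributed M lborel (\<lambda>\<omega>. W t \<omega> - W s \<omega>) (normal_density 0 (sqrt (t - s)))"
    by (rule standard_brownian_motionD(4)[OF W st])
  then have "distributed M lborel (\<lambda>\<omega>. ((W t \<omega> - W s \<omega>) - 0) / sqrt (t - s)) std_normal_density"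
    using normal_standard_normal_convert[OF sd, of "\<lambda>\<omega>. W t \<omega> - W s \<omega>" 0] by simp
  then have "distr M lborel (\<lambda>\<omega>. (W t \<omega> - W s \<omega>) / sqrt (t - s)) = std_normal_distribution"
    by (simp add: distributed_def)
  moreover have "distr M lborel (\<lambda>\<omega>. (W t \<omega> - W s \<omega>) / sqrt (t - s)) = distr M borel (\<lambda>\<omega>. (W t \<omega> - W s \<omega>) / sqrt (t - s))"
    by (rule distr_cong) auto
  ultimately have "distr std_normal_distribution borel (\<lambda>x. c * sqrt (t - s) * x)
      = distr (distr M borel (\<lambda>\<omega>. (W t \<omega> - W s \<omega>) / sqrt (t - s))) borel (\<lambda>x. c * sqrt (t - s) * x)" by simp
  also have "\<dots> = distr M borel (\<lambda>\<omega>. c * sqrt (t - s) * ((W t \<omega> - W s \<omega>) / sqrt (t - s)))"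
    by (subst distr_distr) (auto simp: comp_def)
  also have "\<dots> = distr M borel (\<lambda>\<omega>. c * (W t \<omega> - W s \<omega>))" using sd by simp
  finally show ?thesis ..
qed

lemma sum_telescope_block:
  fixes g :: "nat \<Rightarrow> real" and Q :: "nat \<Rightarrow> nat"
  assumes "\<And>l. l \<le> i \<Longrightarrow> Q l \<le> Q (Suc l)" "Q 0 = 0"
  shows "(\<Sum>l\<le>i. \<Sum>b\<in>{Q l..<Q (Suc l)}. g b) = (\<Sum>b<Q (Suc i). g b)"
  using assms
proof (induction i)
  case (Suc i)
  have "(\<Sum>b<Q (Suc i). g b) + (\<Sum>b\<in>{Q (Suc i)..<Q (Suc (Suc i))}. g b) = (\<Sum>b<Q (Suc (Suc i)). g b)"
    using Suc.prems(1)[of "Suc i"] by (simp add: sum.atLeastLessThan_concat flip: atLeast0LessThan)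
  then show ?case using Suc by simp
qed (simp add: atLeast0LessThan)

context prob_space
begin

context
  fixes B :: "nat \<Rightarrow> 'a \<Rightarrow> real"
  assumes B: "indep_vars (\<lambda>_. borel) B UNIV"
    and B_law: "\<And>b. distr M borel (B b) = distr M borel (B 0)"
    and B_sq: "\<And>b. square_integrable M (B b)"
    and B_mean: "\<And>b. expectation (B b) = 0"
begin

lemma measurable_iid: "B b \<in> borel_measurable M"
  using B_sq by (rule square_integrable_measurable)

lemma norm2_iid: "norm2 M (B b) = norm2 M (B 0)"
proof -
  note measurable_iid[measurable]
  have "(\<integral>\<omega>. (B b \<omega>)\<^sup>2 \<partial>M) = (\<integral>x. x\<^sup>2 \<partial>distr M borel (B b))" for b
    by (subst integral_distr) auto
  then show ?thesis unfolding norm2_def by (simp only: B_law[of b])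
qed

lemma iid_block_sum_law:
  assumes [measurable]: "\<phi> \<in> borel_measurable borel"
  shows "distr M borel (\<lambda>\<omega>. \<phi> (\<Sum>b\<in>{a..<a'}. B b \<omega>)) = distr M borel (\<lambda>\<omega>. \<phi> (\<Sum>b<a' - a. B b \<omega>))"
proof -
  note measurable_iid[measurable]
  let ?J = "{..<a' - a}"
  have "distr M borel (\<lambda>\<omega>. \<phi> (\<Sum>j\<in>?J. B (c + j) \<omega>))
      = distr (Pi\<^sub>M ?J (\<lambda>_. distr M borel (B 0))) borel (\<lambda>x. \<phi> (\<Sum>j\<in>?J. x j))" for c
  proof -
    have inj: "inj_on (\<lambda>j. c + j) ?J" by (simp add: inj_on_def)
    have m: "(\<lambda>x. \<phi> (\<Sum>j\<in>?J. x j)) \<in> borel_measurable (Pi\<^sub>M ?J (\<lambda>_. borel))" by measurable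
    have w: "(\<lambda>\<omega>. \<lambda>j\<in>?J. B (c + j) \<omega>) \<in> M \<rightarrow>\<^sub>M Pi\<^sub>M ?J (\<lambda>_. borel)" by (intro measurable_restrict) simp
    show ?thesis
      unfolding iid_window_law[OF B B_law inj, symmetric] distr_distr[OF m w] comp_def by simp
  qed
  from this[of a] this[of 0] have "distr M borel (\<lambda>\<omega>. \<phi> (\<Sum>j\<in>?J. B (a + j) \<omega>)) = distr M borel (\<lambda>\<omega>. \<phi> (\<Sum>b<a' - a. B b \<omega>))"
    by simp
  moreover have "(\<Sum>b\<in>{a..<a'}. B b \<omega>) = (\<Sum>j\<in>?J. B (a + j) \<omega>)" for \<omega>
    by (rule sum.reindex_bij_witness[of _ "\<lambda>j. a + j" "\<lambda>b. b - a"]) auto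
  ultimately show ?thesis by simp
qed

lemma iid_sum_norm2: "(norm2 M (\<lambda>\<omega>. \<Sum>b<q. B b \<omega>))\<^sup>2 = real q * (norm2 M (B 0))\<^sup>2"
proof (induction q)
  case (Suc q)
  let ?S = "\<lambda>\<omega>. \<Sum>b<q. B b \<omega>"
  have S: "square_integrable M ?S" by (intro square_integrable_sum B_sq)
  have ind: "indep_var borel (B q) borel ?S"
    by (rule indep_vars_sum) (auto intro: indep_vars_subset[OF B])
  have "(\<integral>\<omega>. B q \<omega> * ?S \<omega> \<partial>M) = 0"
    using indep_var_lebesgue_integral[OF ind] square_integrable_integrable[OF B_sq]
      square_integrable_integrable[OF S] by (simp add: B_mean)
  moreover have "(norm2 M (\<lambda>\<omega>. ?S \<omega> + B q \<omega>))\<^sup>2 = (\<integral>\<omega>. (?S \<omega>)\<^sup>2 + (B q \<omega>)\<^sup>2 + 2 * (B q \<omega> * ?S \<omega>) \<partial>M)"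
    unfolding norm2_squared by (simp add: power2_sum mult_ac)
  ultimately have "(norm2 M (\<lambda>\<omega>. ?S \<omega> + B q \<omega>))\<^sup>2 = (norm2 M ?S)\<^sup>2 + (norm2 M (B q))\<^sup>2"
    unfolding norm2_squared using S B_sq[of q] square_integrable_mult[OF B_sq[of q] S]
    by (simp add: square_integrable_def)
  then show ?case using Suc norm2_iid[of q] by (simp add: distrib_right)
qed simp

text \<open>
  The increments of the random walk between consecutive times are sums over disjoint blocks of indices, hence
  independent, and each of them is asymptotically normal by the central limit theorem. Their joint limit is that of
  the increments of Brownian motion; the values at the times \<open>t i\<close> are partial sums of increments.
\<close>
lemma random_walk_fdd:
  fixes h :: "(nat \<Rightarrow> real) \<Rightarrow> real" and t :: "nat \<Rightarrow> real" and L :: nat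
  assumes L: "L > 0" and t0: "t 0 = 0" and t: "\<And>i. i < r \<Longrightarrow> t i < t (Suc i)"
    and h: "continuous_on UNIV h" and hB: "\<And>x. \<bar>h x\<bar> \<le> Bd"
    and W: "standard_brownian_motion M' W"
  shows "(\<lambda>N. \<integral>\<omega>. h (pad r (\<lambda>i. (\<Sum>b<nat \<lfloor>real N * t (Suc i)\<rfloor> div L. B b \<omega>) / sqrt (real N))) \<partial>M)
    \<longlonglongrightarrow> (\<integral>\<omega>. h (pad r (\<lambda>i. norm2 M (B 0) / sqrt (real L) * W (t (Suc i)) \<omega>)) \<partial>M')"
proof (cases "norm2 M (B 0) = 0")
  case True
  note measurable_iid[measurable]
  interpret M': prob_space M' by (rule standard_brownian_motionD(1)[OF W])
  have "AE \<omega> in M. B b \<omega> = 0" for b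
  proof -
    have "norm2 M (B b) = 0" by (rule trans[OF norm2_iid True])
    then have "(\<integral>\<omega>. (B b \<omega>)\<^sup>2 \<partial>M) = 0" unfolding norm2_squared[symmetric] by (simp only: power_zero_numeral)
    then have "AE \<omega> in M. (B b \<omega>)\<^sup>2 = 0"
      using integral_nonneg_eq_0_iff_AE[of M "\<lambda>\<omega>. (B b \<omega>)\<^sup>2"] B_sq[of b] by (simp add: square_integrable_def)
    then show ?thesis by simp
  qed
  then have "AE \<omega> in M. \<forall>b. B b \<omega> = 0" by (simp add: AE_all_countable)
  then have AE: "AE \<omega> in M. h (pad r (\<lambda>i. (\<Sum>b<nat \<lfloor>real N * t (Suc i)\<rfloor> div L. B b \<omega>) / sqrt (real N))) = h (pad r (\<lambda>_. 0))" for N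
    by eventually_elim simp
  have hm: "h \<in> borel_measurable borel" using h by (rule borel_measurable_continuous_onI)
  have "(\<integral>\<omega>. h (pad r (\<lambda>i. (\<Sum>b<nat \<lfloor>real N * t (Suc i)\<rfloor> div L. B b \<omega>) / sqrt (real N))) \<partial>M)
      = (\<integral>\<omega>. h (pad r (\<lambda>_. 0)) \<partial>M)" for N
    by (rule integral_cong_AE[OF _ _ AE]) (auto intro!: measurable_compose[OF measurable_pad hm])
  then show ?thesis using True by (simp add: prob_space M'.prob_space)
next
  case False
  note measurable_iid[measurable]
  define \<sigma> where "\<sigma> = norm2 M (B 0)"
  have \<sigma>: "\<sigma> > 0" using False norm2_nonneg[of M "B 0"] unfolding \<sigma>_def by linarith
  interpret M': prob_space M' by (rule standard_brownian_motionD(1)[OF W])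
  have t_nonneg: "0 \<le> t i" if "i \<le> r" for i
    using that
  proof (induction i)
    case (Suc i)
    then show ?case using t[of i] by simp
  qed (simp add: t0)
  \<comment> \<open>\<open>Q N i\<close> is the number of steps up to time \<open>t i\<close>, \<open>D N l\<close> and \<open>G l\<close> are the increments before and after the limit\<close>
  define Q where "Q N i = nat \<lfloor>real N * t i\<rfloor> div L" for N i
  have Q0: "Q N 0 = 0" for N by (simp add: Q_def t0)
  have Q_mono: "Q N i \<le> Q N (Suc i)" if "i < r" for N i
    unfolding Q_def using t[OF that] by (intro div_le_mono nat_mono floor_mono mult_left_mono) auto
  have Q_mono': "Q N i \<le> Q N j" if "i \<le> j" "j \<le> r" for N i j
    using that
  proof (induction j rule: dec_induct)
    case (step j)
    then show ?case using Q_mono[of j N] by simp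
  qed simp
  define q where "q N l = Q N (Suc l) - Q N l" for N l
  define c where "c N l = sqrt (real (q N l) * \<sigma>\<^sup>2 / real N)" for N l
  define \<gamma> where "\<gamma> l = \<sigma> / sqrt (real L) * sqrt (t (Suc l) - t l)" for l
  define D where "D N l \<omega> = (\<Sum>b\<in>{Q N l..<Q N (Suc l)}. B b \<omega>) / sqrt (real N)" for N l \<omega>
  define G where "G l \<omega> = \<sigma> / sqrt (real L) * (W (t (Suc l)) \<omega> - W (t l) \<omega>)" for l \<omega>
  define \<nu> where "\<nu> n = distr M borel (\<lambda>x. (\<Sum>i<n. B i x) / sqrt (real n * \<sigma>\<^sup>2))" for n
  define F where "F x = h (pad r (\<lambda>i. \<Sum>l\<le>i. x l))" for x
  have qN: "(\<lambda>N. real (q N l) / real N) \<longlonglongrightarrow> (t (Suc l) - t l) / L" if l: "l < r" for l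
  proof -
    have "(\<lambda>N. real (Q N (Suc l)) / real N - real (Q N l) / real N) \<longlonglongrightarrow> t (Suc l) / L - t l / L"
      unfolding Q_def using l by (intro tendsto_diff block_count_asymptotics L t_nonneg) auto
    moreover have "real (Q N (Suc l)) / real N - real (Q N l) / real N = real (q N l) / real N" for N
      using Q_mono[OF l, of N] by (simp add: q_def of_nat_diff diff_divide_distrib)
    ultimately show ?thesis by (simp add: diff_divide_distrib)
  qed
  have conv: "(\<lambda>N. \<integral>\<omega>. F (pad r (\<lambda>l. D N l \<omega>)) \<partial>M) \<longlonglongrightarrow> (\<integral>\<omega>. F (pad r (\<lambda>l. G l \<omega>)) \<partial>M')"
  proof (rule expectation_tendsto_independent_increments[where \<nu>=\<nu> and q=q and c=c and \<gamma>=\<gamma>])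
    show "prob_space M" "prob_space M'" by unfold_locales
    have "continuous_on UNIV (\<lambda>x. pad r (\<lambda>i. \<Sum>l\<le>i. x l))"
    proof (rule continuous_on_coordinatewise_then_product)
      fix i
      show "continuous_on UNIV (\<lambda>x. pad r (\<lambda>i. \<Sum>l\<le>i. x l) i)"
        unfolding pad_def by (cases "i < r") (auto intro!: continuous_intros)
    qed
    then show "continuous_on UNIV F"
      unfolding F_def by (rule continuous_on_compose2[OF h]) auto
    show "\<bar>F x\<bar> \<le> Bd" for x unfolding F_def by (rule hB)
    show "real_distribution (\<nu> n)" for n unfolding \<nu>_def by (rule real_distribution_distr) simp
    show "weak_conv_m \<nu> std_normal_distribution"
      unfolding \<nu>_def[abs_def]
    proof (rule central_limit_theorem_zero_mean[OF B B_mean \<sigma> _ _ B_law])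
      show "integrable M (\<lambda>x. (B n x)\<^sup>2)" for n using B_sq[of n] by (simp add: square_integrable_def)
      show "variance (B n) = \<sigma>\<^sup>2" for n
        using norm2_iid[of n] by (simp add: B_mean \<sigma>_def norm2_squared[symmetric])
    qed
    show "indep_vars (\<lambda>_. borel) (D N) {..<r}" for N
    proof -
      have disj: "disjoint_family_on (\<lambda>l. {Q N l..<Q N (Suc l)}) {..<r}"
        unfolding disjoint_family_on_def
      proof safe
        fix i j b assume ij: "i < r" "j < r" "i \<noteq> j" and b: "b \<in> {Q N i..<Q N (Suc i)}" "b \<in> {Q N j..<Q N (Suc j)}"
        have "Suc i \<le> j \<or> Suc j \<le> i" using ij by auto
        then show "b \<in> {}"
          using b Q_mono'[of "Suc i" j N] Q_mono'[of "Suc j" i N] ij by auto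
      qed
      have "indep_vars (\<lambda>l. Pi\<^sub>M {Q N l..<Q N (Suc l)} (\<lambda>_. borel)) (\<lambda>l \<omega>. \<lambda>b\<in>{Q N l..<Q N (Suc l)}. B b \<omega>) {..<r}"
        by (rule indep_vars_restrict[OF B _ disj]) auto
      then have "indep_vars (\<lambda>_. borel) (\<lambda>l \<omega>. (\<Sum>b\<in>{Q N l..<Q N (Suc l)}. (\<lambda>b\<in>{Q N l..<Q N (Suc l)}. B b \<omega>) b) / sqrt (real N)) {..<r}"
        by (rule indep_vars_compose2[where Y="\<lambda>l x. (\<Sum>b\<in>{Q N l..<Q N (Suc l)}. x b) / sqrt (real N)"]) measurable
      then show ?thesis by (simp add: D_def[abs_def])
    qed
    show "distr M borel (D N l) = distr (\<nu> (q N l)) borel (\<lambda>x. c N l * x)" if "l < r" for N l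
    proof -
      have "distr M borel (D N l) = distr M borel (\<lambda>\<omega>. (\<Sum>b<q N l. B b \<omega>) / sqrt (real N))"
        unfolding D_def[abs_def] q_def by (rule iid_block_sum_law[of "\<lambda>x. x / sqrt (real N)"]) simp
      also have "\<dots> = distr M borel (\<lambda>\<omega>. c N l * ((\<Sum>b<q N l. B b \<omega>) / sqrt (real (q N l) * \<sigma>\<^sup>2)))"
        using \<sigma> by (cases "q N l = 0") (simp_all add: c_def real_sqrt_divide real_sqrt_mult)
      also have "\<dots> = distr (\<nu> (q N l)) borel (\<lambda>x. c N l * x)"
        unfolding \<nu>_def by (subst distr_distr) (auto simp: comp_def)
      finally show ?thesis .
    qed
    show "filterlim (\<lambda>N. q N l) at_top sequentially" if l: "l < r" for l
    proof -
      have pos: "0 < (t (Suc l) - t l) / L" using t[OF l] L by simp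
      have "filterlim (\<lambda>N. real (q N l) / real N * real N) at_top sequentially"
        by (rule filterlim_tendsto_pos_mult_at_top[OF qN[OF l] pos filterlim_real_sequentially])
      moreover have "\<forall>\<^sub>F N in sequentially. real (q N l) / real N * real N = real (q N l)"
        using eventually_gt_at_top[of 0] by eventually_elim simp
      ultimately have "filterlim (\<lambda>N. real (q N l)) at_top sequentially"
        by (simp cong: filterlim_cong)
      then have "\<forall>\<^sub>F N in sequentially. real Z \<le> real (q N l)" for Z
        unfolding filterlim_at_top by blast
      then show ?thesis unfolding filterlim_at_top by simp
    qed
    show "(\<lambda>N. c N l) \<longlonglongrightarrow> \<gamma> l" if l: "l < r" for l
    proof -
      have "(\<lambda>N. sqrt (real (q N l) / real N) * \<sigma>) \<longlonglongrightarrow> sqrt ((t (Suc l) - t l) / L) * \<sigma>"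
        by (intro tendsto_intros qN l)
      moreover have "sqrt (real (q N l) / real N) * \<sigma> = c N l" for N
        using \<sigma> by (simp add: c_def real_sqrt_divide real_sqrt_mult)
      ultimately show ?thesis by (simp add: \<gamma>_def real_sqrt_divide mult_ac)
    qed
    show "M'.indep_vars (\<lambda>_. borel) G {..<r}"
    proof -
      have "M'.indep_vars (\<lambda>_. borel) (\<lambda>i \<omega>. W (t (Suc i)) \<omega> - W (t i) \<omega>) {..<r}"
        by (rule standard_brownian_motionD(5)[OF W]) (simp_all add: t0 t)
      then show ?thesis unfolding G_def[abs_def] by (rule M'.indep_vars_compose2) simp
    qed
    show "distr M' borel (G l) = distr std_normal_distribution borel (\<lambda>x. \<gamma> l * x)" if "l < r" for l
      unfolding G_def[abs_def] \<gamma>_def using that by (intro brownian_increment_law[OF W] t_nonneg t) auto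
  qed
  have eqM: "F (pad r (\<lambda>l. D N l \<omega>)) = h (pad r (\<lambda>i. (\<Sum>b<nat \<lfloor>real N * t (Suc i)\<rfloor> div L. B b \<omega>) / sqrt (real N)))" for N \<omega>
  proof -
    have "(\<Sum>l\<le>i. pad r (\<lambda>l. D N l \<omega>) l) = (\<Sum>b<Q N (Suc i). B b \<omega>) / sqrt (real N)" if "i < r" for i
    proof -
      have "(\<Sum>l\<le>i. pad r (\<lambda>l. D N l \<omega>) l) = (\<Sum>l\<le>i. \<Sum>b\<in>{Q N l..<Q N (Suc l)}. B b \<omega>) / sqrt (real N)"
        using that by (subst sum_divide_distrib, intro sum.cong) (auto simp: pad_def D_def)
      also have "(\<Sum>l\<le>i. \<Sum>b\<in>{Q N l..<Q N (Suc l)}. B b \<omega>) = (\<Sum>b<Q N (Suc i). B b \<omega>)"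
        using that by (intro sum_telescope_block Q_mono Q0) auto
      finally show ?thesis .
    qed
    then show ?thesis unfolding F_def Q_def by (intro arg_cong[where f=h]) (auto simp: pad_def)
  qed
  have Wm: "W (t i) \<in> borel_measurable M'" if "i \<le> r" for i
    by (rule standard_brownian_motionD(2)[OF W t_nonneg[OF that]])
  have hm: "h \<in> borel_measurable borel" using h by (rule borel_measurable_continuous_onI)
  have "AE \<omega> in M'. W 0 \<omega> = 0" by (rule standard_brownian_motionD(3)[OF W])
  then have AE: "AE \<omega> in M'. F (pad r (\<lambda>l. G l \<omega>)) = h (pad r (\<lambda>i. \<sigma> / sqrt (real L) * W (t (Suc i)) \<omega>))"
  proof eventually_elim
    case (elim \<omega>)
    have "(\<Sum>l\<le>i. pad r (\<lambda>l. G l \<omega>) l) = \<sigma> / sqrt (real L) * W (t (Suc i)) \<omega>" if "i < r" for i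
    proof -
      have "(\<Sum>l\<le>i. pad r (\<lambda>l. G l \<omega>) l) = (\<Sum>l\<le>i. \<sigma> / sqrt (real L) * (W (t (Suc l)) \<omega> - W (t l) \<omega>))"
        using that by (intro sum.cong) (auto simp: pad_def G_def)
      also have "\<dots> = \<sigma> / sqrt (real L) * (\<Sum>l<Suc i. W (t (Suc l)) \<omega> - W (t l) \<omega>)"
        by (simp only: sum_distrib_left lessThan_Suc_atMost)
      also have "(\<Sum>l<Suc i. W (t (Suc l)) \<omega> - W (t l) \<omega>) = W (t (Suc i)) \<omega> - W (t 0) \<omega>"
        by (rule sum_lessThan_telescope)
      finally show ?thesis using elim t0 by simp
    qed
    then show ?case unfolding F_def by (intro arg_cong[where f=h]) (auto simp: pad_def)
  qed
  have "(\<integral>\<omega>. F (pad r (\<lambda>l. G l \<omega>)) \<partial>M') = (\<integral>\<omega>. h (pad r (\<lambda>i. \<sigma> / sqrt (real L) * W (t (Suc i)) \<omega>)) \<partial>M')"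
  proof (rule integral_cong_AE[OF _ _ AE])
    show "(\<lambda>\<omega>. F (pad r (\<lambda>l. G l \<omega>))) \<in> borel_measurable M'"
      unfolding F_def
    proof (intro measurable_compose[OF measurable_pad hm] borel_measurable_sum)
      fix i l assume "i < r" "l \<in> {..i}"
      then show "(\<lambda>\<omega>. pad r (\<lambda>l. G l \<omega>) l) \<in> borel_measurable M'"
        using Wm by (auto simp: pad_def G_def intro!: borel_measurable_times borel_measurable_diff)
    qed
    show "(\<lambda>\<omega>. h (pad r (\<lambda>i. \<sigma> / sqrt (real L) * W (t (Suc i)) \<omega>))) \<in> borel_measurable M'"
      using Wm by (intro measurable_compose[OF measurable_pad hm] borel_measurable_times) auto
  qed
  then show ?thesis using conv unfolding eqM by (simp only: \<sigma>_def)
qed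

end

end

section \<open>Sums close to random walks\<close>

lemma integral_tendsto_scale:
  fixes h :: "(nat \<Rightarrow> real) \<Rightarrow> real" and \<theta> :: "nat \<Rightarrow> real"
  assumes P: "prob_space P" and h: "continuous_on UNIV h" and B: "\<And>x. \<bar>h x\<bar> \<le> B"
    and Z: "\<And>i. i < r \<Longrightarrow> Z i \<in> borel_measurable P" and \<theta>: "\<theta> \<longlonglongrightarrow> \<theta>'"
  shows "(\<lambda>k. \<integral>\<omega>. h (pad r (\<lambda>i. \<theta> k * Z i \<omega>)) \<partial>P) \<longlonglongrightarrow> (\<integral>\<omega>. h (pad r (\<lambda>i. \<theta>' * Z i \<omega>)) \<partial>P)"
  using Z by (intro integral_tendsto_of_pointwise[OF P h B]) (auto intro!: AE_I2 tendsto_mult \<theta> tendsto_const)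

context prob_space
begin

text \<open>
  \<open>S N\<close> is close to the random walk with steps \<open>B\<close>, one step for \<open>L\<close> units of time. The constant \<open>c\<close> accounts for the
  incomplete last block.
\<close>
definition block_approximable :: "(nat \<Rightarrow> 'a \<Rightarrow> real) \<Rightarrow> real \<Rightarrow> (nat \<Rightarrow> 'a \<Rightarrow> real) \<Rightarrow> nat \<Rightarrow> real \<Rightarrow> bool" where
  "block_approximable S \<eta> B L c \<longleftrightarrow> L > 0 \<and> indep_vars (\<lambda>_. borel) B UNIV \<and>
     (\<forall>b. distr M borel (B b) = distr M borel (B 0)) \<and> (\<forall>b. square_integrable M (B b)) \<and>
     (\<forall>b. expectation (B b) = 0) \<and>
     (\<forall>N. norm2 M (\<lambda>\<omega>. S N \<omega> - (\<Sum>b<N div L. B b \<omega>)) \<le> \<eta> * sqrt (real N) + c)"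

lemma block_approximable_norm2:
  assumes S: "\<And>N. square_integrable M (S N)" and blk: "block_approximable S \<eta> B L c" and \<eta>: "\<eta> > 0"
  shows "\<forall>\<^sub>F N in sequentially. \<bar>norm2 M (S N) / sqrt (real N) - norm2 M (B 0) / sqrt (real L)\<bar> \<le> 3 * \<eta>"
proof -
  have L: "L > 0" and B: "indep_vars (\<lambda>_. borel) B UNIV" "\<And>b. distr M borel (B b) = distr M borel (B 0)"
      "\<And>b. square_integrable M (B b)" "\<And>b. expectation (B b) = 0"
    and le: "\<And>N. norm2 M (\<lambda>\<omega>. S N \<omega> - (\<Sum>b<N div L. B b \<omega>)) \<le> \<eta> * sqrt (real N) + c"
    using blk unfolding block_approximable_def by blast+
  let ?T = "\<lambda>N \<omega>. \<Sum>b<N div L. B b \<omega>"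
  have T_sq: "square_integrable M (?T N)" for N by (intro square_integrable_sum B)
  have T_norm: "norm2 M (?T N) / sqrt (real N) = sqrt (real (N div L) / real N) * norm2 M (B 0)" for N
  proof -
    have "norm2 M (?T N) = sqrt (real (N div L) * (norm2 M (B 0))\<^sup>2)"
      using iid_sum_norm2[OF B, of "N div L"] by (metis norm2_nonneg real_sqrt_unique)
    then show ?thesis by (simp add: real_sqrt_mult real_sqrt_divide)
  qed
  have "(\<lambda>N. real (nat \<lfloor>real N * 1\<rfloor> div L) / real N) \<longlonglongrightarrow> 1 / L"
    by (rule block_count_asymptotics[OF L]) simp
  then have "(\<lambda>N. sqrt (real (N div L) / real N) * norm2 M (B 0)) \<longlonglongrightarrow> sqrt (1 / L) * norm2 M (B 0)"
    by (intro tendsto_mult tendsto_real_sqrt tendsto_const) simp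
  then have lim: "(\<lambda>N. norm2 M (?T N) / sqrt (real N)) \<longlonglongrightarrow> norm2 M (B 0) / sqrt (real L)"
    unfolding T_norm by (simp add: real_sqrt_divide)
  have "(\<lambda>N. c / sqrt (real N)) \<longlonglongrightarrow> 0"
    by (intro tendsto_divide_0[OF tendsto_const] filterlim_at_top_imp_at_infinity
        filterlim_compose[OF sqrt_at_top filterlim_real_sequentially])
  then have "\<forall>\<^sub>F N in sequentially. c / sqrt (real N) < \<eta>" using \<eta> by (rule order_tendstoD)
  moreover have "\<forall>\<^sub>F N in sequentially. dist (norm2 M (?T N) / sqrt (real N)) (norm2 M (B 0) / sqrt (real L)) < \<eta>"
    using lim \<eta> by (rule tendstoD)
  ultimately show ?thesis using eventually_gt_at_top[of 0]
  proof eventually_elim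
    case (elim N)
    have "\<bar>norm2 M (S N) - norm2 M (?T N)\<bar> \<le> \<eta> * sqrt (real N) + c"
      using norm2_abs_diff[OF S[of N] T_sq[of N]] le[of N] by linarith
    then have "\<bar>norm2 M (S N) - norm2 M (?T N)\<bar> / sqrt (real N) \<le> (\<eta> * sqrt (real N) + c) / sqrt (real N)"
      by (rule divide_right_mono) simp
    also have "\<dots> = \<eta> + c / sqrt (real N)" using elim(3) by (simp add: add_divide_distrib)
    finally have "\<bar>norm2 M (S N) / sqrt (real N) - norm2 M (?T N) / sqrt (real N)\<bar> \<le> \<eta> + c / sqrt (real N)"
      by (simp add: diff_divide_distrib[symmetric])
    then show ?case using elim(1,2) by (simp add: dist_real_def)
  qed
qed

context
  fixes S :: "nat \<Rightarrow> 'a \<Rightarrow> real" and \<eta> :: "nat \<Rightarrow> real"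
    and B :: "nat \<Rightarrow> nat \<Rightarrow> 'a \<Rightarrow> real" and L :: "nat \<Rightarrow> nat" and c :: "nat \<Rightarrow> real"
  assumes S: "\<And>N. square_integrable M (S N)" and S0: "S 0 = (\<lambda>_. 0)"
    and blk: "\<And>k. block_approximable S (\<eta> k) (B k) (L k) (c k)"
    and \<eta>: "\<And>k. \<eta> k > 0" and \<eta>_lim: "\<eta> \<longlonglongrightarrow> 0"
begin

text \<open>
  For every \<open>k\<close>, the normalised norm of \<open>S N\<close> is for large \<open>N\<close> within \<open>3 * \<eta> k\<close> of the standard deviation per unit of
  time of the \<open>k\<close>-th random walk. Therefore the former is a Cauchy sequence in \<open>N\<close>, and the latter converges to the
  same limit.
\<close>
lemma normalized_norm2_convergent:
  obtains \<theta> where "0 \<le> \<theta>" "(\<lambda>N. norm2 M (S N) / sqrt (real N)) \<longlonglongrightarrow> \<theta>"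
    "(\<lambda>k. norm2 M (B k 0) / sqrt (real (L k))) \<longlonglongrightarrow> \<theta>"
proof -
  let ?s = "\<lambda>N. norm2 M (S N) / sqrt (real N)"
  let ?t = "\<lambda>k. norm2 M (B k 0) / sqrt (real (L k))"
  have ev: "\<forall>\<^sub>F N in sequentially. \<bar>?s N - ?t k\<bar> \<le> 3 * \<eta> k" for k
    by (rule block_approximable_norm2[OF S blk \<eta>])
  have "Cauchy ?s"
  proof (rule metric_CauchyI)
    fix e :: real assume e: "e > 0"
    have "\<forall>\<^sub>F k in sequentially. \<eta> k < e / 7" using e by (intro order_tendstoD[OF \<eta>_lim]) simp
    then obtain k where k: "\<eta> k < e / 7" by (auto simp: eventually_sequentially)
    from ev[of k] obtain N0 where "\<And>N. N \<ge> N0 \<Longrightarrow> \<bar>?s N - ?t k\<bar> \<le> 3 * \<eta> k"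
      by (auto simp: eventually_sequentially)
    then have "dist (?s m) (?s n) < e" if "m \<ge> N0" "n \<ge> N0" for m n
      using that(1)[THEN \<open>\<And>N. N \<ge> N0 \<Longrightarrow> \<bar>?s N - ?t k\<bar> \<le> 3 * \<eta> k\<close>]
        that(2)[THEN \<open>\<And>N. N \<ge> N0 \<Longrightarrow> \<bar>?s N - ?t k\<bar> \<le> 3 * \<eta> k\<close>] k e \<eta>[of k]
      unfolding dist_real_def by linarith
    then show "\<exists>N0. \<forall>m\<ge>N0. \<forall>n\<ge>N0. dist (?s m) (?s n) < e" by blast
  qed
  then obtain \<theta> where \<theta>: "?s \<longlonglongrightarrow> \<theta>" using Cauchy_convergent_iff convergent_def by blast
  have close: "\<bar>\<theta> - ?t k\<bar> \<le> 3 * \<eta> k" for k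
  proof (rule tendsto_upperbound)
    show "(\<lambda>N. \<bar>?s N - ?t k\<bar>) \<longlonglongrightarrow> \<bar>\<theta> - ?t k\<bar>" by (intro tendsto_intros \<theta>)
  qed (use ev in auto)
  have "(\<lambda>k. ?t k - \<theta>) \<longlonglongrightarrow> 0"
  proof (rule Lim_null_comparison)
    show "\<forall>\<^sub>F k in sequentially. norm (?t k - \<theta>) \<le> 3 * \<eta> k"
      using close by (intro always_eventually) (simp add: abs_minus_commute)
    show "(\<lambda>k. 3 * \<eta> k) \<longlonglongrightarrow> 0" using \<eta>_lim by (intro tendsto_mult_right_zero)
  qed
  then have "?t \<longlonglongrightarrow> \<theta>" by (simp add: LIM_zero_iff)
  moreover have "0 \<le> \<theta>" by (rule LIMSEQ_le_const[OF \<theta>]) simp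
  ultimately show ?thesis using that \<theta> by blast
qed

text \<open>
  Choose \<open>k\<close> first, so that the \<open>k\<close>-th random walk has almost the right variance and is close to \<open>S\<close> in mean square
  relative to \<open>sqrt N\<close>; then let \<open>N\<close> tend to infinity, where \<open>random_walk_fdd\<close> applies.
\<close>
lemma block_approximable_fdd:
  fixes h :: "(nat \<Rightarrow> real) \<Rightarrow> real" and t :: "nat \<Rightarrow> real"
  assumes s_lim: "(\<lambda>N. norm2 M (S N) / sqrt (real N)) \<longlonglongrightarrow> \<theta>"
    and t_lim: "(\<lambda>k. norm2 M (B k 0) / sqrt (real (L k))) \<longlonglongrightarrow> \<theta>"
    and t0: "t 0 = 0" and t: "\<And>i. i < r \<Longrightarrow> t i < t (Suc i)"
    and h: "continuous_on UNIV h" and hB: "\<And>x. \<bar>h x\<bar> \<le> Bd"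
    and W: "standard_brownian_motion M' W"
  shows "(\<lambda>N. \<integral>\<omega>. h (pad r (\<lambda>i. S (nat \<lfloor>real N * t (Suc i)\<rfloor>) \<omega> / sqrt (real N))) \<partial>M)
    \<longlonglongrightarrow> (\<integral>\<omega>. h (pad r (\<lambda>i. \<theta> * W (t (Suc i)) \<omega>)) \<partial>M')"
proof -
  interpret M': prob_space M' by (rule standard_brownian_motionD(1)[OF W])
  have t_nonneg: "0 \<le> t i" if "i \<le> r" for i
    using that
  proof (induction i)
    case (Suc i)
    then show ?case using t[of i] by simp
  qed (simp add: t0)
  define \<tau> where "\<tau> = (\<Sum>i\<le>r. t i)"
  have t_le: "t i \<le> \<tau>" if "i \<le> r" for i
    unfolding \<tau>_def using that t_nonneg by (intro member_le_sum) auto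
  have \<tau>0: "0 \<le> \<tau>" using t_le[of 0] t0 by simp
  have "Bseq (\<lambda>N. norm2 M (S N) / sqrt (real N))" using s_lim by (intro convergent_imp_Bseq) (auto simp: convergent_def)
  then obtain a where a: "a > 0" "\<And>N. norm (norm2 M (S N) / sqrt (real N)) \<le> a" by (auto simp: Bseq_def)
  have S_le: "norm2 M (S n) \<le> a * sqrt (real n)" for n
  proof (cases "n = 0")
    case False
    then show ?thesis using a(2)[of n] by (simp add: field_simps)
  qed (simp add: S0)
  define V where "V N i \<omega> = S (nat \<lfloor>real N * t (Suc i)\<rfloor>) \<omega> / sqrt (real N)" for N i \<omega>
  define V' where "V' k N i \<omega> = (\<Sum>b<nat \<lfloor>real N * t (Suc i)\<rfloor> div L k. B k b \<omega>) / sqrt (real N)" for k N i \<omega>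
  define J where "J k = (\<integral>\<omega>. h (pad r (\<lambda>i. norm2 M (B k 0) / sqrt (real (L k)) * W (t (Suc i)) \<omega>)) \<partial>M')" for k
  define J0 where "J0 = (\<integral>\<omega>. h (pad r (\<lambda>i. \<theta> * W (t (Suc i)) \<omega>)) \<partial>M')"
  note bl = blk[unfolded block_approximable_def]
  have walk: "(\<lambda>N. \<integral>\<omega>. h (pad r (\<lambda>i. V' k N i \<omega>)) \<partial>M) \<longlonglongrightarrow> J k" for k
    unfolding V'_def J_def using bl[of k] by (intro random_walk_fdd[OF _ _ _ _ _ t0 t h hB W]) auto
  have J_lim: "J \<longlonglongrightarrow> J0"
    unfolding J_def[abs_def] J0_def
    by (rule integral_tendsto_scale[OF M'.prob_space_axioms h hB _ t_lim])
      (intro standard_brownian_motionD(2)[OF W] t_nonneg, simp)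
  have div_sqrt: "norm2 M (\<lambda>\<omega>. f \<omega> / sqrt (real N)) = norm2 M f / sqrt (real N)" for f N
    using norm2_cmult[of M "1 / sqrt (real N)" f] by simp
  have div_sq: "square_integrable M (\<lambda>\<omega>. f \<omega> / sqrt (real N))" if "square_integrable M f" for f N
    using square_integrable_cmult[OF that, of "1 / sqrt (real N)"] by simp
  have V_sq: "square_integrable M (V N i)" for N i
    unfolding V_def by (intro div_sq S)
  have V'_sq: "square_integrable M (V' k N i)" for k N i
    unfolding V'_def using bl[of k] by (intro div_sq square_integrable_sum) auto
  have sqrt_le: "sqrt (real (nat \<lfloor>real N * t (Suc i)\<rfloor>)) \<le> sqrt (real N) * sqrt \<tau>" if i: "i < r" for N i
  proof -
    have "0 \<le> real N * t (Suc i)" using t_nonneg[of "Suc i"] i by simp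
    then have "real (nat \<lfloor>real N * t (Suc i)\<rfloor>) \<le> real N * t (Suc i)" by linarith
    also have "\<dots> \<le> real N * \<tau>" using t_le[of "Suc i"] i by (intro mult_left_mono) auto
    finally show ?thesis by (simp add: real_sqrt_mult[symmetric])
  qed
  have V_norm: "norm2 M (V N i) \<le> a * sqrt \<tau>" if i: "i < r" and N: "N > 0" for N i
  proof -
    have "norm2 M (V N i) = norm2 M (S (nat \<lfloor>real N * t (Suc i)\<rfloor>)) / sqrt (real N)"
      unfolding V_def by (rule div_sqrt)
    also have "\<dots> \<le> (a * (sqrt (real N) * sqrt \<tau>)) / sqrt (real N)"
      using a(1) by (intro divide_right_mono order_trans[OF S_le mult_left_mono[OF sqrt_le[OF i]]]) auto
    finally show ?thesis using N by simp
  qed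
  have VV'_norm: "norm2 M (\<lambda>\<omega>. V N i \<omega> - V' k N i \<omega>) \<le> \<eta> k * sqrt \<tau> + c k / sqrt (real N)"
    if i: "i < r" and N: "N > 0" for k N i
  proof -
    let ?n = "nat \<lfloor>real N * t (Suc i)\<rfloor>"
    have "norm2 M (\<lambda>\<omega>. V N i \<omega> - V' k N i \<omega>) = norm2 M (\<lambda>\<omega>. S ?n \<omega> - (\<Sum>b<?n div L k. B k b \<omega>)) / sqrt (real N)"
      unfolding V_def V'_def diff_divide_distrib[symmetric] by (rule div_sqrt)
    also have "\<dots> \<le> (\<eta> k * sqrt (real ?n) + c k) / sqrt (real N)"
      using bl[of k] by (intro divide_right_mono) auto
    also have "\<dots> \<le> (\<eta> k * (sqrt (real N) * sqrt \<tau>) + c k) / sqrt (real N)"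
      using sqrt_le[OF i, of N] less_imp_le[OF \<eta>[of k]] by (intro divide_right_mono add_right_mono mult_left_mono) auto
    also have "\<dots> = \<eta> k * sqrt \<tau> + c k / sqrt (real N)" using N by (simp add: add_divide_distrib)
    finally show ?thesis .
  qed
  have Bd0: "0 \<le> Bd" using hB[of undefined] by linarith
  have "(\<lambda>N. \<integral>\<omega>. h (pad r (\<lambda>i. V N i \<omega>)) \<partial>M) \<longlonglongrightarrow> J0"
  proof (rule tendstoI)
    fix e0 :: real assume "e0 > 0"
    define e where "e = e0 / 6"
    have e: "e > 0" using \<open>e0 > 0\<close> by (simp add: e_def)
    \<comment> \<open>so large that the event that some \<open>V N i\<close> exceeds \<open>R\<close> costs at most \<open>e\<close>\<close>
    define R where "R = sqrt (2 * Bd * real r * (a * sqrt \<tau>)\<^sup>2 / e + 1)"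
    have R2: "R\<^sup>2 = 2 * Bd * real r * (a * sqrt \<tau>)\<^sup>2 / e + 1" unfolding R_def using Bd0 e by simp
    have R: "R > 0" unfolding R_def using Bd0 e by (intro real_sqrt_gt_zero add_nonneg_pos) auto
    have R_small: "2 * Bd * (real r * ((a * sqrt \<tau>)\<^sup>2 / R\<^sup>2)) \<le> e"
    proof -
      have "2 * Bd * real r * (a * sqrt \<tau>)\<^sup>2 \<le> e * R\<^sup>2"
        unfolding R2 using e by (simp add: distrib_left)
      then show ?thesis using R by (simp add: field_simps)
    qed
    obtain d where d: "0 < d" and uc: "\<And>x y. (\<And>i. \<bar>x i\<bar> \<le> R) \<Longrightarrow> (\<And>i. \<bar>x i - y i\<bar> \<le> d) \<Longrightarrow> \<bar>h x - h y\<bar> \<le> e"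
      using uniformly_continuous_bounded_sequences[OF h e, of R] by blast
    have "(\<lambda>k. 2 * Bd * (real r * ((\<eta> k * (sqrt \<tau> + 1))\<^sup>2 / d\<^sup>2))) \<longlonglongrightarrow> 2 * Bd * (real r * ((0 * (sqrt \<tau> + 1))\<^sup>2 / d\<^sup>2))"
      using d by (intro tendsto_intros \<eta>_lim) auto
    then have "\<forall>\<^sub>F k in sequentially. 2 * Bd * (real r * ((\<eta> k * (sqrt \<tau> + 1))\<^sup>2 / d\<^sup>2)) < e"
      using e by (intro order_tendstoD(2)) auto
    moreover have "\<forall>\<^sub>F k in sequentially. dist (J k) J0 < e" by (rule tendstoD[OF J_lim e])
    ultimately have "\<forall>\<^sub>F k in sequentially. 2 * Bd * (real r * ((\<eta> k * (sqrt \<tau> + 1))\<^sup>2 / d\<^sup>2)) < e \<and> dist (J k) J0 < e"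
      by (rule eventually_conj)
    then obtain k where k: "2 * Bd * (real r * ((\<eta> k * (sqrt \<tau> + 1))\<^sup>2 / d\<^sup>2)) < e" "dist (J k) J0 < e"
      by (auto simp: eventually_sequentially)
    have "(\<lambda>N. c k / sqrt (real N)) \<longlonglongrightarrow> 0"
      by (intro tendsto_divide_0[OF tendsto_const] filterlim_at_top_imp_at_infinity
          filterlim_compose[OF sqrt_at_top filterlim_real_sequentially])
    then have "\<forall>\<^sub>F N in sequentially. c k / sqrt (real N) < \<eta> k" using \<eta> by (rule order_tendstoD)
    moreover have "\<forall>\<^sub>F N in sequentially. dist (\<integral>\<omega>. h (pad r (\<lambda>i. V' k N i \<omega>)) \<partial>M) (J k) < e"
      by (rule tendstoD[OF walk e])
    ultimately show "\<forall>\<^sub>F N in sequentially. dist (\<integral>\<omega>. h (pad r (\<lambda>i. V N i \<omega>)) \<partial>M) J0 < e0"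
      using eventually_gt_at_top[of 0]
    proof eventually_elim
      case (elim N)
      have "\<bar>(\<integral>\<omega>. h (pad r (\<lambda>i. V N i \<omega>)) \<partial>M) - (\<integral>\<omega>. h (pad r (\<lambda>i. V' k N i \<omega>)) \<partial>M)\<bar>
          \<le> e + 2 * Bd * (\<Sum>i<r. (norm2 M (V N i))\<^sup>2 / R\<^sup>2 + (norm2 M (\<lambda>\<omega>. V N i \<omega> - V' k N i \<omega>))\<^sup>2 / d\<^sup>2)"
        using e by (intro expectation_close_of_norm2_close[OF h hB R d _ uc V_sq V'_sq]) auto
      also have "(\<Sum>i<r. (norm2 M (V N i))\<^sup>2 / R\<^sup>2 + (norm2 M (\<lambda>\<omega>. V N i \<omega> - V' k N i \<omega>))\<^sup>2 / d\<^sup>2)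
          \<le> (\<Sum>i<r. (a * sqrt \<tau>)\<^sup>2 / R\<^sup>2 + (\<eta> k * (sqrt \<tau> + 1))\<^sup>2 / d\<^sup>2)"
      proof (intro sum_mono add_mono divide_right_mono power_mono)
        fix i assume "i \<in> {..<r}"
        then have i: "i < r" by simp
        show "norm2 M (V N i) \<le> a * sqrt \<tau>" by (rule V_norm[OF i elim(3)])
        show "norm2 M (\<lambda>\<omega>. V N i \<omega> - V' k N i \<omega>) \<le> \<eta> k * (sqrt \<tau> + 1)"
          using VV'_norm[OF i elim(3), of k] elim(1) by (simp add: distrib_left)
      qed auto
      also have "e + 2 * Bd * (\<Sum>i<r. (a * sqrt \<tau>)\<^sup>2 / R\<^sup>2 + (\<eta> k * (sqrt \<tau> + 1))\<^sup>2 / d\<^sup>2)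
          = e + 2 * Bd * (real r * ((a * sqrt \<tau>)\<^sup>2 / R\<^sup>2)) + 2 * Bd * (real r * ((\<eta> k * (sqrt \<tau> + 1))\<^sup>2 / d\<^sup>2))"
        by (simp add: distrib_left)
      also have "\<dots> \<le> 3 * e" using R_small k(1) by linarith
      finally have "\<bar>(\<integral>\<omega>. h (pad r (\<lambda>i. V N i \<omega>)) \<partial>M) - (\<integral>\<omega>. h (pad r (\<lambda>i. V' k N i \<omega>)) \<partial>M)\<bar> \<le> 3 * e"
        using Bd0 by (simp add: mult_left_mono)
      then show ?case using elim(2) k(2) e unfolding dist_real_def e_def by linarith
    qed
  qed
  then show ?thesis by (simp add: V_def J0_def)
qed

end

text \<open>
  A finite set of times is listed in increasing order with 0 in front. Both processes start in 0, so a test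
  function of the values at these times is one of the values at the positive ones.
\<close>
lemma block_approximable_fdd_converges:
  fixes S :: "nat \<Rightarrow> 'a \<Rightarrow> real"
  assumes S0: "S 0 = (\<lambda>_. 0)" and \<theta>: "\<theta> \<ge> 0" and W: "standard_brownian_motion M' W"
    and conv: "\<And>r (t :: nat \<Rightarrow> real) (h :: (nat \<Rightarrow> real) \<Rightarrow> real) (Bd :: real). t 0 = 0 \<Longrightarrow> (\<And>i. i < r \<Longrightarrow> t i < t (Suc i)) \<Longrightarrow> continuous_on UNIV h \<Longrightarrow>
      (\<And>x. \<bar>h x\<bar> \<le> Bd) \<Longrightarrow>
      (\<lambda>N. \<integral>\<omega>. h (pad r (\<lambda>i. S (nat \<lfloor>real N * t (Suc i)\<rfloor>) \<omega> / sqrt (real N))) \<partial>M)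
        \<longlonglongrightarrow> (\<integral>\<omega>. h (pad r (\<lambda>i. \<theta> * W (t (Suc i)) \<omega>)) \<partial>M')"
  shows "fdd_converges M (\<lambda>N t \<omega>. S (nat \<lfloor>real N * t\<rfloor>) \<omega> / sqrt (real N)) M' (\<lambda>t \<omega>. \<bar>\<theta>\<bar> * W t \<omega>)"
  unfolding fdd_converges_def
proof (intro allI impI, elim conjE)
  fix T :: "real set" and f :: "(real \<Rightarrow> real) \<Rightarrow> real"
  assume T: "finite T" "T \<subseteq> {0..}" and f: "continuous_map (product_topology (\<lambda>_. euclideanreal) T) euclideanreal f"
    and fb: "bounded (f ` (T \<rightarrow>\<^sub>E UNIV))"
  obtain Bd where Bd: "\<And>x. x \<in> T \<rightarrow>\<^sub>E UNIV \<Longrightarrow> \<bar>f x\<bar> \<le> Bd" using fb by (auto simp: bounded_iff)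
  define ts where "ts = sorted_list_of_set (insert 0 T)"
  have fin: "finite (insert 0 T)" using T by simp
  have ts: "set ts = insert 0 T" "sorted_wrt (<) ts"
    unfolding ts_def by (rule set_sorted_list_of_set[OF fin], rule strict_sorted_list_of_set)
  have len: "length ts > 0" using ts(1) by (cases ts) auto
  define r where "r = length ts - 1"
  define t where "t i = ts ! i" for i
  have inc: "t i < t (Suc i)" if "i < r" for i
    unfolding t_def by (rule sorted_wrt_nth_less[OF ts(2)]) (use that in \<open>auto simp: r_def\<close>)
  have t0: "t 0 = 0"
  proof -
    obtain i where i: "i < length ts" "ts ! i = 0" using ts(1) by (metis in_set_conv_nth insertI1)
    have "ts ! 0 \<le> ts ! i" using sorted_wrt_nth_less[OF ts(2), of 0 i] i(1) by (cases "i = 0") auto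
    moreover have "ts ! 0 \<ge> 0" using nth_mem[OF len] ts(1) T(2) by auto
    ultimately show ?thesis using i(2) by (simp add: t_def)
  qed
  have "\<exists>i\<le>r. t i = s" if "s \<in> T" for s
  proof -
    have "s \<in> set ts" using ts(1) that by simp
    then obtain i where "i < length ts" "ts ! i = s" by (auto simp: in_set_conv_nth)
    then show ?thesis unfolding r_def t_def by (intro exI[of _ i]) auto
  qed
  then obtain idx where idx: "\<And>s. s \<in> T \<Longrightarrow> idx s \<le> r" "\<And>s. s \<in> T \<Longrightarrow> t (idx s) = s" by metis
  define h' where "h' v = f (\<lambda>s\<in>T. v (idx s))" for v :: "nat \<Rightarrow> real"
  define h where "h v = h' (case_nat 0 v)" for v :: "nat \<Rightarrow> real"
  have h'c: "continuous_on UNIV h'"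
  proof -
    have "continuous_map euclidean (product_topology (\<lambda>_. euclideanreal) T) (\<lambda>v :: nat \<Rightarrow> real. \<lambda>s\<in>T. v (idx s))"
      by (rule continuous_map_coordinatewise_then_product) (auto intro: continuous_on_product_coordinates)
    from continuous_map_compose[OF this f] show ?thesis by (simp add: h'_def[abs_def] comp_def)
  qed
  have hc: "continuous_on UNIV h"
    unfolding h_def[abs_def]
  proof (rule continuous_on_compose2[OF h'c])
    show "continuous_on UNIV (\<lambda>v :: nat \<Rightarrow> real. case_nat 0 v)"
    proof (rule continuous_on_coordinatewise_then_product)
      show "continuous_on UNIV (\<lambda>v :: nat \<Rightarrow> real. case_nat 0 v i)" for i
        by (cases i) (auto intro: continuous_on_product_coordinates)
    qed
  qed auto
  have hB: "\<bar>h v\<bar> \<le> Bd" for v unfolding h_def h'_def by (rule Bd) auto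
  have eqS: "f (\<lambda>s\<in>T. S (nat \<lfloor>real N * s\<rfloor>) \<omega> / sqrt (real N))
      = h (pad r (\<lambda>i. S (nat \<lfloor>real N * t (Suc i)\<rfloor>) \<omega> / sqrt (real N)))" for N \<omega>
    unfolding h_def h'_def
  proof (intro arg_cong[where f=f] restrict_ext)
    fix s assume s: "s \<in> T"
    show "S (nat \<lfloor>real N * s\<rfloor>) \<omega> / sqrt (real N) 
      = case_nat 0 (pad r (\<lambda>i. S (nat \<lfloor>real N * t (Suc i)\<rfloor>) \<omega> / sqrt (real N))) (idx s)"
    proof (cases "idx s")
      case 0
      then have "s = 0" using idx(2)[OF s] t0 by simp
      then show ?thesis using 0 by (simp add: S0)
    next
      case (Suc j)
      then show ?thesis using idx[OF s] by (simp add: pad_def)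
    qed
  qed
  have t_nonneg: "0 \<le> t i" if "i \<le> r" for i
  proof -
    have "i < length ts" using that len unfolding r_def by linarith
    then have "t i \<in> set ts" unfolding t_def by (rule nth_mem)
    then show ?thesis using ts(1) T(2) by auto
  qed
  have Wm: "W (t i) \<in> borel_measurable M'" if "i \<le> r" for i
    by (rule standard_brownian_motionD(2)[OF W t_nonneg[OF that]])
  have eqW: "f (\<lambda>s\<in>T. \<bar>\<theta>\<bar> * W s \<omega>) = h' (pad (Suc r) (\<lambda>i. \<theta> * W (t i) \<omega>))" for \<omega>
    unfolding h'_def using \<theta> idx by (intro arg_cong[where f=f] restrict_ext) (simp add: pad_def less_Suc_eq_le)
  have AE: "AE \<omega> in M'. h' (pad (Suc r) (\<lambda>i. \<theta> * W (t i) \<omega>)) = h (pad r (\<lambda>i. \<theta> * W (t (Suc i)) \<omega>))"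
    using standard_brownian_motionD(3)[OF W]
  proof eventually_elim
    case (elim \<omega>)
    show ?case
      unfolding h_def using elim t0 by (intro arg_cong[where f=h'] ext) (auto simp: pad_def split: nat.split)
  qed
  have h'm: "h' \<in> borel_measurable borel" and hm: "h \<in> borel_measurable borel"
    using h'c hc by (auto intro: borel_measurable_continuous_onI)
  have "(\<integral>\<omega>. f (\<lambda>s\<in>T. \<bar>\<theta>\<bar> * W s \<omega>) \<partial>M') = (\<integral>\<omega>. h (pad r (\<lambda>i. \<theta> * W (t (Suc i)) \<omega>)) \<partial>M')"
    unfolding eqW
  proof (rule integral_cong_AE[OF _ _ AE])
    show "(\<lambda>\<omega>. h' (pad (Suc r) (\<lambda>i. \<theta> * W (t i) \<omega>))) \<in> borel_measurable M'"
      using Wm by (intro measurable_compose[OF measurable_pad h'm] borel_measurable_times) auto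
    show "(\<lambda>\<omega>. h (pad r (\<lambda>i. \<theta> * W (t (Suc i)) \<omega>))) \<in> borel_measurable M'"
      using Wm by (intro measurable_compose[OF measurable_pad hm] borel_measurable_times) auto
  qed
  then show "(\<lambda>N. \<integral>\<omega>. f (\<lambda>s\<in>T. S (nat \<lfloor>real N * s\<rfloor>) \<omega> / sqrt (real N)) \<partial>M)
      \<longlonglongrightarrow> (\<integral>\<omega>. f (\<lambda>s\<in>T. \<bar>\<theta>\<bar> * W s \<omega>) \<partial>M')"
    unfolding eqS using conv[of t r h Bd, OF t0 inc hc hB] by simp
qed

end

section \<open>The central limit theorem\<close>

context real_distribution
begin

text \<open>
  The majorant \<open>w\<close> is of the order \<open>\<bar>u\<bar> powr (-3)\<close>, so that \<open>w\<close> and \<open>\<bar>u\<bar> * w u\<close> are both dominated by a multiple of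
  the Cauchy density.
\<close>
lemma lipschitz_density_of_cubic_char_decay:
  assumes D: "D \<ge> 1" and decay: "\<And>u. 1 \<le> \<bar>u\<bar> \<Longrightarrow> cmod (char M u) \<le> D / \<bar>u\<bar> ^ 3"
  obtains p C where "lipschitz_density p C" "M = density lborel (\<lambda>x. ennreal (p x))"
proof -
  \<comment> \<open>at least 1 on \<open>[-1, 1]\<close>, and at least \<open>D / \<bar>u\<bar> ^ 3\<close> outside\<close>
  define w where "w u = 4 * D / ((1 + \<bar>u\<bar>) * (1 + u\<^sup>2))" for u :: real
  have den: "0 < (1 + \<bar>u\<bar>) * (1 + u\<^sup>2)" for u :: real by (intro mult_pos_pos) (auto intro: add_pos_nonneg)
  have bound: "cmod (char M u) \<le> w u" for u
  proof (cases "1 \<le> \<bar>u\<bar>")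
    case True
    have "(1 + \<bar>u\<bar>) * (1 + u\<^sup>2) \<le> (2 * \<bar>u\<bar>) * (2 * u\<^sup>2)"
      using True one_le_power[of "\<bar>u\<bar>" 2] by (intro mult_mono) auto
    also have "\<dots> = 4 * \<bar>u\<bar> ^ 3" by (simp add: power3_eq_cube power2_eq_square abs_mult[symmetric])
    finally have "4 * D / (4 * \<bar>u\<bar> ^ 3) \<le> w u"
      using den[of u] D unfolding w_def by (intro divide_left_mono mult_pos_pos) (auto intro: add_pos_nonneg)
    then have "D / \<bar>u\<bar> ^ 3 \<le> w u" by simp
    then show ?thesis using decay[OF True] by linarith
  next
    case False
    have "(1 + \<bar>u\<bar>) * (1 + u\<^sup>2) \<le> 2 * 2"
      using False power_le_one[of "\<bar>u\<bar>" 2] by (intro mult_mono) auto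
    then have "1 \<le> w u" using den[of u] D unfolding w_def by simp
    then show ?thesis using cmod_char_le_1[of u] by linarith
  qed
  have cauchy: "integrable lborel (\<lambda>u :: real. 4 * D * inverse (1 + u\<^sup>2))"
    using integrable_inverse_1_plus_square by (simp add: set_integrable_def)
  have le: "w u \<le> 4 * D * inverse (1 + u\<^sup>2)" "\<bar>u\<bar> * w u \<le> 4 * D * inverse (1 + u\<^sup>2)" "0 \<le> w u" for u
  proof -
    have q: "0 < 1 + u\<^sup>2" by (rule add_pos_nonneg) auto
    have w: "w u = 1 / (1 + \<bar>u\<bar>) * (4 * D * inverse (1 + u\<^sup>2))" unfolding w_def by (simp add: divide_simps)
    have nn: "0 \<le> 4 * D * inverse (1 + u\<^sup>2)" using D q by simp
    show "w u \<le> 4 * D * inverse (1 + u\<^sup>2)" unfolding w by (rule mult_left_le_one_le[OF nn]) auto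
    have "\<bar>u\<bar> * w u = \<bar>u\<bar> / (1 + \<bar>u\<bar>) * (4 * D * inverse (1 + u\<^sup>2))" unfolding w by simp
    also have "\<dots> \<le> 4 * D * inverse (1 + u\<^sup>2)" by (rule mult_left_le_one_le[OF nn]) auto
    finally show "\<bar>u\<bar> * w u \<le> 4 * D * inverse (1 + u\<^sup>2)" .
    show "0 \<le> w u" unfolding w using nn by simp
  qed
  have wm: "w \<in> borel_measurable borel" unfolding w_def[abs_def] by measurable
  have w: "integrable lborel w"
  proof (rule Bochner_Integration.integrable_bound[OF cauchy _ AE_I2])
    show "norm (w u) \<le> norm (4 * D * inverse (1 + u\<^sup>2))" for u
      unfolding real_norm_def using le(1,3)[of u] by linarith
  qed (use wm in simp)
  have uw: "integrable lborel (\<lambda>u. \<bar>u\<bar> * w u)"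
  proof (rule Bochner_Integration.integrable_bound[OF cauchy _ AE_I2])
    show "norm (\<bar>u\<bar> * w u) \<le> norm (4 * D * inverse (1 + u\<^sup>2))" for u
      unfolding real_norm_def using le(2)[of u] mult_nonneg_nonneg[OF abs_ge_zero[of u] le(3)[of u]] by linarith
  qed (use wm in simp)
  define C where "C = max ((\<integral>u. w u \<partial>lborel) / (2 * pi)) ((\<integral>u. \<bar>u\<bar> * w u \<partial>lborel) / (2 * pi))"
  obtain p where "p \<in> borel_measurable borel" and p: "M = density lborel (\<lambda>x. ennreal (p x))"
    and "\<And>x. 0 \<le> p x" "\<And>x. p x \<le> C" "\<And>x y. \<bar>p x - p y\<bar> \<le> C * \<bar>x - y\<bar>"
    using lipschitz_density_of_integrable_char[OF w uw bound, of C] by (auto simp: C_def)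
  then have "lipschitz_density p C" by unfold_locales
  then show ?thesis using that p by blast
qed

lemma clipped_norm_eq_truncated_moment:
  assumes s: "s > 0"
  shows "clipped_norm M s = s * sqrt (truncated_moment M (inverse s))"
proof -
  have "(min 1 \<bar>s * x\<bar>)\<^sup>2 = s\<^sup>2 * min (x\<^sup>2) ((inverse s)\<^sup>2)" for x
  proof (cases "\<bar>s * x\<bar> \<le> 1")
    case True
    then have "\<bar>x\<bar> \<le> inverse s" using s by (simp add: abs_mult field_simps)
    then have "x\<^sup>2 \<le> (inverse s)\<^sup>2" using s by (simp add: abs_le_square_iff[symmetric])
    then show ?thesis using True by (simp add: min_absorb1 min_absorb2 power_mult_distrib)
  next
    case False
    then have "inverse s \<le> \<bar>x\<bar>" using s by (simp add: abs_mult field_simps)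
    then have "(inverse s)\<^sup>2 \<le> x\<^sup>2" using s by (simp add: abs_le_square_iff[symmetric])
    then show ?thesis using False s by (simp add: min_absorb1 min_absorb2 power_mult_distrib[symmetric])
  qed
  then show ?thesis using s
    unfolding clipped_norm_def norm2_def truncated_moment_def by (simp add: real_sqrt_mult)
qed

lemma clipped_norm_le:
  assumes s: "s > 0" and C: "C > 0"
    and le: "truncated_moment M (inverse s) \<le> C * (inverse s powr (2 - \<alpha>) * Hs)"
  shows "clipped_norm M s \<le> sqrt C * (s powr (\<alpha> / 2) * sqrt Hs)"
proof -
  have "s * sqrt (inverse s powr (2 - \<alpha>)) = s powr 1 * s powr ((\<alpha> - 2) / 2)"
    using s by (simp add: powr_half_sqrt[symmetric] powr_powr inverse_powr powr_minus[symmetric])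
  also have "\<dots> = s powr (\<alpha> / 2)" unfolding powr_add[symmetric] by (simp add: field_simps)
  finally have eq: "s * sqrt (inverse s powr (2 - \<alpha>)) = s powr (\<alpha> / 2)" .
  have "clipped_norm M s \<le> s * sqrt (C * (inverse s powr (2 - \<alpha>) * Hs))"
    unfolding clipped_norm_eq_truncated_moment[OF s] using s le by (intro mult_left_mono) auto
  also have "\<dots> = sqrt C * ((s * sqrt (inverse s powr (2 - \<alpha>))) * sqrt Hs)"
    by (simp add: real_sqrt_mult mult_ac)
  finally show ?thesis unfolding eq .
qed

text \<open>
  Short memory in the form used below: with \<open>s = b j\<close>, the clipped norm is \<open>s\<close> times the root of the truncated
  moment at \<open>1 / s\<close>, and \<open>s * sqrt ((1 / s) powr (2 - \<alpha>)) = s powr (\<alpha> / 2)\<close>.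
\<close>
lemma summable_clipped_norm:
  assumes \<alpha>: "0 < \<alpha>" "\<alpha> \<le> 2" and h: "slowly_varying h" and H: "tail_normalizer \<alpha> h H"
    and tail: "((\<lambda>x. two_sided_tail M x / (x powr (-\<alpha>) * h x)) \<longlongrightarrow> \<sigma>) at_top" and \<sigma>: "\<sigma> > 0"
    and b: "\<And>j. b j > 0" "b \<longlonglongrightarrow> 0"
    and sum: "summable (\<lambda>j. b j powr (\<alpha> / 2) * sqrt (H (inverse (b j))))"
  shows "summable (\<lambda>j. clipped_norm M (b j))"
proof -
  obtain C x0 where x0: "0 < x0" and C: "0 < C"
    and le: "\<And>x. x \<ge> x0 \<Longrightarrow> truncated_moment M x \<le> C * (x powr (2 - \<alpha>) * H x)"
    using truncated_moment_le_tail_normalizer[OF \<alpha> h H tail \<sigma>] by blast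
  have "\<forall>\<^sub>F j in sequentially. b j < inverse x0" using x0 by (intro order_tendstoD(2)[OF b(2)]) simp
  then have ev: "\<forall>\<^sub>F j in sequentially. norm (clipped_norm M (b j)) \<le> sqrt C * (b j powr (\<alpha> / 2) * sqrt (H (inverse (b j))))"
  proof eventually_elim
    case (elim j)
    have "x0 \<le> inverse (b j)" using elim b(1)[of j] x0 by (simp add: field_simps)
    from clipped_norm_le[OF b(1) C le[OF this]] show ?case by (simp add: clipped_norm_def norm2_nonneg)
  qed
  show ?thesis by (rule summable_comparison_test_ev[OF ev summable_mult[OF sum]])
qed

end

lemma (in linear_innovations) lin_law:
  assumes "finite J"
  shows "distr M borel (lin J n) = distr (Pi\<^sub>M J (\<lambda>_. \<mu>)) borel (\<lambda>x. \<Sum>j\<in>J. a j * x j)"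
proof -
  have inj: "inj_on (\<lambda>j. n - int j) J" by (simp add: inj_on_def)
  have "distr (Pi\<^sub>M J (\<lambda>_. \<mu>)) borel (\<lambda>x. \<Sum>j\<in>J. a j * x j)
      = distr M borel (\<lambda>\<omega>. \<Sum>j\<in>J. a j * (\<lambda>j\<in>J. \<epsilon> (n - int j) \<omega>) j)"
    unfolding window_law[OF inj, symmetric] by (subst distr_distr) (auto simp: comp_def)
  also have "\<dots> = distr M borel (lin J n)" by (simp add: lin_def[abs_def])
  finally show ?thesis ..
qed

lemma (in linear_innovations) char_lin:
  assumes J: "finite J" "J \<noteq> {}"
  shows "char (distr M borel (lin J n)) u = (\<Prod>j\<in>J. char \<mu> (a j * u))"
proof -
  let ?P = "Pi\<^sub>M J (\<lambda>_. \<mu>)"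
  interpret mu: prob_space \<mu> by (rule prob_space_mu)
  interpret P: prob_space ?P by (rule prob_space_PiM) unfold_locales
  have "P.indep_vars (\<lambda>_. \<mu>) (\<lambda>j x. x j) J"
    by (rule indep_vars_PiM_coordinates[OF J(2)]) unfold_locales
  then have ind: "P.indep_vars (\<lambda>_. borel) (\<lambda>j x. a j * x j) J" by (rule P.indep_vars_compose2) measurable
  have one: "char (distr ?P borel (\<lambda>x. a j * x j)) u = char \<mu> (a j * u)" if j: "j \<in> J" for j
  proof -
    have "distr ?P borel (\<lambda>x. a j * x j) = distr (distr ?P \<mu> (\<lambda>x. x j)) borel (\<lambda>y. a j * y)"
      using j by (subst distr_distr) (auto simp: comp_def)
    also have "distr ?P \<mu> (\<lambda>x. x j) = \<mu>"
      using j by (intro distr_PiM_component) unfold_locales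
    finally have eq: "distr ?P borel (\<lambda>x. a j * x j) = distr \<mu> borel (\<lambda>y. a j * y)" .
    show ?thesis unfolding eq char_def by (subst integral_distr) (auto simp: mult_ac)
  qed
  show ?thesis
    unfolding lin_law[OF J(1)] P.char_distr_sum[OF ind] using one by simp
qed

text \<open>Each factor of the characteristic function decays like \<open>\<bar>u\<bar> powr (-\<delta>)\<close>, so \<open>k\<close> of them with \<open>k * \<delta> \<ge> 3\<close> give cubic decay.\<close>
lemma (in linear_innovations) head_char_decay:
  assumes c: "c > 0" and pos: "\<And>j. j \<ge> 1 \<Longrightarrow> a j > 0" and k: "3 \<le> real k * \<delta>"
    and decay: "\<And>u. cmod (char \<mu> u) \<le> c / (1 + \<bar>u\<bar> powr \<delta>)"
  obtains D where "D \<ge> 1" "\<And>n u. 1 \<le> \<bar>u\<bar> \<Longrightarrow> cmod (char (distr M borel (lin {1..k} n)) u) \<le> D / \<bar>u\<bar> ^ 3"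
proof
  define D where "D = (\<Prod>j=1..k. c / a j powr \<delta>)"
  show "max 1 D \<ge> 1" by simp
  fix n u assume u: "1 \<le> \<bar>u :: real\<bar>"
  have k0: "k > 0" using k by (cases k) auto
  have D0: "0 \<le> D" unfolding D_def using c by (intro prod_nonneg) auto
  have "cmod (char (distr M borel (lin {1..k} n)) u) = (\<Prod>j=1..k. cmod (char \<mu> (a j * u)))"
    using k0 by (simp add: char_lin prod_norm)
  also have "\<dots> \<le> (\<Prod>j=1..k. c / a j powr \<delta> * \<bar>u\<bar> powr - \<delta>)"
  proof (intro prod_mono conjI)
    fix j assume "j \<in> {1..k}"
    then have a: "a j > 0" using pos by simp
    have p: "0 < a j powr \<delta> * \<bar>u\<bar> powr \<delta>" using a u by simp
    have "cmod (char \<mu> (a j * u)) \<le> c / (1 + \<bar>a j * u\<bar> powr \<delta>)" by (rule decay)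
    also have "\<dots> = c / (1 + a j powr \<delta> * \<bar>u\<bar> powr \<delta>)" using a by (simp add: abs_mult powr_mult)
    also have "\<dots> \<le> c / (a j powr \<delta> * \<bar>u\<bar> powr \<delta>)" using p c by (intro divide_left_mono) (auto intro!: mult_pos_pos)
    finally show "cmod (char \<mu> (a j * u)) \<le> c / a j powr \<delta> * \<bar>u\<bar> powr - \<delta>" by (simp add: powr_minus_divide)
  qed simp
  also have "\<dots> = D * (\<bar>u\<bar> powr - \<delta>) ^ k" unfolding D_def by (simp add: prod.distrib prod_dividef power_mult_distrib)
  also have "(\<bar>u\<bar> powr - \<delta>) ^ k = \<bar>u\<bar> powr (- (real k * \<delta>))"
    using u by (simp add: powr_realpow[symmetric] powr_powr mult_ac)
  also have "D * \<bar>u\<bar> powr (- (real k * \<delta>)) \<le> max 1 D * \<bar>u\<bar> powr (- 3)"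
    using u k D0 by (intro mult_mono powr_mono) auto
  also have "\<dots> = max 1 D / \<bar>u\<bar> ^ 3"
    using u powr_realpow[of "\<bar>u\<bar>" 3] by (simp add: powr_minus_divide)
  finally show "cmod (char (distr M borel (lin {1..k} n)) u) \<le> max 1 D / \<bar>u\<bar> ^ 3" .
qed

lemma (in smoothed_functional) central_limit:
  fixes S :: "nat \<Rightarrow> 'a \<Rightarrow> real"
  defines "S \<equiv> \<lambda>N \<omega>. \<Sum>n=1..N. centered_limit (int n) \<omega>"
  shows "\<exists>\<theta> :: real. (\<forall>N. square_integrable M (S N)) \<and>
    (\<lambda>N. variance (S N) / real N) \<longlonglongrightarrow> \<theta>\<^sup>2 \<and>
    (\<forall>(M' :: 'b measure) W. standard_brownian_motion M' W \<longrightarrow>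
       fdd_converges M (\<lambda>N t \<omega>. S (nat \<lfloor>real N * t\<rfloor>) \<omega> / sqrt (real N)) M' (\<lambda>t \<omega>. \<bar>\<theta>\<bar> * W t \<omega>))"
proof -
  have S_sq: "square_integrable M (S N)" for N
    unfolding S_def by (intro square_integrable_sum square_integrable_centered_limit)
  have S0: "S 0 = (\<lambda>_. 0)" by (simp add: S_def)
  have S_mean: "expectation (S N) = 0" for N
  proof -
    have "expectation (centered_limit n) = 0" for n
      unfolding centered_limit_def
      using square_integrable_integrable[OF square_integrable_comp_lin_limit(1)[OF K2]] by (simp add: prob_space)
    then show ?thesis
      unfolding S_def using square_integrable_integrable[OF square_integrable_centered_limit]
      by (subst Bochner_Integration.integral_sum) auto
  qed
  have \<eta>: "1 / real (Suc k) > 0" for k by simp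
  have "\<exists>B L c. block_approximable S (1 / real (Suc k)) B L c" for k
  proof (rule block_approximation[OF \<eta>[of k]])
    fix B :: "nat \<Rightarrow> 'a \<Rightarrow> real" and L :: nat and c :: real
    assume "L > 0" "indep_vars (\<lambda>_. borel) B UNIV" "\<And>b. distr M borel (B b) = distr M borel (B 0)"
      "\<And>b. square_integrable M (B b)" "\<And>b. expectation (B b) = 0"
      "\<And>N. norm2 M (\<lambda>\<omega>. (\<Sum>n=1..N. centered_limit (int n) \<omega>) - (\<Sum>b<N div L. B b \<omega>)) \<le> 1 / real (Suc k) * sqrt N + c"
    then have "block_approximable S (1 / real (Suc k)) B L c" unfolding block_approximable_def S_def by blast
    then show "\<exists>B L c. block_approximable S (1 / real (Suc k)) B L c" by blast
  qed
  then obtain B L c where blk: "\<And>k. block_approximable S (1 / real (Suc k)) (B k) (L k) (c k)" by metis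
  have \<eta>_lim: "(\<lambda>k. 1 / real (Suc k)) \<longlonglongrightarrow> 0"
    using LIMSEQ_inverse_real_of_nat by (simp add: inverse_eq_divide)
  obtain \<theta> where \<theta>: "0 \<le> \<theta>" and s_lim: "(\<lambda>N. norm2 M (S N) / sqrt (real N)) \<longlonglongrightarrow> \<theta>"
    and t_lim: "(\<lambda>k. norm2 M (B k 0) / sqrt (real (L k))) \<longlonglongrightarrow> \<theta>"
    by (rule normalized_norm2_convergent[OF S_sq S0 blk \<eta> \<eta>_lim])
  have "(\<lambda>N. (norm2 M (S N) / sqrt (real N))\<^sup>2) \<longlonglongrightarrow> \<theta>\<^sup>2" by (intro tendsto_power s_lim)
  then have "(\<lambda>N. variance (S N) / real N) \<longlonglongrightarrow> \<theta>\<^sup>2"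
    by (simp add: S_mean power_divide norm2_squared)
  moreover have "fdd_converges M (\<lambda>N t \<omega>. S (nat \<lfloor>real N * t\<rfloor>) \<omega> / sqrt (real N)) M' (\<lambda>t \<omega>. \<bar>\<theta>\<bar> * W t \<omega>)"
    if W: "standard_brownian_motion M' W" for M' :: "'b measure" and W
    by (rule block_approximable_fdd_converges[of S, OF S0 \<theta> W])
      (rule block_approximable_fdd[OF S_sq S0 blk \<eta> \<eta>_lim s_lim t_lim _ _ _ _ W])
  ultimately show ?thesis using S_sq by blast
qed

theorem theorem1p4:
  fixes M :: "'a measure"
    and \<epsilon> :: "int \<Rightarrow> 'a \<Rightarrow> real"
    and \<alpha> \<beta> \<sigma>1 \<sigma>2 c \<delta> :: real
    and h H \<l> K :: "real \<Rightarrow> real"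
    and a :: "nat \<Rightarrow> real"
    and X S :: "nat \<Rightarrow> 'a \<Rightarrow> real"
  assumes "prob_space M"
    and "0 < \<alpha>" "\<alpha> \<le> 2" "\<alpha> * \<beta> = 2" "\<beta> \<ge> 1"
    and indep: "prob_space.indep_vars M (\<lambda>_. borel) \<epsilon> UNIV"
    and ident: "\<And>n. distr M borel (\<epsilon> n) = distr M borel (\<epsilon> 1)"
    and attraction: "\<exists>\<nu>. stable_law \<alpha> \<nu> \<and> in_domain_of_attraction (distr M borel (\<epsilon> 1)) \<nu>"
    and symmetric: "\<alpha> = 1 \<Longrightarrow> distr M borel (\<lambda>\<omega>. - \<epsilon> 1 \<omega>) = distr M borel (\<epsilon> 1)"
    and mean_zero: "\<alpha> > 1 \<Longrightarrow> has_bochner_integral M (\<epsilon> 1) 0"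
    and "\<sigma>1 \<ge> 0" "\<sigma>2 \<ge> 0" "\<sigma>1 + \<sigma>2 > 0"
    and "slowly_varying h"
    and left_tail: "((\<lambda>x. measure M {\<omega> \<in> space M. \<epsilon> 1 \<omega> \<le> - x} / (x powr (- \<alpha>) * h x))
           \<longlongrightarrow> \<sigma>1) at_top"
    and right_tail: "((\<lambda>x. measure M {\<omega> \<in> space M. \<epsilon> 1 \<omega> > x} / (x powr (- \<alpha>) * h x))
           \<longlongrightarrow> \<sigma>2) at_top"
    and "tail_normalizer \<alpha> h H"
    and "slowly_varying \<l>"
    and coeff: "\<And>j. j \<ge> 1 \<Longrightarrow> a j = real j powr (- \<beta>) * \<l> (real j)"
    and K_integrable: "integrable lborel K"
    and K_square_integrable: "integrable lborel (\<lambda>x. (K x)\<^sup>2)"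
    and "c > 0" "\<delta> > 0"
    and char_decay: "\<And>u. cmod (char (distr M borel (\<epsilon> 1)) u) \<le> c / (1 + \<bar>u\<bar> powr \<delta>)"
    and short_memory: "summable (\<lambda>j. a (Suc j) powr (\<alpha> / 2) * sqrt (H (inverse (a (Suc j)))))"
  defines "X \<equiv> linear_process a \<epsilon>"
    and "S \<equiv> centered_sum M K X"
  shows "\<exists>\<theta> :: real.
    (\<forall>N. integrable M (\<lambda>\<omega>. (S N \<omega>)\<^sup>2)) \<and>
    (\<lambda>N. prob_space.variance M (S N) / real N) \<longlonglongrightarrow> \<theta>\<^sup>2 \<and>
    (\<forall>(M' :: 'b measure) W. standard_brownian_motion M' W \<longrightarrow>
       fdd_converges M (\<lambda>N t \<omega>. S (nat \<lfloor>real N * t\<rfloor>) \<omega> / sqrt (real N))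
         M' (\<lambda>t \<omega>. \<bar>\<theta>\<bar> * W t \<omega>))"
proof -
  interpret prob_space M by fact
  define \<mu> where "\<mu> = distr M borel (\<epsilon> 1)"
  have eps[measurable]: "\<epsilon> n \<in> borel_measurable M" for n using indep unfolding indep_vars_def by auto
  interpret \<mu>: real_distribution \<mu> unfolding \<mu>_def by (rule real_distribution_distr) simp
  have two_sided: "two_sided_tail \<mu> x = measure M {\<omega> \<in> space M. \<epsilon> 1 \<omega> \<le> - x} + measure M {\<omega> \<in> space M. \<epsilon> 1 \<omega> > x}"
    if "x > 0" for x
  proof -
    have "two_sided_tail \<mu> x = measure M ({\<omega> \<in> space M. \<epsilon> 1 \<omega> \<le> - x} \<union> {\<omega> \<in> space M. \<epsilon> 1 \<omega> > x})"
      unfolding two_sided_tail_def \<mu>_def by (subst measure_distr) (auto intro!: arg_cong[where f="measure M"])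
    also have "\<dots> = measure M {\<omega> \<in> space M. \<epsilon> 1 \<omega> \<le> - x} + measure M {\<omega> \<in> space M. \<epsilon> 1 \<omega> > x}"
      using that by (intro finite_measure_Union) auto
    finally show ?thesis .
  qed
  have tail: "((\<lambda>x. two_sided_tail \<mu> x / (x powr (- \<alpha>) * h x)) \<longlongrightarrow> \<sigma>1 + \<sigma>2) at_top"
  proof (rule Lim_transform_eventually[OF tendsto_add[OF left_tail right_tail]])
    show "\<forall>\<^sub>F x in at_top. measure M {\<omega> \<in> space M. \<epsilon> 1 \<omega> \<le> - x} / (x powr (- \<alpha>) * h x)
        + measure M {\<omega> \<in> space M. \<epsilon> 1 \<omega> > x} / (x powr (- \<alpha>) * h x) = two_sided_tail \<mu> x / (x powr (- \<alpha>) * h x)"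
      using eventually_gt_at_top[of 0] by eventually_elim (simp add: two_sided add_divide_distrib)
  qed
  have a_pos: "a j > 0" if "j \<ge> 1" for j
    using that \<open>slowly_varying \<l>\<close> by (simp add: coeff slowly_varying_def)
  have "(\<lambda>j. real j powr (- \<beta>) * \<l> (real j)) \<longlonglongrightarrow> 0"
    by (rule filterlim_compose[OF slowly_varying_powr_tendsto_0[OF \<open>slowly_varying \<l>\<close> \<open>\<beta> \<ge> 1\<close>] filterlim_real_sequentially])
  then have "(\<lambda>j. real (Suc j) powr (- \<beta>) * \<l> (real (Suc j))) \<longlonglongrightarrow> 0" by (rule LIMSEQ_Suc)
  then have a_lim: "(\<lambda>j. a (Suc j)) \<longlonglongrightarrow> 0" by (simp add: coeff del: of_nat_Suc)
  interpret lin: linear_innovations M \<epsilon> \<mu> a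
  proof
    show "indep_vars (\<lambda>_. borel) \<epsilon> UNIV" by (rule indep)
    show "distr M borel (\<epsilon> n) = \<mu>" for n unfolding \<mu>_def by (rule ident)
    show "summable (\<lambda>j. clipped_norm \<mu> (a (Suc j)))"
      by (rule \<mu>.summable_clipped_norm[OF \<open>0 < \<alpha>\<close> \<open>\<alpha> \<le> 2\<close> \<open>slowly_varying h\<close> \<open>tail_normalizer \<alpha> h H\<close> tail
            \<open>\<sigma>1 + \<sigma>2 > 0\<close> a_pos a_lim short_memory]) simp
  qed
  obtain k :: nat where "3 / \<delta> \<le> real k" using real_arch_simple by blast
  then have k: "3 \<le> real k * \<delta>" using \<open>\<delta> > 0\<close> by (simp add: field_simps)
  obtain D where D: "D \<ge> 1"
    "\<And>n u. 1 \<le> \<bar>u\<bar> \<Longrightarrow> cmod (char (distr M borel (lin.lin {1..k} n)) u) \<le> D / \<bar>u\<bar> ^ 3"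
    using lin.head_char_decay[OF \<open>c > 0\<close> a_pos k] char_decay unfolding \<mu>_def by blast
  interpret head: real_distribution "distr M borel (lin.lin {1..k} 0)" by (rule real_distribution_distr) simp
  obtain p C where p: "lipschitz_density p C" "distr M borel (lin.lin {1..k} 0) = density lborel (\<lambda>x. ennreal (p x))"
    using head.lipschitz_density_of_cubic_char_decay[OF D] by blast
  interpret smoothed_functional M \<epsilon> \<mu> a K k p C
  proof (rule smoothed_functional.intro[OF lin.linear_innovations_axioms], rule smoothed_functional_axioms.intro)
    show "lipschitz_density p C" by fact
    show "distr M borel (lin.lin {1..k} n) = density lborel (\<lambda>x. ennreal (p x))" for n
      using p(2) by (simp add: lin.lin_law)
    show "integrable lborel K" by fact
    show "square_integrable lborel K"
      using K_integrable K_square_integrable by (simp add: square_integrable_def)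
  qed
  have "linear_process a \<epsilon> n = lin.lin_limit (int n)" for n
    by (rule ext) (simp only: linear_process_def lin.lin_limit_def)
  then have S: "S = (\<lambda>N \<omega>. \<Sum>n=1..N. centered_limit (int n) \<omega>)"
    by (simp add: S_def X_def centered_sum_def[abs_def] centered_limit_def fun_eq_iff)
  show ?thesis
    unfolding S using central_limit by (auto simp: square_integrable_def)
qed

end
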